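(* Let $L:\mathscr A\to\mathscr B$, $R:\mathscr B\to\mathscr A$ be functors between categories with $L\dashv R$, where $\mathscr A$ is symmetric monoidal and the monad $R\circ L$ is strong. Let $\mathrm{Lin}:\mathscr M\to\mathscr A$ and $\mathrm{Mult}:\mathscr B\to\mathscr M$ form an $R$-relative linear-non-linear coadjunction. Then it induces a direct linear-non-linear adjunction between $\mathscr M$ and $\mathbf{dupl}_{L,R}$, with left adjoint $\mathrm{Lin}:\mathscr M\to\mathbf{dupl}_{L,R}$ and right adjoint $\mathrm{Mult}^-:\mathbf{dupl}_{L,R}\rightharpoonup\mathscr M$: that is, $(\mathrm{Lin},\mathrm{Mult}^-)$ is a positive adjunction, and the induced functor $\mathrm{Lin}:\mathscr M\to\mathscr P_t$ into the category $\mathscr P_t$ of positive objects and thunkable morphisms of $\mathbf{dupl}_{L,R}$ is strong monoidal (from the cartesian structure of $\mathscr M$ to the tensor product on $\mathscr P_t$).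
   Context: For a functor $R:\mathscr B\to\mathscr A$ with $\mathscr A$ symmetric monoidal, an $R$-relative linear-non-linear coadjunction consists of a category $\mathscr M$ with finite products, a strong monoidal functor $\mathrm{Lin}:\mathscr M\to\mathscr A$, a functor $\mathrm{Mult}:\mathscr B\to\mathscr M$, and bijections $\Psi_{X,B}:\mathscr A(\mathrm{Lin}X,RB)\cong\mathscr M(X,\mathrm{Mult}B)$ natural in $X$ and $B$. A non-associative category is a category without the associativity axiom. A bare functor $\rightharpoonup$ is a morphism of reflexive graphs (preserves identities, not necessarily composition). A morphism $f$ is thunkable if $(h\circ g)\circ f=h\circ(g\circ f)$ for all composable $g,h$; $h$ is linear if $(h\circ g)\circ f=h\circ(g\circ f)$ for all composable $f,g$. An object is positive if every morphism out of it is linear. An adjunction over non-associative categories $\mathscr D,\mathscr E$: bare functors $F:\mathscr D\rightharpoonup\mathscr E$, $G:\mathscr E\rightharpoonup\mathscr D$ with bijections $\varphi:\mathscr E(FA,B)\cong\mathscr D(A,GB)$ such that $\varphi(g\circ h)=Gg\circ\varphi(h)$ and $\varphi(h\circ Ff)=\varphi(h)\circ f$. It is positive if every $FA$ is positive. $\mathbf{dupl}_{L,R}$: objects $|\mathscr A|\uplus|\mathscr B|$; $X^+=X$, $X^-=LX$ for $X\in\mathscr A$ and $X^+=RX$, $X^-=X$ for $X\in\mathscr B$; $\mathbf{dupl}_{L,R}(X,Y)=\mathscr A(X^+,RY^-)$; the identity on $X$ is the unit $\eta_X$ if $X\in\mathscr A$, and $\mathrm{id}_{RX}$ if $X\in\mathscr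 B$; the composite of $f:X\to Z$ and $g:Z\to Y$ is $R(\hat g)\circ f$ if $Z\in\mathscr A$ ($\hat g:LZ\to Y^-$ the transpose of $g$) and $g\circ f$ if $Z\in\mathscr B$. Tensor product on $\mathbf{dupl}_{L,R}$ and on $\mathscr P_t$: $X\otimes Y:=X^+\otimes Y^+\in|\mathscr A|$, with unit the unit of $\mathscr A$. For $f\in\mathbf{dupl}_{L,R}(X,X')$ let $f^{\circ}:X^+\to RLX'^+$ be $f$ if $X'\in\mathscr A$, and $\eta_{RX'}\circ f$ if $X'\in\mathscr B$; for thunkable $f,g$, $f\otimes g$ is $f^\circ\otimes g^\circ$ followed by the double strength $RLX'^+\otimes RLY'^+\to RL(X'^+\otimes Y'^+)$ of the strong monad $RL$ (the choice of evaluation order is irrelevant for thunkable maps). This makes $\mathscr P_t$ a symmetric monoidal category. $\mathrm{Lin}:\mathscr M\to\mathbf{dupl}_{L,R}$ sends $X$ to $\mathrm{Lin}X\in|\mathscr A|$ and $f:X\to X'$ to $\eta_{\mathrm{Lin}X'}\circ\mathrm{Lin}f$. $\mathrm{Mult}^-X=\mathrm{Mult}(X^-)$; for $f\in\mathscr A(X^+,RY^-)$, $\mathrm{Mult}^-f=\mathrm{Mult}(\hat f)$ if $X\in\mathscr A$, and $\mathrm{Mult}^-f=\Psi_{\mathrm{Mult}X,Y^-}(f\circ\varepsilon_X)$ if $X\in\mathscr B$, where $\varepsilon_X=\Psi^{-1}(\mathrm{id}_{\mathrm{Mult}X}):\mathrm{Lin}\,\mathrm{Mult}X\to RX$. *)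

theory Defs
  imports Main
begin

section \<open>Non-associative categories\<close>

text \<open>
  Categories are given by families of hom-sets, which need not be disjoint. Composition is
  therefore indexed by objects: for \<open>f : X \<rightarrow> Y\<close> and \<open>g : Y \<rightarrow> Z\<close>, the composite is
  \<open>Comp C X Y Z g f\<close>. Likewise, the action of a functor on \<open>f : X \<rightarrow> Y\<close> is \<open>ar F X Y f\<close>.
  Nothing is required of the data outside \<open>Obj C\<close>.
\<close>

record ('o, 'm) cat =
  Obj :: "'o set"
  Hom :: "'o \<Rightarrow> 'o \<Rightarrow> 'm set"
  Ident :: "'o \<Rightarrow> 'm"
  Comp :: "'o \<Rightarrow> 'o \<Rightarrow> 'o \<Rightarrow> 'm \<Rightarrow> 'm \<Rightarrow> 'm"

record ('o, 'm, 'p, 'n) func =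
  ob :: "'o \<Rightarrow> 'p"
  ar :: "'o \<Rightarrow> 'o \<Rightarrow> 'm \<Rightarrow> 'n"

locale nonassoc_category =
  fixes C :: "('o, 'm, 'z) cat_scheme"
  assumes ident_hom: "X \<in> Obj C \<Longrightarrow> Ident C X \<in> Hom C X X"
    and comp_hom: "\<lbrakk>X \<in> Obj C; Y \<in> Obj C; Z \<in> Obj C; f \<in> Hom C X Y; g \<in> Hom C Y Z\<rbrakk>
      \<Longrightarrow> Comp C X Y Z g f \<in> Hom C X Z"
    and comp_ident_left: "\<lbrakk>X \<in> Obj C; Y \<in> Obj C; f \<in> Hom C X Y\<rbrakk>
      \<Longrightarrow> Comp C X Y Y (Ident C Y) f = f"
    and comp_ident_right: "\<lbrakk>X \<in> Obj C; Y \<in> Obj C; f \<in> Hom C X Y\<rbrakk>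
      \<Longrightarrow> Comp C X X Y f (Ident C X) = f"

locale category = nonassoc_category C for C :: "('o, 'm, 'z) cat_scheme" +
  assumes comp_assoc: "\<lbrakk>W \<in> Obj C; X \<in> Obj C; Y \<in> Obj C; Z \<in> Obj C;
      f \<in> Hom C W X; g \<in> Hom C X Y; h \<in> Hom C Y Z\<rbrakk>
      \<Longrightarrow> Comp C W X Z (Comp C X Y Z h g) f = Comp C W Y Z h (Comp C W X Y g f)"

definition is_iso :: "('o, 'm, 'z) cat_scheme \<Rightarrow> 'o \<Rightarrow> 'o \<Rightarrow> 'm \<Rightarrow> bool" where
  "is_iso C X Y f \<longleftrightarrow> f \<in> Hom C X Y \<and>
     (\<exists>g \<in> Hom C Y X. Comp C X Y X g f = Ident C X \<and> Comp C Y X Y f g = Ident C Y)"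

locale bare_functor = dom: nonassoc_category C + cod: nonassoc_category D
  for C :: "('o, 'm, 'y) cat_scheme" and D :: "('p, 'n, 'z) cat_scheme" +
  fixes F :: "('o, 'm, 'p, 'n) func"
  assumes ob_Obj: "X \<in> Obj C \<Longrightarrow> ob F X \<in> Obj D"
    and ar_Hom: "\<lbrakk>X \<in> Obj C; Y \<in> Obj C; f \<in> Hom C X Y\<rbrakk>
      \<Longrightarrow> ar F X Y f \<in> Hom D (ob F X) (ob F Y)"
    and ar_ident: "X \<in> Obj C \<Longrightarrow> ar F X X (Ident C X) = Ident D (ob F X)"

locale cat_functor = bare_functor C D F + dom: category C + cod: category D
  for C :: "('o, 'm, 'y) cat_scheme" and D :: "('p, 'n, 'z) cat_scheme"
    and F :: "('o, 'm, 'p, 'n) func" +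
  assumes ar_comp: "\<lbrakk>X \<in> Obj C; Y \<in> Obj C; Z \<in> Obj C; f \<in> Hom C X Y; g \<in> Hom C Y Z\<rbrakk>
      \<Longrightarrow> ar F X Z (Comp C X Y Z g f)
        = Comp D (ob F X) (ob F Y) (ob F Z) (ar F Y Z g) (ar F X Y f)"

definition func_comp ::
    "('p, 'n, 'q, 'k) func \<Rightarrow> ('o, 'm, 'p, 'n) func \<Rightarrow> ('o, 'm, 'q, 'k) func" where
  "func_comp G F = \<lparr>ob = \<lambda>X. ob G (ob F X),
     ar = \<lambda>X Y f. ar G (ob F X) (ob F Y) (ar F X Y f)\<rparr>"

definition thunkable :: "('o, 'm, 'z) cat_scheme \<Rightarrow> 'o \<Rightarrow> 'o \<Rightarrow> 'm \<Rightarrow> bool" where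
  "thunkable C X Y f \<longleftrightarrow>
     (\<forall>Z \<in> Obj C. \<forall>W \<in> Obj C. \<forall>g \<in> Hom C Y Z. \<forall>h \<in> Hom C Z W.
        Comp C X Y W (Comp C Y Z W h g) f = Comp C X Z W h (Comp C X Y Z g f))"

definition linear :: "('o, 'm, 'z) cat_scheme \<Rightarrow> 'o \<Rightarrow> 'o \<Rightarrow> 'm \<Rightarrow> bool" where
  "linear C X Y h \<longleftrightarrow>
     (\<forall>V \<in> Obj C. \<forall>U \<in> Obj C. \<forall>f \<in> Hom C V U. \<forall>g \<in> Hom C U X.
        Comp C V U Y (Comp C U X Y h g) f = Comp C V X Y h (Comp C V U X g f))"

definition positive :: "('o, 'm, 'z) cat_scheme \<Rightarrow> 'o \<Rightarrow> bool" where
  "positive C X \<longleftrightarrow> (\<forall>Y \<in> Obj C. \<forall>h \<in> Hom C X Y. linear C X Y h)"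

text \<open>
  Over (associative) categories and functors, the following is the usual notion of an
  adjunction \<open>F \<stileturn> G\<close>, with \<open>\<phi> X Y : E(F X, Y) \<cong> D(X, G Y)\<close>.
\<close>

locale adjunction = left: bare_functor D E F + right: bare_functor E D G
  for D :: "('o, 'm, 'y) cat_scheme" and E :: "('p, 'n, 'z) cat_scheme"
    and F :: "('o, 'm, 'p, 'n) func" and G :: "('p, 'n, 'o, 'm) func" +
  fixes \<phi> :: "'o \<Rightarrow> 'p \<Rightarrow> 'n \<Rightarrow> 'm"
  assumes bij: "\<lbrakk>X \<in> Obj D; Y \<in> Obj E\<rbrakk>
      \<Longrightarrow> bij_betw (\<phi> X Y) (Hom E (ob F X) Y) (Hom D X (ob G Y))"
    and nat_right: "\<lbrakk>X \<in> Obj D; Y \<in> Obj E; Z \<in> Obj E; h \<in> Hom E (ob F X) Y; g \<in> Hom E Y Z\<rbrakk>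
      \<Longrightarrow> \<phi> X Z (Comp E (ob F X) Y Z g h) = Comp D X (ob G Y) (ob G Z) (ar G Y Z g) (\<phi> X Y h)"
    and nat_left: "\<lbrakk>W \<in> Obj D; X \<in> Obj D; Y \<in> Obj E; f \<in> Hom D W X; h \<in> Hom E (ob F X) Y\<rbrakk>
      \<Longrightarrow> \<phi> W Y (Comp E (ob F W) (ob F X) Y h (ar F W X f)) = Comp D W X (ob G Y) (\<phi> X Y h) f"

locale positive_adjunction = adjunction D E F G \<phi>
  for D :: "('o, 'm, 'y) cat_scheme" and E :: "('p, 'n, 'z) cat_scheme"
    and F :: "('o, 'm, 'p, 'n) func" and G :: "('p, 'n, 'o, 'm) func"
    and \<phi> :: "'o \<Rightarrow> 'p \<Rightarrow> 'n \<Rightarrow> 'm" +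
  assumes positive_left: "X \<in> Obj D \<Longrightarrow> positive E (ob F X)"

definition adj_unit ::
    "('p, 'n, 'z) cat_scheme \<Rightarrow> ('o, 'm, 'p, 'n) func \<Rightarrow> ('o \<Rightarrow> 'p \<Rightarrow> 'n \<Rightarrow> 'm) \<Rightarrow> 'o \<Rightarrow> 'm" where
  "adj_unit E F \<phi> X = \<phi> X (ob F X) (Ident E (ob F X))"

text \<open>The transpose \<open>F X \<rightarrow> Y\<close> of a morphism \<open>g : X \<rightarrow> G Y\<close>.\<close>

definition adj_transpose ::
    "('p, 'n, 'z) cat_scheme \<Rightarrow> ('o, 'm, 'p, 'n) func \<Rightarrow> ('o \<Rightarrow> 'p \<Rightarrow> 'n \<Rightarrow> 'm)
      \<Rightarrow> 'o \<Rightarrow> 'p \<Rightarrow> 'm \<Rightarrow> 'n" where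
  "adj_transpose E F \<phi> X Y g = the_inv_into (Hom E (ob F X) Y) (\<phi> X Y) g"

text \<open>The multiplication \<open>G \<epsilon> F\<close> of the monad \<open>G F\<close> on \<open>D\<close>.\<close>

definition adj_mult ::
    "('o, 'm, 'y) cat_scheme \<Rightarrow> ('p, 'n, 'z) cat_scheme \<Rightarrow> ('o, 'm, 'p, 'n) func
      \<Rightarrow> ('p, 'n, 'o, 'm) func \<Rightarrow> ('o \<Rightarrow> 'p \<Rightarrow> 'n \<Rightarrow> 'm) \<Rightarrow> 'o \<Rightarrow> 'm" where
  "adj_mult D E F G \<phi> X =
     (let GFX = ob G (ob F X)
      in ar G (ob F GFX) (ob F X) (adj_transpose E F \<phi> GFX (ob F X) (Ident D GFX)))"


section \<open>Monoidal structure\<close>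

text \<open>For \<open>f : X \<rightarrow> X'\<close> and \<open>g : Y \<rightarrow> Y'\<close>, the morphism \<open>f \<otimes> g\<close> is \<open>tensA C X X' Y Y' f g\<close>.\<close>

record ('o, 'm) moncat = "('o, 'm) cat" +
  tens :: "'o \<Rightarrow> 'o \<Rightarrow> 'o" (infixl "\<otimes>\<index>" 70)
  tensA :: "'o \<Rightarrow> 'o \<Rightarrow> 'o \<Rightarrow> 'o \<Rightarrow> 'm \<Rightarrow> 'm \<Rightarrow> 'm"
  unitO :: "'o" ("\<one>\<index>")
  assoc :: "'o \<Rightarrow> 'o \<Rightarrow> 'o \<Rightarrow> 'm"
  lunit :: "'o \<Rightarrow> 'm"
  runit :: "'o \<Rightarrow> 'm"

record ('o, 'm) smoncat = "('o, 'm) moncat" +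
  swap :: "'o \<Rightarrow> 'o \<Rightarrow> 'm"

locale monoidal_category = category C
  for C :: "('o, 'm, 'z) moncat_scheme" (structure) +
  assumes tens_Obj: "\<lbrakk>X \<in> Obj C; Y \<in> Obj C\<rbrakk> \<Longrightarrow> X \<otimes> Y \<in> Obj C"
    and unit_Obj: "\<one> \<in> Obj C"
    and tensA_Hom: "\<lbrakk>X \<in> Obj C; X' \<in> Obj C; Y \<in> Obj C; Y' \<in> Obj C;
        f \<in> Hom C X X'; g \<in> Hom C Y Y'\<rbrakk>
      \<Longrightarrow> tensA C X X' Y Y' f g \<in> Hom C (X \<otimes> Y) (X' \<otimes> Y')"
    and tensA_ident: "\<lbrakk>X \<in> Obj C; Y \<in> Obj C\<rbrakk>
      \<Longrightarrow> tensA C X X Y Y (Ident C X) (Ident C Y) = Ident C (X \<otimes> Y)"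
    and tensA_comp: "\<lbrakk>X \<in> Obj C; X' \<in> Obj C; X'' \<in> Obj C; Y \<in> Obj C; Y' \<in> Obj C; Y'' \<in> Obj C;
        f \<in> Hom C X X'; f' \<in> Hom C X' X''; g \<in> Hom C Y Y'; g' \<in> Hom C Y' Y''\<rbrakk>
      \<Longrightarrow> tensA C X X'' Y Y'' (Comp C X X' X'' f' f) (Comp C Y Y' Y'' g' g)
        = Comp C (X \<otimes> Y) (X' \<otimes> Y') (X'' \<otimes> Y'')
            (tensA C X' X'' Y' Y'' f' g') (tensA C X X' Y Y' f g)"
    and assoc_iso: "\<lbrakk>X \<in> Obj C; Y \<in> Obj C; Z \<in> Obj C\<rbrakk>
      \<Longrightarrow> is_iso C ((X \<otimes> Y) \<otimes> Z) (X \<otimes> (Y \<otimes> Z)) (assoc C X Y Z)"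
    and lunit_iso: "X \<in> Obj C \<Longrightarrow> is_iso C (\<one> \<otimes> X) X (lunit C X)"
    and runit_iso: "X \<in> Obj C \<Longrightarrow> is_iso C (X \<otimes> \<one>) X (runit C X)"
    and assoc_nat: "\<lbrakk>X \<in> Obj C; X' \<in> Obj C; Y \<in> Obj C; Y' \<in> Obj C; Z \<in> Obj C; Z' \<in> Obj C;
        f \<in> Hom C X X'; g \<in> Hom C Y Y'; h \<in> Hom C Z Z'\<rbrakk>
      \<Longrightarrow> Comp C ((X \<otimes> Y) \<otimes> Z) ((X' \<otimes> Y') \<otimes> Z') (X' \<otimes> (Y' \<otimes> Z'))
            (assoc C X' Y' Z') (tensA C (X \<otimes> Y) (X' \<otimes> Y') Z Z' (tensA C X X' Y Y' f g) h)
        = Comp C ((X \<otimes> Y) \<otimes> Z) (X \<otimes> (Y \<otimes> Z)) (X' \<otimes> (Y' \<otimes> Z'))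
            (tensA C X X' (Y \<otimes> Z) (Y' \<otimes> Z') f (tensA C Y Y' Z Z' g h)) (assoc C X Y Z)"
    and lunit_nat: "\<lbrakk>X \<in> Obj C; X' \<in> Obj C; f \<in> Hom C X X'\<rbrakk>
      \<Longrightarrow> Comp C (\<one> \<otimes> X) (\<one> \<otimes> X') X' (lunit C X') (tensA C \<one> \<one> X X' (Ident C \<one>) f)
        = Comp C (\<one> \<otimes> X) X X' f (lunit C X)"
    and runit_nat: "\<lbrakk>X \<in> Obj C; X' \<in> Obj C; f \<in> Hom C X X'\<rbrakk>
      \<Longrightarrow> Comp C (X \<otimes> \<one>) (X' \<otimes> \<one>) X' (runit C X') (tensA C X X' \<one> \<one> f (Ident C \<one>))
        = Comp C (X \<otimes> \<one>) X X' f (runit C X)"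
    and pentagon: "\<lbrakk>W \<in> Obj C; X \<in> Obj C; Y \<in> Obj C; Z \<in> Obj C\<rbrakk>
      \<Longrightarrow> Comp C (((W \<otimes> X) \<otimes> Y) \<otimes> Z) ((W \<otimes> X) \<otimes> (Y \<otimes> Z)) (W \<otimes> (X \<otimes> (Y \<otimes> Z)))
            (assoc C W X (Y \<otimes> Z)) (assoc C (W \<otimes> X) Y Z)
        = Comp C (((W \<otimes> X) \<otimes> Y) \<otimes> Z) (W \<otimes> ((X \<otimes> Y) \<otimes> Z)) (W \<otimes> (X \<otimes> (Y \<otimes> Z)))
            (tensA C W W ((X \<otimes> Y) \<otimes> Z) (X \<otimes> (Y \<otimes> Z)) (Ident C W) (assoc C X Y Z))
            (Comp C (((W \<otimes> X) \<otimes> Y) \<otimes> Z) ((W \<otimes> (X \<otimes> Y)) \<otimes> Z) (W \<otimes> ((X \<otimes> Y) \<otimes> Z))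
              (assoc C W (X \<otimes> Y) Z)
              (tensA C ((W \<otimes> X) \<otimes> Y) (W \<otimes> (X \<otimes> Y)) Z Z (assoc C W X Y) (Ident C Z)))"
    and triangle: "\<lbrakk>X \<in> Obj C; Y \<in> Obj C\<rbrakk>
      \<Longrightarrow> Comp C ((X \<otimes> \<one>) \<otimes> Y) (X \<otimes> (\<one> \<otimes> Y)) (X \<otimes> Y)
            (tensA C X X (\<one> \<otimes> Y) Y (Ident C X) (lunit C Y)) (assoc C X \<one> Y)
        = tensA C (X \<otimes> \<one>) X Y Y (runit C X) (Ident C Y)"

locale symmetric_monoidal_category = monoidal_category C
  for C :: "('o, 'm, 'z) smoncat_scheme" (structure) +
  assumes swap_Hom: "\<lbrakk>X \<in> Obj C; Y \<in> Obj C\<rbrakk> \<Longrightarrow> swap C X Y \<in> Hom C (X \<otimes> Y) (Y \<otimes> X)"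
    and swap_swap: "\<lbrakk>X \<in> Obj C; Y \<in> Obj C\<rbrakk>
      \<Longrightarrow> Comp C (X \<otimes> Y) (Y \<otimes> X) (X \<otimes> Y) (swap C Y X) (swap C X Y) = Ident C (X \<otimes> Y)"
    and swap_nat: "\<lbrakk>X \<in> Obj C; X' \<in> Obj C; Y \<in> Obj C; Y' \<in> Obj C;
        f \<in> Hom C X X'; g \<in> Hom C Y Y'\<rbrakk>
      \<Longrightarrow> Comp C (X \<otimes> Y) (X' \<otimes> Y') (Y' \<otimes> X') (swap C X' Y') (tensA C X X' Y Y' f g)
        = Comp C (X \<otimes> Y) (Y \<otimes> X) (Y' \<otimes> X') (tensA C Y Y' X X' g f) (swap C X Y)"
    and swap_unit: "X \<in> Obj C
      \<Longrightarrow> Comp C (X \<otimes> \<one>) (\<one> \<otimes> X) X (lunit C X) (swap C X \<one>) = runit C X"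
    and hexagon: "\<lbrakk>X \<in> Obj C; Y \<in> Obj C; Z \<in> Obj C\<rbrakk>
      \<Longrightarrow> Comp C ((X \<otimes> Y) \<otimes> Z) ((Y \<otimes> Z) \<otimes> X) (Y \<otimes> (Z \<otimes> X)) (assoc C Y Z X)
            (Comp C ((X \<otimes> Y) \<otimes> Z) (X \<otimes> (Y \<otimes> Z)) ((Y \<otimes> Z) \<otimes> X)
              (swap C X (Y \<otimes> Z)) (assoc C X Y Z))
        = Comp C ((X \<otimes> Y) \<otimes> Z) (Y \<otimes> (X \<otimes> Z)) (Y \<otimes> (Z \<otimes> X))
            (tensA C Y Y (X \<otimes> Z) (Z \<otimes> X) (Ident C Y) (swap C X Z))
            (Comp C ((X \<otimes> Y) \<otimes> Z) ((Y \<otimes> X) \<otimes> Z) (Y \<otimes> (X \<otimes> Z)) (assoc C Y X Z)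
              (tensA C (X \<otimes> Y) (Y \<otimes> X) Z Z (swap C X Y) (Ident C Z)))"

locale strong_monoidal_functor = cat_functor C D F + dom: monoidal_category C
    + cod: monoidal_category D
  for C :: "('o, 'm, 'y) moncat_scheme" (structure)
    and D :: "('p, 'n, 'z) moncat_scheme" (structure)
    and F :: "('o, 'm, 'p, 'n) func" +
  fixes m2 :: "'o \<Rightarrow> 'o \<Rightarrow> 'n" and m0 :: 'n
  assumes m2_iso: "\<lbrakk>X \<in> Obj C; Y \<in> Obj C\<rbrakk>
      \<Longrightarrow> is_iso D (ob F X \<otimes>\<^bsub>D\<^esub> ob F Y) (ob F (X \<otimes> Y)) (m2 X Y)"
    and m0_iso: "is_iso D \<one>\<^bsub>D\<^esub> (ob F \<one>) m0"
    and m2_nat: "\<lbrakk>X \<in> Obj C; X' \<in> Obj C; Y \<in> Obj C; Y' \<in> Obj C;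
        f \<in> Hom C X X'; g \<in> Hom C Y Y'\<rbrakk>
      \<Longrightarrow> Comp D (ob F X \<otimes>\<^bsub>D\<^esub> ob F Y) (ob F X' \<otimes>\<^bsub>D\<^esub> ob F Y') (ob F (X' \<otimes> Y'))
            (m2 X' Y') (tensA D (ob F X) (ob F X') (ob F Y) (ob F Y') (ar F X X' f) (ar F Y Y' g))
        = Comp D (ob F X \<otimes>\<^bsub>D\<^esub> ob F Y) (ob F (X \<otimes> Y)) (ob F (X' \<otimes> Y'))
            (ar F (X \<otimes> Y) (X' \<otimes> Y') (tensA C X X' Y Y' f g)) (m2 X Y)"
    and m2_assoc: "\<lbrakk>X \<in> Obj C; Y \<in> Obj C; Z \<in> Obj C\<rbrakk>
      \<Longrightarrow> Comp D ((ob F X \<otimes>\<^bsub>D\<^esub> ob F Y) \<otimes>\<^bsub>D\<^esub> ob F Z) (ob F ((X \<otimes> Y) \<otimes> Z)) (ob F (X \<otimes> (Y \<otimes> Z)))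
            (ar F ((X \<otimes> Y) \<otimes> Z) (X \<otimes> (Y \<otimes> Z)) (assoc C X Y Z))
            (Comp D ((ob F X \<otimes>\<^bsub>D\<^esub> ob F Y) \<otimes>\<^bsub>D\<^esub> ob F Z) (ob F (X \<otimes> Y) \<otimes>\<^bsub>D\<^esub> ob F Z)
              (ob F ((X \<otimes> Y) \<otimes> Z))
              (m2 (X \<otimes> Y) Z)
              (tensA D (ob F X \<otimes>\<^bsub>D\<^esub> ob F Y) (ob F (X \<otimes> Y)) (ob F Z) (ob F Z)
                (m2 X Y) (Ident D (ob F Z))))
        = Comp D ((ob F X \<otimes>\<^bsub>D\<^esub> ob F Y) \<otimes>\<^bsub>D\<^esub> ob F Z) (ob F X \<otimes>\<^bsub>D\<^esub> ob F (Y \<otimes> Z))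
            (ob F (X \<otimes> (Y \<otimes> Z)))
            (m2 X (Y \<otimes> Z))
            (Comp D ((ob F X \<otimes>\<^bsub>D\<^esub> ob F Y) \<otimes>\<^bsub>D\<^esub> ob F Z) (ob F X \<otimes>\<^bsub>D\<^esub> (ob F Y \<otimes>\<^bsub>D\<^esub> ob F Z))
              (ob F X \<otimes>\<^bsub>D\<^esub> ob F (Y \<otimes> Z))
              (tensA D (ob F X) (ob F X) (ob F Y \<otimes>\<^bsub>D\<^esub> ob F Z) (ob F (Y \<otimes> Z))
                (Ident D (ob F X)) (m2 Y Z))
              (assoc D (ob F X) (ob F Y) (ob F Z)))"
    and m2_lunit: "X \<in> Obj C
      \<Longrightarrow> Comp D (\<one>\<^bsub>D\<^esub> \<otimes>\<^bsub>D\<^esub> ob F X) (ob F (\<one> \<otimes> X)) (ob F X)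
            (ar F (\<one> \<otimes> X) X (lunit C X))
            (Comp D (\<one>\<^bsub>D\<^esub> \<otimes>\<^bsub>D\<^esub> ob F X) (ob F \<one> \<otimes>\<^bsub>D\<^esub> ob F X) (ob F (\<one> \<otimes> X)) (m2 \<one> X)
              (tensA D \<one>\<^bsub>D\<^esub> (ob F \<one>) (ob F X) (ob F X) m0 (Ident D (ob F X))))
        = lunit D (ob F X)"
    and m2_runit: "X \<in> Obj C
      \<Longrightarrow> Comp D (ob F X \<otimes>\<^bsub>D\<^esub> \<one>\<^bsub>D\<^esub>) (ob F (X \<otimes> \<one>)) (ob F X)
            (ar F (X \<otimes> \<one>) X (runit C X))
            (Comp D (ob F X \<otimes>\<^bsub>D\<^esub> \<one>\<^bsub>D\<^esub>) (ob F X \<otimes>\<^bsub>D\<^esub> ob F \<one>) (ob F (X \<otimes> \<one>)) (m2 X \<one>)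
              (tensA D (ob F X) (ob F X) \<one>\<^bsub>D\<^esub> (ob F \<one>) (Ident D (ob F X)) m0))
        = runit D (ob F X)"


section \<open>Strong monads\<close>

locale monad = cat_functor C C T
  for C :: "('o, 'm, 'z) cat_scheme" and T :: "('o, 'm, 'o, 'm) func" +
  fixes \<eta> :: "'o \<Rightarrow> 'm" and \<mu> :: "'o \<Rightarrow> 'm"
  assumes unit_Hom: "X \<in> Obj C \<Longrightarrow> \<eta> X \<in> Hom C X (ob T X)"
    and mult_Hom: "X \<in> Obj C \<Longrightarrow> \<mu> X \<in> Hom C (ob T (ob T X)) (ob T X)"
    and unit_nat: "\<lbrakk>X \<in> Obj C; Y \<in> Obj C; f \<in> Hom C X Y\<rbrakk>
      \<Longrightarrow> Comp C X (ob T X) (ob T Y) (ar T X Y f) (\<eta> X) = Comp C X Y (ob T Y) (\<eta> Y) f"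
    and mult_nat: "\<lbrakk>X \<in> Obj C; Y \<in> Obj C; f \<in> Hom C X Y\<rbrakk>
      \<Longrightarrow> Comp C (ob T (ob T X)) (ob T X) (ob T Y) (ar T X Y f) (\<mu> X)
        = Comp C (ob T (ob T X)) (ob T (ob T Y)) (ob T Y)
            (\<mu> Y) (ar T (ob T X) (ob T Y) (ar T X Y f))"
    and mult_unit_left: "X \<in> Obj C
      \<Longrightarrow> Comp C (ob T X) (ob T (ob T X)) (ob T X) (\<mu> X) (\<eta> (ob T X)) = Ident C (ob T X)"
    and mult_unit_right: "X \<in> Obj C
      \<Longrightarrow> Comp C (ob T X) (ob T (ob T X)) (ob T X) (\<mu> X) (ar T X (ob T X) (\<eta> X))
        = Ident C (ob T X)"
    and mult_mult: "X \<in> Obj C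
      \<Longrightarrow> Comp C (ob T (ob T (ob T X))) (ob T (ob T X)) (ob T X) (\<mu> X) (\<mu> (ob T X))
        = Comp C (ob T (ob T (ob T X))) (ob T (ob T X)) (ob T X)
            (\<mu> X) (ar T (ob T (ob T X)) (ob T X) (\<mu> X))"

text \<open>The strength is the family \<open>st X Y : X \<otimes> T Y \<rightarrow> T (X \<otimes> Y)\<close>.\<close>

locale strong_monad = monad C T \<eta> \<mu> + monoidal_category C
  for C :: "('o, 'm, 'z) moncat_scheme" (structure) and T :: "('o, 'm, 'o, 'm) func"
    and \<eta> :: "'o \<Rightarrow> 'm" and \<mu> :: "'o \<Rightarrow> 'm" +
  fixes st :: "'o \<Rightarrow> 'o \<Rightarrow> 'm"
  assumes st_Hom: "\<lbrakk>X \<in> Obj C; Y \<in> Obj C\<rbrakk> \<Longrightarrow> st X Y \<in> Hom C (X \<otimes> ob T Y) (ob T (X \<otimes> Y))"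
    and st_nat: "\<lbrakk>X \<in> Obj C; X' \<in> Obj C; Y \<in> Obj C; Y' \<in> Obj C;
        f \<in> Hom C X X'; g \<in> Hom C Y Y'\<rbrakk>
      \<Longrightarrow> Comp C (X \<otimes> ob T Y) (X' \<otimes> ob T Y') (ob T (X' \<otimes> Y'))
            (st X' Y') (tensA C X X' (ob T Y) (ob T Y') f (ar T Y Y' g))
        = Comp C (X \<otimes> ob T Y) (ob T (X \<otimes> Y)) (ob T (X' \<otimes> Y'))
            (ar T (X \<otimes> Y) (X' \<otimes> Y') (tensA C X X' Y Y' f g)) (st X Y)"
    and st_lunit: "X \<in> Obj C
      \<Longrightarrow> Comp C (\<one> \<otimes> ob T X) (ob T (\<one> \<otimes> X)) (ob T X) (ar T (\<one> \<otimes> X) X (lunit C X)) (st \<one> X)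
        = lunit C (ob T X)"
    and st_assoc: "\<lbrakk>X \<in> Obj C; Y \<in> Obj C; Z \<in> Obj C\<rbrakk>
      \<Longrightarrow> Comp C ((X \<otimes> Y) \<otimes> ob T Z) (ob T ((X \<otimes> Y) \<otimes> Z)) (ob T (X \<otimes> (Y \<otimes> Z)))
            (ar T ((X \<otimes> Y) \<otimes> Z) (X \<otimes> (Y \<otimes> Z)) (assoc C X Y Z)) (st (X \<otimes> Y) Z)
        = Comp C ((X \<otimes> Y) \<otimes> ob T Z) (X \<otimes> ob T (Y \<otimes> Z)) (ob T (X \<otimes> (Y \<otimes> Z)))
            (st X (Y \<otimes> Z))
            (Comp C ((X \<otimes> Y) \<otimes> ob T Z) (X \<otimes> (Y \<otimes> ob T Z)) (X \<otimes> ob T (Y \<otimes> Z))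
              (tensA C X X (Y \<otimes> ob T Z) (ob T (Y \<otimes> Z)) (Ident C X) (st Y Z))
              (assoc C X Y (ob T Z)))"
    and st_unit: "\<lbrakk>X \<in> Obj C; Y \<in> Obj C\<rbrakk>
      \<Longrightarrow> Comp C (X \<otimes> Y) (X \<otimes> ob T Y) (ob T (X \<otimes> Y))
            (st X Y) (tensA C X X Y (ob T Y) (Ident C X) (\<eta> Y))
        = \<eta> (X \<otimes> Y)"
    and st_mult: "\<lbrakk>X \<in> Obj C; Y \<in> Obj C\<rbrakk>
      \<Longrightarrow> Comp C (X \<otimes> ob T (ob T Y)) (X \<otimes> ob T Y) (ob T (X \<otimes> Y))
            (st X Y) (tensA C X X (ob T (ob T Y)) (ob T Y) (Ident C X) (\<mu> Y))
        = Comp C (X \<otimes> ob T (ob T Y)) (ob T (ob T (X \<otimes> Y))) (ob T (X \<otimes> Y))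
            (\<mu> (X \<otimes> Y))
            (Comp C (X \<otimes> ob T (ob T Y)) (ob T (X \<otimes> ob T Y)) (ob T (ob T (X \<otimes> Y)))
              (ar T (X \<otimes> ob T Y) (ob T (X \<otimes> Y)) (st X Y)) (st X (ob T Y)))"

text \<open>The costrength \<open>T X \<otimes> Y \<rightarrow> T (X \<otimes> Y)\<close>, obtained from the strength by symmetry.\<close>

definition costrength ::
    "('o, 'm, 'z) smoncat_scheme \<Rightarrow> ('o, 'm, 'o, 'm) func \<Rightarrow> ('o \<Rightarrow> 'o \<Rightarrow> 'm) \<Rightarrow> 'o \<Rightarrow> 'o \<Rightarrow> 'm" where
  "costrength C T st X Y =
     Comp C (ob T X \<otimes>\<^bsub>C\<^esub> Y) (ob T (Y \<otimes>\<^bsub>C\<^esub> X)) (ob T (X \<otimes>\<^bsub>C\<^esub> Y))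
       (ar T (Y \<otimes>\<^bsub>C\<^esub> X) (X \<otimes>\<^bsub>C\<^esub> Y) (swap C Y X))
       (Comp C (ob T X \<otimes>\<^bsub>C\<^esub> Y) (Y \<otimes>\<^bsub>C\<^esub> ob T X) (ob T (Y \<otimes>\<^bsub>C\<^esub> X)) (st Y X) (swap C (ob T X) Y))"

text \<open>
  The double strength \<open>T X \<otimes> T Y \<rightarrow> T (X \<otimes> Y)\<close> that evaluates the left argument first.
  It agrees with the other one on pairs of thunkable maps.
\<close>

definition double_strength ::
    "('o, 'm, 'z) smoncat_scheme \<Rightarrow> ('o, 'm, 'o, 'm) func \<Rightarrow> ('o \<Rightarrow> 'm) \<Rightarrow> ('o \<Rightarrow> 'o \<Rightarrow> 'm)
      \<Rightarrow> 'o \<Rightarrow> 'o \<Rightarrow> 'm" where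
  "double_strength C T \<mu> st X Y =
     Comp C (ob T X \<otimes>\<^bsub>C\<^esub> ob T Y) (ob T (ob T (X \<otimes>\<^bsub>C\<^esub> Y))) (ob T (X \<otimes>\<^bsub>C\<^esub> Y))
       (\<mu> (X \<otimes>\<^bsub>C\<^esub> Y))
       (Comp C (ob T X \<otimes>\<^bsub>C\<^esub> ob T Y) (ob T (X \<otimes>\<^bsub>C\<^esub> ob T Y)) (ob T (ob T (X \<otimes>\<^bsub>C\<^esub> Y)))
         (ar T (X \<otimes>\<^bsub>C\<^esub> ob T Y) (ob T (X \<otimes>\<^bsub>C\<^esub> Y)) (st X Y)) (costrength C T st X (ob T Y)))"


section \<open>Finite products\<close>

record ('o, 'm) prodcat = "('o, 'm) cat" +
  terminal :: "'o"
  prodO :: "'o \<Rightarrow> 'o \<Rightarrow> 'o"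
  proj1 :: "'o \<Rightarrow> 'o \<Rightarrow> 'm"
  proj2 :: "'o \<Rightarrow> 'o \<Rightarrow> 'm"

locale category_with_finite_products = category C
  for C :: "('o, 'm, 'z) prodcat_scheme" +
  assumes terminal_Obj: "terminal C \<in> Obj C"
    and terminal_univ: "X \<in> Obj C \<Longrightarrow> \<exists>!f. f \<in> Hom C X (terminal C)"
    and prod_Obj: "\<lbrakk>X \<in> Obj C; Y \<in> Obj C\<rbrakk> \<Longrightarrow> prodO C X Y \<in> Obj C"
    and proj1_Hom: "\<lbrakk>X \<in> Obj C; Y \<in> Obj C\<rbrakk> \<Longrightarrow> proj1 C X Y \<in> Hom C (prodO C X Y) X"
    and proj2_Hom: "\<lbrakk>X \<in> Obj C; Y \<in> Obj C\<rbrakk> \<Longrightarrow> proj2 C X Y \<in> Hom C (prodO C X Y) Y"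
    and prod_univ: "\<lbrakk>W \<in> Obj C; X \<in> Obj C; Y \<in> Obj C; f \<in> Hom C W X; g \<in> Hom C W Y\<rbrakk>
      \<Longrightarrow> \<exists>!h. h \<in> Hom C W (prodO C X Y)
            \<and> Comp C W (prodO C X Y) X (proj1 C X Y) h = f
            \<and> Comp C W (prodO C X Y) Y (proj2 C X Y) h = g"

definition pairing ::
    "('o, 'm, 'z) prodcat_scheme \<Rightarrow> 'o \<Rightarrow> 'o \<Rightarrow> 'o \<Rightarrow> 'm \<Rightarrow> 'm \<Rightarrow> 'm" where
  "pairing C W X Y f g = (THE h. h \<in> Hom C W (prodO C X Y)
     \<and> Comp C W (prodO C X Y) X (proj1 C X Y) h = f
     \<and> Comp C W (prodO C X Y) Y (proj2 C X Y) h = g)"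

definition cartesian :: "('o, 'm, 'z) prodcat_scheme \<Rightarrow> ('o, 'm) moncat" where
  "cartesian C = \<lparr>Obj = Obj C, Hom = Hom C, Ident = Ident C, Comp = Comp C,
     tens = prodO C,
     tensA = \<lambda>X X' Y Y' f g. pairing C (prodO C X Y) X' Y'
       (Comp C (prodO C X Y) X X' f (proj1 C X Y)) (Comp C (prodO C X Y) Y Y' g (proj2 C X Y)),
     unitO = terminal C,
     assoc = \<lambda>X Y Z. let XY = prodO C X Y; P = prodO C XY Z; p = proj1 C XY Z in
       pairing C P X (prodO C Y Z) (Comp C P XY X (proj1 C X Y) p)
         (pairing C P Y Z (Comp C P XY Y (proj2 C X Y) p) (proj2 C XY Z)),
     lunit = \<lambda>X. proj2 C (terminal C) X,
     runit = \<lambda>X. proj1 C X (terminal C)\<rparr>"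


section \<open>Relative linear-non-linear coadjunctions\<close>

locale relative_lnl_coadjunction =
    symmetric_monoidal_category A + R: cat_functor B A R
    + category_with_finite_products M
    + Lin: strong_monoidal_functor "cartesian M" A Lin m2 m0
    + Mult: cat_functor B M Mult
  for A :: "('oa, 'a, 'x) smoncat_scheme" and B :: "('ob, 'b, 'y) cat_scheme"
    and R :: "('ob, 'b, 'oa, 'a) func"
    and M :: "('om, 'm, 'z) prodcat_scheme"
    and Lin :: "('om, 'm, 'oa, 'a) func" and m2 :: "'om \<Rightarrow> 'om \<Rightarrow> 'a" and m0 :: 'a
    and Mult :: "('ob, 'b, 'om, 'm) func" +
  fixes \<Psi> :: "'om \<Rightarrow> 'ob \<Rightarrow> 'a \<Rightarrow> 'm"
  assumes \<Psi>_bij: "\<lbrakk>X \<in> Obj M; Y \<in> Obj B\<rbrakk>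
      \<Longrightarrow> bij_betw (\<Psi> X Y) (Hom A (ob Lin X) (ob R Y)) (Hom M X (ob Mult Y))"
    and \<Psi>_nat_left: "\<lbrakk>W \<in> Obj M; X \<in> Obj M; Y \<in> Obj B; f \<in> Hom M W X; h \<in> Hom A (ob Lin X) (ob R Y)\<rbrakk>
      \<Longrightarrow> \<Psi> W Y (Comp A (ob Lin W) (ob Lin X) (ob R Y) h (ar Lin W X f))
        = Comp M W X (ob Mult Y) (\<Psi> X Y h) f"
    and \<Psi>_nat_right: "\<lbrakk>X \<in> Obj M; Y \<in> Obj B; Z \<in> Obj B; h \<in> Hom A (ob Lin X) (ob R Y); g \<in> Hom B Y Z\<rbrakk>
      \<Longrightarrow> \<Psi> X Z (Comp A (ob Lin X) (ob R Y) (ob R Z) (ar R Y Z g) h)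
        = Comp M X (ob Mult Y) (ob Mult Z) (ar Mult Y Z g) (\<Psi> X Y h)"


section \<open>The duploid of an adjunction\<close>

fun pos :: "('ob, 'b, 'oa, 'a) func \<Rightarrow> 'oa + 'ob \<Rightarrow> 'oa" where
  "pos R (Inl X) = X"
| "pos R (Inr Y) = ob R Y"

fun neg :: "('oa, 'a, 'ob, 'b) func \<Rightarrow> 'oa + 'ob \<Rightarrow> 'ob" where
  "neg L (Inl X) = ob L X"
| "neg L (Inr Y) = Y"

definition dupl ::
    "('oa, 'a, 'x) cat_scheme \<Rightarrow> ('ob, 'b, 'y) cat_scheme \<Rightarrow> ('oa, 'a, 'ob, 'b) func
      \<Rightarrow> ('ob, 'b, 'oa, 'a) func \<Rightarrow> ('oa \<Rightarrow> 'ob \<Rightarrow> 'b \<Rightarrow> 'a) \<Rightarrow> ('oa + 'ob, 'a) cat" where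
  "dupl A B L R \<phi> = \<lparr>
     Obj = Obj A <+> Obj B,
     Hom = \<lambda>X Y. Hom A (pos R X) (ob R (neg L Y)),
     Ident = \<lambda>X. case X of Inl a \<Rightarrow> adj_unit B L \<phi> a | Inr b \<Rightarrow> Ident A (ob R b),
     Comp = \<lambda>X Z Y g f. case Z of
         Inl a \<Rightarrow> Comp A (pos R X) (ob R (ob L a)) (ob R (neg L Y))
                   (ar R (ob L a) (neg L Y) (adj_transpose B L \<phi> a (neg L Y) g)) f
       | Inr b \<Rightarrow> Comp A (pos R X) (ob R b) (ob R (neg L Y)) g f\<rparr>"

definition dupl_circ ::
    "('oa, 'a, 'x) cat_scheme \<Rightarrow> ('ob, 'b, 'y) cat_scheme \<Rightarrow> ('oa, 'a, 'ob, 'b) func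
      \<Rightarrow> ('ob, 'b, 'oa, 'a) func \<Rightarrow> ('oa \<Rightarrow> 'ob \<Rightarrow> 'b \<Rightarrow> 'a)
      \<Rightarrow> 'oa + 'ob \<Rightarrow> 'oa + 'ob \<Rightarrow> 'a \<Rightarrow> 'a" where
  "dupl_circ A B L R \<phi> X X' f = (case X' of
       Inl a \<Rightarrow> f
     | Inr b \<Rightarrow> Comp A (pos R X) (ob R b) (ob R (ob L (ob R b))) (adj_unit B L \<phi> (ob R b)) f)"

text \<open>
  A morphism \<open>h : P \<rightarrow> X\<^sup>+\<close> of \<open>A\<close>, seen as a morphism from \<open>P\<close> to \<open>X\<close> in the duploid
  (using that the identity on \<open>X\<close> is a morphism \<open>X\<^sup>+ \<rightarrow> R X\<^sup>-\<close> of \<open>A\<close>): it is \<open>\<eta> \<circ> h\<close> if \<open>X\<close> is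
  an object of \<open>A\<close>, and \<open>h\<close> itself if \<open>X\<close> is an object of \<open>B\<close>.
\<close>

definition dupl_lift ::
    "('oa, 'a, 'x) cat_scheme \<Rightarrow> ('ob, 'b, 'y) cat_scheme \<Rightarrow> ('oa, 'a, 'ob, 'b) func
      \<Rightarrow> ('ob, 'b, 'oa, 'a) func \<Rightarrow> ('oa \<Rightarrow> 'ob \<Rightarrow> 'b \<Rightarrow> 'a)
      \<Rightarrow> 'oa \<Rightarrow> 'oa + 'ob \<Rightarrow> 'a \<Rightarrow> 'a" where
  "dupl_lift A B L R \<phi> P X h =
     Comp A P (pos R X) (ob R (neg L X)) (Ident (dupl A B L R \<phi>) X) h"

text \<open>
  The category of positive objects and thunkable morphisms of the duploid, with its tensor
  product. The structural isomorphisms are those of \<open>A\<close>, seen as morphisms of the duploid.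
\<close>

definition dupl_Pt ::
    "('oa, 'a, 'x) smoncat_scheme \<Rightarrow> ('ob, 'b, 'y) cat_scheme \<Rightarrow> ('oa, 'a, 'ob, 'b) func
      \<Rightarrow> ('ob, 'b, 'oa, 'a) func \<Rightarrow> ('oa \<Rightarrow> 'ob \<Rightarrow> 'b \<Rightarrow> 'a) \<Rightarrow> ('oa \<Rightarrow> 'oa \<Rightarrow> 'a)
      \<Rightarrow> ('oa + 'ob, 'a) moncat" where
  "dupl_Pt A B L R \<phi> st =
    (let D = dupl A B L R \<phi>; T = func_comp R L; lift = dupl_lift A B L R \<phi> in
     \<lparr>Obj = {X \<in> Obj D. positive D X},
      Hom = \<lambda>X Y. {f \<in> Hom D X Y. thunkable D X Y f},
      Ident = Ident D,
      Comp = Comp D,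
      tens = \<lambda>X Y. Inl (pos R X \<otimes>\<^bsub>A\<^esub> pos R Y),
      tensA = \<lambda>X X' Y Y' f g.
        Comp A (pos R X \<otimes>\<^bsub>A\<^esub> pos R Y) (ob T (pos R X') \<otimes>\<^bsub>A\<^esub> ob T (pos R Y'))
          (ob T (pos R X' \<otimes>\<^bsub>A\<^esub> pos R Y'))
          (double_strength A T (adj_mult A B L R \<phi>) st (pos R X') (pos R Y'))
          (tensA A (pos R X) (ob T (pos R X')) (pos R Y) (ob T (pos R Y'))
            (dupl_circ A B L R \<phi> X X' f) (dupl_circ A B L R \<phi> Y Y' g)),
      unitO = Inl \<one>\<^bsub>A\<^esub>,
      assoc = \<lambda>X Y Z. lift ((pos R X \<otimes>\<^bsub>A\<^esub> pos R Y) \<otimes>\<^bsub>A\<^esub> pos R Z)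
        (Inl (pos R X \<otimes>\<^bsub>A\<^esub> (pos R Y \<otimes>\<^bsub>A\<^esub> pos R Z))) (assoc A (pos R X) (pos R Y) (pos R Z)),
      lunit = \<lambda>X. lift (\<one>\<^bsub>A\<^esub> \<otimes>\<^bsub>A\<^esub> pos R X) X (lunit A (pos R X)),
      runit = \<lambda>X. lift (pos R X \<otimes>\<^bsub>A\<^esub> \<one>\<^bsub>A\<^esub>) X (runit A (pos R X))\<rparr>)"

definition dupl_Lin ::
    "('oa, 'a, 'x) cat_scheme \<Rightarrow> ('ob, 'b, 'y) cat_scheme \<Rightarrow> ('oa, 'a, 'ob, 'b) func
      \<Rightarrow> ('ob, 'b, 'oa, 'a) func \<Rightarrow> ('oa \<Rightarrow> 'ob \<Rightarrow> 'b \<Rightarrow> 'a)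
      \<Rightarrow> ('om, 'm, 'oa, 'a) func \<Rightarrow> ('om, 'm, 'oa + 'ob, 'a) func" where
  "dupl_Lin A B L R \<phi> Lin = \<lparr>ob = \<lambda>X. Inl (ob Lin X),
     ar = \<lambda>X X' f. Comp A (ob Lin X) (ob Lin X') (ob R (ob L (ob Lin X')))
       (adj_unit B L \<phi> (ob Lin X')) (ar Lin X X' f)\<rparr>"

definition lnl_counit ::
    "('oa, 'a, 'x) cat_scheme \<Rightarrow> ('ob, 'b, 'oa, 'a) func \<Rightarrow> ('om, 'm, 'z) cat_scheme
      \<Rightarrow> ('om, 'm, 'oa, 'a) func \<Rightarrow> ('ob, 'b, 'om, 'm) func \<Rightarrow> ('om \<Rightarrow> 'ob \<Rightarrow> 'a \<Rightarrow> 'm)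
      \<Rightarrow> 'ob \<Rightarrow> 'a" where
  "lnl_counit A R M Lin Mult \<Psi> Y =
     the_inv_into (Hom A (ob Lin (ob Mult Y)) (ob R Y)) (\<Psi> (ob Mult Y) Y) (Ident M (ob Mult Y))"

definition dupl_Mult ::
    "('oa, 'a, 'x) cat_scheme \<Rightarrow> ('ob, 'b, 'y) cat_scheme \<Rightarrow> ('oa, 'a, 'ob, 'b) func
      \<Rightarrow> ('ob, 'b, 'oa, 'a) func \<Rightarrow> ('oa \<Rightarrow> 'ob \<Rightarrow> 'b \<Rightarrow> 'a) \<Rightarrow> ('om, 'm, 'z) cat_scheme
      \<Rightarrow> ('om, 'm, 'oa, 'a) func \<Rightarrow> ('ob, 'b, 'om, 'm) func \<Rightarrow> ('om \<Rightarrow> 'ob \<Rightarrow> 'a \<Rightarrow> 'm)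
      \<Rightarrow> ('oa + 'ob, 'a, 'om, 'm) func" where
  "dupl_Mult A B L R \<phi> M Lin Mult \<Psi> = \<lparr>ob = \<lambda>X. ob Mult (neg L X),
     ar = \<lambda>X Y f. case X of
         Inl a \<Rightarrow> ar Mult (ob L a) (neg L Y) (adj_transpose B L \<phi> a (neg L Y) f)
       | Inr b \<Rightarrow> \<Psi> (ob Mult b) (neg L Y)
           (Comp A (ob Lin (ob Mult b)) (ob R b) (ob R (neg L Y)) f
             (lnl_counit A R M Lin Mult \<Psi> b))\<rparr>"

end

(*
A positive object X of the duploid is isomorphic, by thunkable maps, to the object X^+ of A: for X in B,
positivity makes the unit of the monad T = RL invertible at RX. Hence P_t is equivalent to
the category of thunkable Kleisli maps of T, i.e. of those f : X -> TY that equalize T eta and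
eta T. These maps are central: thunk f, commute the resulting pure map past the other map, and
force the thunk afterwards. So the double strength is functorial on them, which makes them a
monoidal category; its structure is pulled back to P_t. The maps eta o h form a strict
monoidal image of A, so that Lin inherits its monoidal structure from Lin : M -> A.
*)
theory Submission
  imports Defs
begin

section \<open>Commuting squares and naturality of the associator\<close>

text \<open>Associativity fails in the duploid, so the laws of P_t are not checked there:
  \<open>circ\<close> sends a thunkable morphism X -> Y to a Kleisli map X^+ -> Y^+, and for
  positive Y equations are verified on these images. Compatibility of \<open>circ\<close> with
  composition itself rests on thunkability, because \<open>circ\<close> appends a unit when the
  codomain lies in B, and the resulting composite has to be rebracketed. In the Kleisli category the
  obstacle is naturality of the associator in three effectful arguments. The axioms of a strength
  yield it for the last argument only; symmetry and hexagon transport it to the other two. The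
  adjunction is a separate matter. Since the hom-set from Lin X to Y in the duploid is A(Lin X, R
  Y^-), \<open>\<Psi>\<close> itself is its bijection. The delicate case is naturality along a
  morphism g out of an object b of B: g is an arbitrary map R b -> R Z^- of A, to which naturality
  of \<open>\<Psi>\<close> in B does not apply. The counit of the coadjunction turns this case into
  naturality in M.\<close>

lemma (in category) is_iso_comp:
  assumes "X \<in> Obj C" "Y \<in> Obj C" "Z \<in> Obj C" "is_iso C X Y f" "is_iso C Y Z g"
  shows "is_iso C X Z (Comp C X Y Z g f)"
proof -
  obtain f' g' where f': "f \<in> Hom C X Y" "f' \<in> Hom C Y X" "Comp C X Y X f' f = Ident C X"
      "Comp C Y X Y f f' = Ident C Y"
    and g': "g \<in> Hom C Y Z" "g' \<in> Hom C Z Y" "Comp C Y Z Y g' g = Ident C Y"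
      "Comp C Z Y Z g g' = Ident C Z"
    using assms unfolding is_iso_def by blast
  have "Comp C X Z X (Comp C Z Y X f' g') (Comp C X Y Z g f)
      = Comp C X Y X f' (Comp C X Y Y (Comp C Y Z Y g' g) f)"
    using assms(1-3) f'(1,2) g'(1,2) by (simp add: comp_assoc comp_hom)
  moreover have "Comp C Z X Z (Comp C X Y Z g f) (Comp C Z Y X f' g')
      = Comp C Z Y Z g (Comp C Z Y Y (Comp C Y X Y f f') g')"
    using assms(1-3) f'(1,2) g'(1,2) by (simp add: comp_assoc comp_hom)
  ultimately have "Comp C X Z X (Comp C Z Y X f' g') (Comp C X Y Z g f) = Ident C X"
      "Comp C Z X Z (Comp C X Y Z g f) (Comp C Z Y X f' g') = Ident C Z"
    using assms(1-3) f' g' by (simp_all add: comp_ident_left)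
  then show ?thesis
    unfolding is_iso_def using assms(1-3) f'(1,2) g'(1,2) by (blast intro: comp_hom)
qed

lemma (in category) iso_epi:
  assumes "X \<in> Obj C" "Y \<in> Obj C" "Z \<in> Obj C" "is_iso C X Y u"
    "g \<in> Hom C Y Z" "h \<in> Hom C Y Z" "Comp C X Y Z g u = Comp C X Y Z h u"
  shows "g = h"
proof -
  obtain v where v: "u \<in> Hom C X Y" "v \<in> Hom C Y X" "Comp C Y X Y u v = Ident C Y"
    using assms(4) unfolding is_iso_def by blast
  have "Comp C Y X Z (Comp C X Y Z g u) v = Comp C Y X Z (Comp C X Y Z h u) v"
    by (simp add: assms(7))
  then show ?thesis
    using assms(1-3,5,6) v by (simp add: comp_assoc comp_ident_right)
qed

lemma (in category) iso_mono:
  assumes "X \<in> Obj C" "Y \<in> Obj C" "Z \<in> Obj C" "is_iso C Y Z u"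
    "g \<in> Hom C X Y" "h \<in> Hom C X Y" "Comp C X Y Z u g = Comp C X Y Z u h"
  shows "g = h"
proof -
  obtain v where v: "u \<in> Hom C Y Z" "v \<in> Hom C Z Y" "Comp C Y Z Y v u = Ident C Y"
    using assms(4) unfolding is_iso_def by blast
  have "Comp C X Y Y (Comp C Y Z Y v u) g = Comp C X Y Y (Comp C Y Z Y v u) h"
    using assms v(1,2) by (simp add: comp_assoc)
  then show ?thesis
    using assms(1-3,5,6) v by (simp add: comp_ident_left)
qed

text \<open>The square has horizontal sides \<open>f\<close>, \<open>g\<close> and vertical sides \<open>u\<close>, \<open>v\<close>.\<close>

definition square ::
    "('o, 'm, 'z) cat_scheme \<Rightarrow> 'o \<Rightarrow> 'o \<Rightarrow> 'o \<Rightarrow> 'o \<Rightarrow> 'm \<Rightarrow> 'm \<Rightarrow> 'm \<Rightarrow> 'm \<Rightarrow> bool" where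
  "square C X Y X' Y' f g u v \<longleftrightarrow>
     X \<in> Obj C \<and> Y \<in> Obj C \<and> X' \<in> Obj C \<and> Y' \<in> Obj C \<and>
     f \<in> Hom C X Y \<and> g \<in> Hom C X' Y' \<and> u \<in> Hom C X X' \<and> v \<in> Hom C Y Y' \<and>
     Comp C X X' Y' g u = Comp C X Y Y' v f"

lemma squareD:
  assumes "square C X Y X' Y' f g u v"
  shows "X \<in> Obj C" "Y \<in> Obj C" "X' \<in> Obj C" "Y' \<in> Obj C"
    "f \<in> Hom C X Y" "g \<in> Hom C X' Y'" "u \<in> Hom C X X'" "v \<in> Hom C Y Y'"
  using assms by (simp_all add: square_def)

lemma square_commutes:
  "square C X Y X' Y' f g u v \<Longrightarrow> Comp C X X' Y' g u = Comp C X Y Y' v f"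
  by (simp add: square_def)

section \<open>Pasting and cancellation of commuting squares\<close>

context category
begin

lemma square_paste_vertical:
  assumes "square C X Y X' Y' f g u v" "square C X' Y' X'' Y'' g h u' v'"
  shows "square C X Y X'' Y'' f h (Comp C X X' X'' u' u) (Comp C Y Y' Y'' v' v)"
proof -
  note [simp] = squareD[OF assms(1)] squareD[OF assms(2)]
  have "Comp C X X'' Y'' h (Comp C X X' X'' u' u) = Comp C X X' Y'' (Comp C X' X'' Y'' h u') u"
    by (simp add: comp_assoc)
  also have "\<dots> = Comp C X Y' Y'' v' (Comp C X X' Y' g u)"
    by (simp add: square_commutes[OF assms(2)] comp_assoc)
  also have "\<dots> = Comp C X Y Y'' (Comp C Y Y' Y'' v' v) f"
    by (simp add: square_commutes[OF assms(1)] comp_assoc)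
  finally show ?thesis
    by (simp add: square_def comp_hom)
qed

lemma square_paste_horizontal:
  assumes "square C X Y X' Y' f g u v" "square C Y Z Y' Z' f' g' v w"
  shows "square C X Z X' Z' (Comp C X Y Z f' f) (Comp C X' Y' Z' g' g) u w"
proof -
  note [simp] = squareD[OF assms(1)] squareD[OF assms(2)]
  have "Comp C X X' Z' (Comp C X' Y' Z' g' g) u = Comp C X Y' Z' g' (Comp C X X' Y' g u)"
    by (simp add: comp_assoc)
  also have "\<dots> = Comp C X Y Z' (Comp C Y Y' Z' g' v) f"
    by (simp add: square_commutes[OF assms(1)] comp_assoc)
  also have "\<dots> = Comp C X Z Z' w (Comp C X Y Z f' f)"
    by (simp add: square_commutes[OF assms(2)] comp_assoc)
  finally show ?thesis
    by (simp add: square_def comp_hom)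
qed

text \<open>Both composites of the lower square start at \<open>X'\<close> and agree after
  precomposition with \<open>u\<close>; hence it is the left side of the upper square that has to be
  invertible.\<close>

lemma square_cancel_upper:
  assumes "square C X Y X'' Y'' f h (Comp C X X' X'' u' u) (Comp C Y Y' Y'' v' v)"
    and "square C X Y X' Y' f g u v" "is_iso C X X' u" "u' \<in> Hom C X' X''" "v' \<in> Hom C Y' Y''"
  shows "square C X' Y' X'' Y'' g h u' v'"
proof -
  note [simp] = squareD[OF assms(1)] squareD[OF assms(2)] assms(4,5)
  have "Comp C X X' Y'' (Comp C X' X'' Y'' h u') u = Comp C X X'' Y'' h (Comp C X X' X'' u' u)"
    by (simp add: comp_assoc)
  also have "\<dots> = Comp C X Y' Y'' v' (Comp C X X' Y' g u)"
    by (simp add: square_commutes[OF assms(1)] square_commutes[OF assms(2)] comp_assoc)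
  also have "\<dots> = Comp C X X' Y'' (Comp C X' Y' Y'' v' g) u"
    by (simp add: comp_assoc)
  finally have "Comp C X' X'' Y'' h u' = Comp C X' Y' Y'' v' g"
    by (rule iso_epi[rotated -1]) (simp_all add: comp_hom assms(3))
  then show ?thesis
    by (simp add: square_def)
qed

text \<open>Dually, both composites of the upper square end at \<open>Y'\<close> and agree after
  postcomposition with \<open>v'\<close>, the right side of the lower square.\<close>

lemma square_cancel_lower:
  assumes "square C X Y X'' Y'' f h (Comp C X X' X'' u' u) (Comp C Y Y' Y'' v' v)"
    and "square C X' Y' X'' Y'' g h u' v'" "is_iso C Y' Y'' v'" "u \<in> Hom C X X'" "v \<in> Hom C Y Y'"
  shows "square C X Y X' Y' f g u v"
proof -
  note [simp] = squareD[OF assms(1)] squareD[OF assms(2)] assms(4,5)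
  have "Comp C X Y' Y'' v' (Comp C X X' Y' g u) = Comp C X X' Y'' (Comp C X' Y' Y'' v' g) u"
    by (simp add: comp_assoc)
  also have "\<dots> = Comp C X X'' Y'' h (Comp C X X' X'' u' u)"
    by (simp add: square_commutes[OF assms(2), symmetric] comp_assoc)
  also have "\<dots> = Comp C X Y' Y'' v' (Comp C X Y Y' v f)"
    by (simp add: square_commutes[OF assms(1)] comp_assoc)
  finally have "Comp C X X' Y' g u = Comp C X Y Y' v f"
    by (rule iso_mono[rotated -1]) (simp_all add: comp_hom assms(3))
  then show ?thesis
    by (simp add: square_def)
qed

lemma square_ident_horizontal:
  assumes "X \<in> Obj C" "X' \<in> Obj C" "u \<in> Hom C X X'"
  shows "square C X X X' X' (Ident C X) (Ident C X') u u"
  using assms by (simp add: square_def ident_hom comp_ident_left comp_ident_right)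

lemma square_ident_vertical:
  assumes "X \<in> Obj C" "Y \<in> Obj C" "f \<in> Hom C X Y"
  shows "square C X Y X Y f f (Ident C X) (Ident C Y)"
  using assms by (simp add: square_def ident_hom comp_ident_left comp_ident_right)

end

text \<open>
  In a symmetric tensor category satisfying the hexagon, naturality of the associator in its
  last argument suffices: the hexagon expresses the associator in terms of instances in which
  the varying argument has been moved to the right.
\<close>

locale symmetric_tensor_category = category C
  for C :: "('o, 'm, 'z) smoncat_scheme" (structure) +
  assumes tens_Obj: "\<lbrakk>X \<in> Obj C; Y \<in> Obj C\<rbrakk> \<Longrightarrow> X \<otimes> Y \<in> Obj C"
    and tensA_Hom: "\<lbrakk>X \<in> Obj C; X' \<in> Obj C; Y \<in> Obj C; Y' \<in> Obj C;
        f \<in> Hom C X X'; g \<in> Hom C Y Y'\<rbrakk>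
      \<Longrightarrow> tensA C X X' Y Y' f g \<in> Hom C (X \<otimes> Y) (X' \<otimes> Y')"
    and tensA_ident: "\<lbrakk>X \<in> Obj C; Y \<in> Obj C\<rbrakk>
      \<Longrightarrow> tensA C X X Y Y (Ident C X) (Ident C Y) = Ident C (X \<otimes> Y)"
    and tensA_comp: "\<lbrakk>X \<in> Obj C; X' \<in> Obj C; X'' \<in> Obj C; Y \<in> Obj C; Y' \<in> Obj C; Y'' \<in> Obj C;
        f \<in> Hom C X X'; f' \<in> Hom C X' X''; g \<in> Hom C Y Y'; g' \<in> Hom C Y' Y''\<rbrakk>
      \<Longrightarrow> tensA C X X'' Y Y'' (Comp C X X' X'' f' f) (Comp C Y Y' Y'' g' g)
        = Comp C (X \<otimes> Y) (X' \<otimes> Y') (X'' \<otimes> Y'')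
            (tensA C X' X'' Y' Y'' f' g') (tensA C X X' Y Y' f g)"
    and assoc_iso: "\<lbrakk>X \<in> Obj C; Y \<in> Obj C; Z \<in> Obj C\<rbrakk>
      \<Longrightarrow> is_iso C ((X \<otimes> Y) \<otimes> Z) (X \<otimes> (Y \<otimes> Z)) (assoc C X Y Z)"
    and swap_Hom: "\<lbrakk>X \<in> Obj C; Y \<in> Obj C\<rbrakk> \<Longrightarrow> swap C X Y \<in> Hom C (X \<otimes> Y) (Y \<otimes> X)"
    and swap_swap: "\<lbrakk>X \<in> Obj C; Y \<in> Obj C\<rbrakk>
      \<Longrightarrow> Comp C (X \<otimes> Y) (Y \<otimes> X) (X \<otimes> Y) (swap C Y X) (swap C X Y) = Ident C (X \<otimes> Y)"
    and swap_nat: "\<lbrakk>X \<in> Obj C; X' \<in> Obj C; Y \<in> Obj C; Y' \<in> Obj C;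
        f \<in> Hom C X X'; g \<in> Hom C Y Y'\<rbrakk>
      \<Longrightarrow> Comp C (X \<otimes> Y) (X' \<otimes> Y') (Y' \<otimes> X') (swap C X' Y') (tensA C X X' Y Y' f g)
        = Comp C (X \<otimes> Y) (Y \<otimes> X) (Y' \<otimes> X') (tensA C Y Y' X X' g f) (swap C X Y)"
    and hexagon: "\<lbrakk>X \<in> Obj C; Y \<in> Obj C; Z \<in> Obj C\<rbrakk>
      \<Longrightarrow> Comp C ((X \<otimes> Y) \<otimes> Z) ((Y \<otimes> Z) \<otimes> X) (Y \<otimes> (Z \<otimes> X)) (assoc C Y Z X)
            (Comp C ((X \<otimes> Y) \<otimes> Z) (X \<otimes> (Y \<otimes> Z)) ((Y \<otimes> Z) \<otimes> X)
              (swap C X (Y \<otimes> Z)) (assoc C X Y Z))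
        = Comp C ((X \<otimes> Y) \<otimes> Z) (Y \<otimes> (X \<otimes> Z)) (Y \<otimes> (Z \<otimes> X))
            (tensA C Y Y (X \<otimes> Z) (Z \<otimes> X) (Ident C Y) (swap C X Z))
            (Comp C ((X \<otimes> Y) \<otimes> Z) ((Y \<otimes> X) \<otimes> Z) (Y \<otimes> (X \<otimes> Z)) (assoc C Y X Z)
              (tensA C (X \<otimes> Y) (Y \<otimes> X) Z Z (swap C X Y) (Ident C Z)))"
    and assoc_nat_right: "\<lbrakk>X \<in> Obj C; Y \<in> Obj C; Z \<in> Obj C; Z' \<in> Obj C; h \<in> Hom C Z Z'\<rbrakk>
      \<Longrightarrow> Comp C ((X \<otimes> Y) \<otimes> Z) ((X \<otimes> Y) \<otimes> Z') (X \<otimes> (Y \<otimes> Z'))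
            (assoc C X Y Z') (tensA C (X \<otimes> Y) (X \<otimes> Y) Z Z' (Ident C (X \<otimes> Y)) h)
        = Comp C ((X \<otimes> Y) \<otimes> Z) (X \<otimes> (Y \<otimes> Z)) (X \<otimes> (Y \<otimes> Z'))
            (tensA C X X (Y \<otimes> Z) (Y \<otimes> Z') (Ident C X) (tensA C Y Y Z Z' (Ident C Y) h))
            (assoc C X Y Z)"
begin

lemma assoc_Hom:
  "\<lbrakk>X \<in> Obj C; Y \<in> Obj C; Z \<in> Obj C\<rbrakk>
    \<Longrightarrow> assoc C X Y Z \<in> Hom C ((X \<otimes> Y) \<otimes> Z) (X \<otimes> (Y \<otimes> Z))"
  using assoc_iso unfolding is_iso_def by blast

lemma swap_iso: "\<lbrakk>X \<in> Obj C; Y \<in> Obj C\<rbrakk> \<Longrightarrow> is_iso C (X \<otimes> Y) (Y \<otimes> X) (swap C X Y)"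
  unfolding is_iso_def using swap_Hom swap_swap by blast

lemmas typing = tens_Obj tensA_Hom ident_hom swap_Hom assoc_Hom comp_hom

section \<open>Naturality of the associator, one argument at a time\<close>

lemma square_tensor:
  assumes "square C X Y X' Y' f g u v" "square C Z W Z' W' f' g' u' v'"
  shows "square C (X \<otimes> Z) (Y \<otimes> W) (X' \<otimes> Z') (Y' \<otimes> W')
    (tensA C X Y Z W f f') (tensA C X' Y' Z' W' g g') (tensA C X X' Z Z' u u')
    (tensA C Y Y' W W' v v')"
  using assms
  by (auto simp: square_def tens_Obj tensA_Hom tensA_comp[symmetric])

lemma square_swap:
  assumes "X \<in> Obj C" "X' \<in> Obj C" "Y \<in> Obj C" "Y' \<in> Obj C" "f \<in> Hom C X X'" "g \<in> Hom C Y Y'"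
  shows "square C (X \<otimes> Y) (X' \<otimes> Y') (Y \<otimes> X) (Y' \<otimes> X')
    (tensA C X X' Y Y' f g) (tensA C Y Y' X X' g f) (swap C X Y) (swap C X' Y')"
  using assms by (simp add: square_def typing swap_nat)

text \<open>The identity on \<open>X \<otimes> Y\<close> is written as a tensor of identities, so
  that the square pastes with those for the other two arguments.\<close>

lemma square_assoc_right:
  assumes "X \<in> Obj C" "Y \<in> Obj C" "Z \<in> Obj C" "Z' \<in> Obj C" "h \<in> Hom C Z Z'"
  shows "square C ((X \<otimes> Y) \<otimes> Z) ((X \<otimes> Y) \<otimes> Z') (X \<otimes> (Y \<otimes> Z)) (X \<otimes> (Y \<otimes> Z'))
    (tensA C (X \<otimes> Y) (X \<otimes> Y) Z Z' (tensA C X X Y Y (Ident C X) (Ident C Y)) h)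
    (tensA C X X (Y \<otimes> Z) (Y \<otimes> Z') (Ident C X) (tensA C Y Y Z Z' (Ident C Y) h))
    (assoc C X Y Z) (assoc C X Y Z')"
  using assms by (simp add: square_def typing tensA_ident assoc_nat_right)

text \<open>In the hexagon at \<open>X\<close>, \<open>Y\<close>, \<open>Z\<close>, let
  \<open>Z\<close> vary. The associators at (X, Y, Z) and (Y, X, Z) have it in last position, so
  every edge other than the associator at (Y, Z, X) is known to be natural. The edges that precede
  this one are isomorphisms and can be cancelled.\<close>

lemma square_assoc_middle:
  assumes "Y \<in> Obj C" "Z \<in> Obj C" "Z' \<in> Obj C" "X \<in> Obj C" "h \<in> Hom C Z Z'"
  shows "square C ((Y \<otimes> Z) \<otimes> X) ((Y \<otimes> Z') \<otimes> X) (Y \<otimes> (Z \<otimes> X)) (Y \<otimes> (Z' \<otimes> X))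
    (tensA C (Y \<otimes> Z) (Y \<otimes> Z') X X (tensA C Y Y Z Z' (Ident C Y) h) (Ident C X))
    (tensA C Y Y (Z \<otimes> X) (Z' \<otimes> X) (Ident C Y) (tensA C Z Z' X X h (Ident C X)))
    (assoc C Y Z X) (assoc C Y Z' X)"
proof (rule square_cancel_upper)
  show "square C ((X \<otimes> Y) \<otimes> Z) ((X \<otimes> Y) \<otimes> Z') ((Y \<otimes> Z) \<otimes> X) ((Y \<otimes> Z') \<otimes> X)
      (tensA C (X \<otimes> Y) (X \<otimes> Y) Z Z' (tensA C X X Y Y (Ident C X) (Ident C Y)) h)
      (tensA C (Y \<otimes> Z) (Y \<otimes> Z') X X (tensA C Y Y Z Z' (Ident C Y) h) (Ident C X))
      (Comp C ((X \<otimes> Y) \<otimes> Z) (X \<otimes> (Y \<otimes> Z)) ((Y \<otimes> Z) \<otimes> X) (swap C X (Y \<otimes> Z)) (assoc C X Y Z))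
      (Comp C ((X \<otimes> Y) \<otimes> Z') (X \<otimes> (Y \<otimes> Z')) ((Y \<otimes> Z') \<otimes> X) (swap C X (Y \<otimes> Z')) (assoc C X Y Z'))"
    by (rule square_paste_vertical[OF square_assoc_right square_swap])
      (use assms in \<open>simp_all add: typing\<close>)
  show "is_iso C ((X \<otimes> Y) \<otimes> Z) ((Y \<otimes> Z) \<otimes> X)
      (Comp C ((X \<otimes> Y) \<otimes> Z) (X \<otimes> (Y \<otimes> Z)) ((Y \<otimes> Z) \<otimes> X) (swap C X (Y \<otimes> Z)) (assoc C X Y Z))"
    by (rule is_iso_comp) (use assms in \<open>simp_all add: typing assoc_iso swap_iso\<close>)
  show "square C ((X \<otimes> Y) \<otimes> Z) ((X \<otimes> Y) \<otimes> Z') (Y \<otimes> (Z \<otimes> X)) (Y \<otimes> (Z' \<otimes> X))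
      (tensA C (X \<otimes> Y) (X \<otimes> Y) Z Z' (tensA C X X Y Y (Ident C X) (Ident C Y)) h)
      (tensA C Y Y (Z \<otimes> X) (Z' \<otimes> X) (Ident C Y) (tensA C Z Z' X X h (Ident C X)))
      (Comp C ((X \<otimes> Y) \<otimes> Z) ((Y \<otimes> Z) \<otimes> X) (Y \<otimes> (Z \<otimes> X)) (assoc C Y Z X)
        (Comp C ((X \<otimes> Y) \<otimes> Z) (X \<otimes> (Y \<otimes> Z)) ((Y \<otimes> Z) \<otimes> X) (swap C X (Y \<otimes> Z)) (assoc C X Y Z)))
      (Comp C ((X \<otimes> Y) \<otimes> Z') ((Y \<otimes> Z') \<otimes> X) (Y \<otimes> (Z' \<otimes> X)) (assoc C Y Z' X)
        (Comp C ((X \<otimes> Y) \<otimes> Z') (X \<otimes> (Y \<otimes> Z')) ((Y \<otimes> Z') \<otimes> X)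
          (swap C X (Y \<otimes> Z')) (assoc C X Y Z')))"
    \<comment> \<open>On the other side of the hexagon the only associator is the one at (Y, X, Z),
      where the varying argument is last.\<close>
    unfolding hexagon[OF assms(4,1,2)] hexagon[OF assms(4,1,3)]
    by (rule square_paste_vertical[OF square_paste_vertical[OF
          square_tensor[OF square_swap square_ident_vertical] square_assoc_right]
          square_tensor[OF square_ident_horizontal square_swap]])
      (use assms in \<open>simp_all add: typing\<close>)
qed (use assms in \<open>simp_all add: typing\<close>)

text \<open>Now \<open>X\<close> varies in the hexagon: it is last in the associator at (Y, Z, X)
  and in the middle in the one at (Y, X, Z), both settled above. The associator in question is the
  first edge, so the cancellation is done from below.\<close>

lemma square_assoc_left:
  assumes "X \<in> Obj C" "X' \<in> Obj C" "Y \<in> Obj C" "Z \<in> Obj C" "h \<in> Hom C X X'"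
  shows "square C ((X \<otimes> Y) \<otimes> Z) ((X' \<otimes> Y) \<otimes> Z) (X \<otimes> (Y \<otimes> Z)) (X' \<otimes> (Y \<otimes> Z))
    (tensA C (X \<otimes> Y) (X' \<otimes> Y) Z Z (tensA C X X' Y Y h (Ident C Y)) (Ident C Z))
    (tensA C X X' (Y \<otimes> Z) (Y \<otimes> Z) h (tensA C Y Y Z Z (Ident C Y) (Ident C Z)))
    (assoc C X Y Z) (assoc C X' Y Z)"
proof (rule square_cancel_lower)
  show "square C (X \<otimes> (Y \<otimes> Z)) (X' \<otimes> (Y \<otimes> Z)) (Y \<otimes> (Z \<otimes> X)) (Y \<otimes> (Z \<otimes> X'))
      (tensA C X X' (Y \<otimes> Z) (Y \<otimes> Z) h (tensA C Y Y Z Z (Ident C Y) (Ident C Z)))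
      (tensA C Y Y (Z \<otimes> X) (Z \<otimes> X') (Ident C Y) (tensA C Z Z X X' (Ident C Z) h))
      (Comp C (X \<otimes> (Y \<otimes> Z)) ((Y \<otimes> Z) \<otimes> X) (Y \<otimes> (Z \<otimes> X)) (assoc C Y Z X) (swap C X (Y \<otimes> Z)))
      (Comp C (X' \<otimes> (Y \<otimes> Z)) ((Y \<otimes> Z) \<otimes> X') (Y \<otimes> (Z \<otimes> X')) (assoc C Y Z X') (swap C X' (Y \<otimes> Z)))"
    by (rule square_paste_vertical[OF square_swap square_assoc_right])
      (use assms in \<open>simp_all add: typing\<close>)
  show "is_iso C (X' \<otimes> (Y \<otimes> Z)) (Y \<otimes> (Z \<otimes> X'))
      (Comp C (X' \<otimes> (Y \<otimes> Z)) ((Y \<otimes> Z) \<otimes> X') (Y \<otimes> (Z \<otimes> X')) (assoc C Y Z X') (swap C X' (Y \<otimes> Z)))"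
    by (rule is_iso_comp) (use assms in \<open>simp_all add: typing assoc_iso swap_iso\<close>)
  \<comment> \<open>The hexagon, rebracketed to split off its first edge, the associator at (V, Y,
    Z).\<close>
  have *: "Comp C ((V \<otimes> Y) \<otimes> Z) (V \<otimes> (Y \<otimes> Z)) (Y \<otimes> (Z \<otimes> V))
      (Comp C (V \<otimes> (Y \<otimes> Z)) ((Y \<otimes> Z) \<otimes> V) (Y \<otimes> (Z \<otimes> V)) (assoc C Y Z V) (swap C V (Y \<otimes> Z)))
      (assoc C V Y Z)
    = Comp C ((V \<otimes> Y) \<otimes> Z) (Y \<otimes> (V \<otimes> Z)) (Y \<otimes> (Z \<otimes> V))
        (tensA C Y Y (V \<otimes> Z) (Z \<otimes> V) (Ident C Y) (swap C V Z))
        (Comp C ((V \<otimes> Y) \<otimes> Z) ((Y \<otimes> V) \<otimes> Z) (Y \<otimes> (V \<otimes> Z)) (assoc C Y V Z)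
          (tensA C (V \<otimes> Y) (Y \<otimes> V) Z Z (swap C V Y) (Ident C Z)))" if "V \<in> Obj C" for V
    using assms(3,4) that hexagon[of V Y Z] by (simp add: comp_assoc typing)
  show "square C ((X \<otimes> Y) \<otimes> Z) ((X' \<otimes> Y) \<otimes> Z) (Y \<otimes> (Z \<otimes> X)) (Y \<otimes> (Z \<otimes> X'))
      (tensA C (X \<otimes> Y) (X' \<otimes> Y) Z Z (tensA C X X' Y Y h (Ident C Y)) (Ident C Z))
      (tensA C Y Y (Z \<otimes> X) (Z \<otimes> X') (Ident C Y) (tensA C Z Z X X' (Ident C Z) h))
      (Comp C ((X \<otimes> Y) \<otimes> Z) (X \<otimes> (Y \<otimes> Z)) (Y \<otimes> (Z \<otimes> X))
        (Comp C (X \<otimes> (Y \<otimes> Z)) ((Y \<otimes> Z) \<otimes> X) (Y \<otimes> (Z \<otimes> X)) (assoc C Y Z X) (swap C X (Y \<otimes> Z)))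
        (assoc C X Y Z))
      (Comp C ((X' \<otimes> Y) \<otimes> Z) (X' \<otimes> (Y \<otimes> Z)) (Y \<otimes> (Z \<otimes> X'))
        (Comp C (X' \<otimes> (Y \<otimes> Z)) ((Y \<otimes> Z) \<otimes> X') (Y \<otimes> (Z \<otimes> X')) (assoc C Y Z X')
          (swap C X' (Y \<otimes> Z)))
        (assoc C X' Y Z))"
    unfolding *[OF assms(1)] *[OF assms(2)]
    by (rule square_paste_vertical[OF square_paste_vertical[OF
          square_tensor[OF square_swap square_ident_vertical] square_assoc_middle]
          square_tensor[OF square_ident_horizontal square_swap]])
      (use assms in \<open>simp_all add: typing\<close>)
qed (use assms in \<open>simp_all add: typing\<close>)

lemma assoc_nat:
  assumes "X \<in> Obj C" "X' \<in> Obj C" "Y \<in> Obj C" "Y' \<in> Obj C" "Z \<in> Obj C" "Z' \<in> Obj C"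
    "f \<in> Hom C X X'" "g \<in> Hom C Y Y'" "h \<in> Hom C Z Z'"
  shows "Comp C ((X \<otimes> Y) \<otimes> Z) ((X' \<otimes> Y') \<otimes> Z') (X' \<otimes> (Y' \<otimes> Z'))
      (assoc C X' Y' Z') (tensA C (X \<otimes> Y) (X' \<otimes> Y') Z Z' (tensA C X X' Y Y' f g) h)
    = Comp C ((X \<otimes> Y) \<otimes> Z) (X \<otimes> (Y \<otimes> Z)) (X' \<otimes> (Y' \<otimes> Z'))
        (tensA C X X' (Y \<otimes> Z) (Y' \<otimes> Z') f (tensA C Y Y' Z Z' g h)) (assoc C X Y Z)"
proof -
  have "square C ((X \<otimes> Y) \<otimes> Z) ((X' \<otimes> Y') \<otimes> Z') (X \<otimes> (Y \<otimes> Z)) (X' \<otimes> (Y' \<otimes> Z'))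
    (Comp C ((X \<otimes> Y) \<otimes> Z) ((X' \<otimes> Y) \<otimes> Z) ((X' \<otimes> Y') \<otimes> Z')
      (Comp C ((X' \<otimes> Y) \<otimes> Z) ((X' \<otimes> Y') \<otimes> Z) ((X' \<otimes> Y') \<otimes> Z')
        (tensA C (X' \<otimes> Y') (X' \<otimes> Y') Z Z' (tensA C X' X' Y' Y' (Ident C X') (Ident C Y')) h)
        (tensA C (X' \<otimes> Y) (X' \<otimes> Y') Z Z (tensA C X' X' Y Y' (Ident C X') g) (Ident C Z)))
      (tensA C (X \<otimes> Y) (X' \<otimes> Y) Z Z (tensA C X X' Y Y f (Ident C Y)) (Ident C Z)))
    (Comp C (X \<otimes> (Y \<otimes> Z)) (X' \<otimes> (Y \<otimes> Z)) (X' \<otimes> (Y' \<otimes> Z'))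
      (Comp C (X' \<otimes> (Y \<otimes> Z)) (X' \<otimes> (Y' \<otimes> Z)) (X' \<otimes> (Y' \<otimes> Z'))
        (tensA C X' X' (Y' \<otimes> Z) (Y' \<otimes> Z') (Ident C X') (tensA C Y' Y' Z Z' (Ident C Y') h))
        (tensA C X' X' (Y \<otimes> Z) (Y' \<otimes> Z) (Ident C X') (tensA C Y Y' Z Z g (Ident C Z))))
      (tensA C X X' (Y \<otimes> Z) (Y \<otimes> Z) f (tensA C Y Y Z Z (Ident C Y) (Ident C Z))))
    (assoc C X Y Z) (assoc C X' Y' Z')"
    by (rule square_paste_horizontal[OF square_assoc_left
          square_paste_horizontal[OF square_assoc_middle square_assoc_right]])
      (use assms in simp_all)
  then show ?thesis
    using assms
    by (simp add: square_def typing tensA_comp[symmetric] comp_ident_left comp_ident_right)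
qed

end


section \<open>Thunkable Kleisli maps of a strong monad\<close>

locale symmetric_strong_monad = symmetric_monoidal_category C + strong_monad C T \<eta> \<mu> st
  for C :: "('o, 'm, 'z) smoncat_scheme" (structure) and T :: "('o, 'm, 'o, 'm) func"
    and \<eta> :: "'o \<Rightarrow> 'm" and \<mu> :: "'o \<Rightarrow> 'm" and st :: "'o \<Rightarrow> 'o \<Rightarrow> 'm"
begin

section \<open>Typing rules and Kleisli composition\<close>

lemma assoc_Hom:
  "\<lbrakk>X \<in> Obj C; Y \<in> Obj C; Z \<in> Obj C\<rbrakk>
    \<Longrightarrow> assoc C X Y Z \<in> Hom C ((X \<otimes> Y) \<otimes> Z) (X \<otimes> (Y \<otimes> Z))"
  using assoc_iso unfolding is_iso_def by blast

lemma lunit_Hom: "X \<in> Obj C \<Longrightarrow> lunit C X \<in> Hom C (\<one> \<otimes> X) X"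
  using lunit_iso unfolding is_iso_def by blast

lemma runit_Hom: "X \<in> Obj C \<Longrightarrow> runit C X \<in> Hom C (X \<otimes> \<one>) X"
  using runit_iso unfolding is_iso_def by blast

lemmas typing = ident_hom comp_hom tens_Obj unit_Obj tensA_Hom assoc_Hom lunit_Hom runit_Hom
  swap_Hom ob_Obj ar_Hom unit_Hom mult_Hom st_Hom

text \<open>The bracketing isolates the Kleisli extension of \<open>g\<close>. For the monad of an
  adjunction this extension is \<open>R\<close> applied to the transpose of \<open>g\<close>, so
  that \<open>kcomp\<close> takes the form of duploid composition at an object of A.\<close>

definition kcomp :: "'o \<Rightarrow> 'o \<Rightarrow> 'o \<Rightarrow> 'm \<Rightarrow> 'm \<Rightarrow> 'm" where
  "kcomp X Y Z g f = Comp C X (ob T Y) (ob T Z)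
     (Comp C (ob T Y) (ob T (ob T Z)) (ob T Z) (\<mu> Z) (ar T Y (ob T Z) g)) f"

definition pure :: "'o \<Rightarrow> 'o \<Rightarrow> 'm \<Rightarrow> 'm" where
  "pure X Y h = Comp C X Y (ob T Y) (\<eta> Y) h"

lemma kcomp_Hom:
  "\<lbrakk>X \<in> Obj C; Y \<in> Obj C; Z \<in> Obj C; f \<in> Hom C X (ob T Y); g \<in> Hom C Y (ob T Z)\<rbrakk>
    \<Longrightarrow> kcomp X Y Z g f \<in> Hom C X (ob T Z)"
  by (simp add: kcomp_def typing)

lemma pure_Hom:
  "\<lbrakk>X \<in> Obj C; Y \<in> Obj C; h \<in> Hom C X Y\<rbrakk> \<Longrightarrow> pure X Y h \<in> Hom C X (ob T Y)"
  by (simp add: pure_def typing)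

lemma pure_ident: "X \<in> Obj C \<Longrightarrow> pure X X (Ident C X) = \<eta> X"
  by (simp add: pure_def typing comp_ident_right)

lemma kcomp_assoc:
  assumes [simp]: "W \<in> Obj C" "X \<in> Obj C" "Y \<in> Obj C" "Z \<in> Obj C"
    "f \<in> Hom C W (ob T X)" "g \<in> Hom C X (ob T Y)" "h \<in> Hom C Y (ob T Z)"
  shows "kcomp W X Z (kcomp X Y Z h g) f = kcomp W Y Z h (kcomp W X Y g f)"
proof -
  let ?T = "ob T"
  \<comment> \<open>The laws of \<open>\<mu>\<close> are applied to the maps out of
    \<open>T X\<close>, before \<open>f\<close> is attached: in the right-nested normal form of the
    full composites their left-hand sides no longer occur as subterms.\<close>
  have 1: "Comp C (?T X) (?T (?T (?T Z))) (?T Z)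
      (Comp C (?T (?T (?T Z))) (?T (?T Z)) (?T Z) (\<mu> Z) (ar T (?T (?T Z)) (?T Z) (\<mu> Z)))
      (Comp C (?T X) (?T (?T Y)) (?T (?T (?T Z))) (ar T (?T Y) (?T (?T Z)) (ar T Y (?T Z) h))
        (ar T X (?T Y) g))
    = Comp C (?T X) (?T Y) (?T Z)
      (Comp C (?T Y) (?T (?T Z)) (?T Z) (\<mu> Z) (ar T Y (?T Z) h))
      (Comp C (?T X) (?T (?T Y)) (?T Y) (\<mu> Y) (ar T X (?T Y) g))"
  proof -
    have "Comp C (?T (?T Y)) (?T (?T (?T Z))) (?T Z)
        (Comp C (?T (?T (?T Z))) (?T (?T Z)) (?T Z) (\<mu> Z) (ar T (?T (?T Z)) (?T Z) (\<mu> Z)))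
        (ar T (?T Y) (?T (?T Z)) (ar T Y (?T Z) h))
      = Comp C (?T (?T Y)) (?T (?T Z)) (?T Z) (\<mu> Z)
        (Comp C (?T (?T Y)) (?T Y) (?T (?T Z)) (ar T Y (?T Z) h) (\<mu> Y))"
      by (simp add: mult_mult[symmetric] comp_assoc typing mult_nat)
    then have "Comp C (?T X) (?T (?T Y)) (?T Z) (Comp C (?T (?T Y)) (?T (?T (?T Z))) (?T Z)
        (Comp C (?T (?T (?T Z))) (?T (?T Z)) (?T Z) (\<mu> Z) (ar T (?T (?T Z)) (?T Z) (\<mu> Z)))
        (ar T (?T Y) (?T (?T Z)) (ar T Y (?T Z) h))) (ar T X (?T Y) g)
      = Comp C (?T X) (?T (?T Y)) (?T Z) (Comp C (?T (?T Y)) (?T (?T Z)) (?T Z) (\<mu> Z)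
        (Comp C (?T (?T Y)) (?T Y) (?T (?T Z)) (ar T Y (?T Z) h) (\<mu> Y))) (ar T X (?T Y) g)"
      by simp
    then show ?thesis
      by (simp add: comp_assoc typing)
  qed
  show ?thesis
    using arg_cong[OF 1, where f = "\<lambda>k. Comp C W (?T X) (?T Z) k f"]
    by (simp add: kcomp_def comp_assoc ar_comp typing)
qed

lemma kcomp_pure:
  assumes [simp]: "X \<in> Obj C" "Y \<in> Obj C" "Z \<in> Obj C" "h \<in> Hom C X Y" "g \<in> Hom C Y (ob T Z)"
  shows "kcomp X Y Z g (pure X Y h) = Comp C X Y (ob T Z) g h"
proof -
  have "Comp C Y (ob T (ob T Z)) (ob T Z) (\<mu> Z) (Comp C Y (ob T Y) (ob T (ob T Z)) (ar T Y (ob T Z) g) (\<eta> Y))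
    = Comp C Y (ob T Z) (ob T Z) (Comp C (ob T Z) (ob T (ob T Z)) (ob T Z) (\<mu> Z) (\<eta> (ob T Z))) g"
    by (simp add: unit_nat comp_assoc typing)
  then have "Comp C X Y (ob T Z) (Comp C Y (ob T (ob T Z)) (ob T Z) (\<mu> Z)
      (Comp C Y (ob T Y) (ob T (ob T Z)) (ar T Y (ob T Z) g) (\<eta> Y))) h = Comp C X Y (ob T Z) g h"
    by (simp add: mult_unit_left comp_ident_left typing)
  then show ?thesis
    by (simp add: kcomp_def pure_def comp_assoc typing)
qed

lemma pure_kcomp:
  assumes [simp]: "X \<in> Obj C" "Y \<in> Obj C" "Z \<in> Obj C" "f \<in> Hom C X (ob T Y)" "h \<in> Hom C Y Z"
  shows "kcomp X Y Z (pure Y Z h) f = Comp C X (ob T Y) (ob T Z) (ar T Y Z h) f"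
proof -
  have "Comp C (ob T Y) (ob T (ob T Z)) (ob T Z) (\<mu> Z) (ar T Y (ob T Z) (pure Y Z h))
    = Comp C (ob T Y) (ob T Z) (ob T Z)
        (Comp C (ob T Z) (ob T (ob T Z)) (ob T Z) (\<mu> Z) (ar T Z (ob T Z) (\<eta> Z))) (ar T Y Z h)"
    by (simp add: pure_def ar_comp comp_assoc typing)
  then show ?thesis
    by (simp add: kcomp_def mult_unit_right comp_ident_left typing)
qed

lemma kcomp_pure_pure:
  assumes [simp]: "X \<in> Obj C" "Y \<in> Obj C" "Z \<in> Obj C" "f \<in> Hom C X Y" "g \<in> Hom C Y Z"
  shows "kcomp X Y Z (pure Y Z g) (pure X Y f) = pure X Z (Comp C X Y Z g f)"
  by (simp add: kcomp_pure pure_Hom) (simp add: pure_def comp_assoc typing)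

lemma kcomp_ident_left:
  "\<lbrakk>X \<in> Obj C; Y \<in> Obj C; f \<in> Hom C X (ob T Y)\<rbrakk> \<Longrightarrow> kcomp X Y Y (\<eta> Y) f = f"
  using pure_kcomp[of X Y Y f "Ident C Y"]
  by (simp add: pure_ident ar_ident comp_ident_left typing)

lemma kcomp_ident_right:
  "\<lbrakk>X \<in> Obj C; Y \<in> Obj C; f \<in> Hom C X (ob T Y)\<rbrakk> \<Longrightarrow> kcomp X X Y f (\<eta> X) = f"
  using kcomp_pure[of X X Y "Ident C X" f]
  by (simp add: pure_ident comp_ident_right typing)

section \<open>Left action of an object on Kleisli maps\<close>

definition lact :: "'o \<Rightarrow> 'o \<Rightarrow> 'o \<Rightarrow> 'm \<Rightarrow> 'm" where
  "lact X Y Z f = Comp C (X \<otimes> Y) (X \<otimes> ob T Z) (ob T (X \<otimes> Z)) (st X Z)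
     (tensA C X X Y (ob T Z) (Ident C X) f)"

lemma lact_Hom:
  "\<lbrakk>X \<in> Obj C; Y \<in> Obj C; Z \<in> Obj C; f \<in> Hom C Y (ob T Z)\<rbrakk>
    \<Longrightarrow> lact X Y Z f \<in> Hom C (X \<otimes> Y) (ob T (X \<otimes> Z))"
  by (simp add: lact_def typing)

lemma tensA_ident_comp:
  assumes [simp]: "X \<in> Obj C" "Y \<in> Obj C" "Z \<in> Obj C" "W \<in> Obj C" "f \<in> Hom C Y Z" "g \<in> Hom C Z W"
  shows "Comp C (X \<otimes> Y) (X \<otimes> Z) (X \<otimes> W) (tensA C X X Z W (Ident C X) g)
    (tensA C X X Y Z (Ident C X) f) = tensA C X X Y W (Ident C X) (Comp C Y Z W g f)"
  by (simp add: tensA_comp[symmetric] typing comp_ident_left)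

lemma lact_pure:
  assumes [simp]: "X \<in> Obj C" "Y \<in> Obj C" "Z \<in> Obj C" "h \<in> Hom C Y Z"
  shows "lact X Y Z (pure Y Z h) = pure (X \<otimes> Y) (X \<otimes> Z) (tensA C X X Y Z (Ident C X) h)"
proof -
  have "lact X Y Z (pure Y Z h) = Comp C (X \<otimes> Y) (X \<otimes> Z) (ob T (X \<otimes> Z))
      (Comp C (X \<otimes> Z) (X \<otimes> ob T Z) (ob T (X \<otimes> Z)) (st X Z)
        (tensA C X X Z (ob T Z) (Ident C X) (\<eta> Z)))
      (tensA C X X Y Z (Ident C X) h)"
    by (simp add: lact_def pure_def tensA_ident_comp[symmetric] comp_assoc typing)
  then show ?thesis
    by (simp add: st_unit pure_def)
qed

lemma lact_ident: "\<lbrakk>X \<in> Obj C; Y \<in> Obj C\<rbrakk> \<Longrightarrow> lact X Y Y (\<eta> Y) = \<eta> (X \<otimes> Y)"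
  using lact_pure[of X Y Y "Ident C Y"] by (simp add: pure_ident tensA_ident typing)

text \<open>Functoriality of the action: \<open>st_mult\<close> moves the strength past the
  multiplication, and \<open>st_nat\<close> moves it past \<open>T g\<close>.\<close>

lemma lact_kcomp:
  assumes [simp]: "X \<in> Obj C" "Y \<in> Obj C" "Z \<in> Obj C" "W \<in> Obj C"
    "f \<in> Hom C Y (ob T Z)" "g \<in> Hom C Z (ob T W)"
  shows "lact X Y W (kcomp Y Z W g f) = kcomp (X \<otimes> Y) (X \<otimes> Z) (X \<otimes> W) (lact X Z W g) (lact X Y Z f)"
proof -
  let ?T = "ob T"
  let ?f = "tensA C X X Y (?T Z) (Ident C X) f"
  let ?g = "tensA C X X (?T Z) (?T (?T W)) (Ident C X) (ar T Z (?T W) g)"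
  have "lact X Y W (kcomp Y Z W g f) = Comp C (X \<otimes> Y) (X \<otimes> ?T (?T W)) (?T (X \<otimes> W))
      (Comp C (X \<otimes> ?T (?T W)) (X \<otimes> ?T W) (?T (X \<otimes> W)) (st X W)
        (tensA C X X (?T (?T W)) (?T W) (Ident C X) (\<mu> W)))
      (Comp C (X \<otimes> Y) (X \<otimes> ?T Z) (X \<otimes> ?T (?T W)) ?g ?f)"
    by (simp add: lact_def kcomp_def tensA_ident_comp[symmetric] comp_assoc typing)
  also have "\<dots> = Comp C (X \<otimes> Y) (?T (X \<otimes> ?T W)) (?T (X \<otimes> W))
      (Comp C (?T (X \<otimes> ?T W)) (?T (?T (X \<otimes> W))) (?T (X \<otimes> W)) (\<mu> (X \<otimes> W))
        (ar T (X \<otimes> ?T W) (?T (X \<otimes> W)) (st X W)))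
      (Comp C (X \<otimes> Y) (X \<otimes> ?T Z) (?T (X \<otimes> ?T W))
        (Comp C (X \<otimes> ?T Z) (X \<otimes> ?T (?T W)) (?T (X \<otimes> ?T W)) (st X (?T W)) ?g) ?f)"
    by (simp add: st_mult comp_assoc typing)
  also have "\<dots> = kcomp (X \<otimes> Y) (X \<otimes> Z) (X \<otimes> W) (lact X Z W g) (lact X Y Z f)"
    by (simp add: st_nat lact_def kcomp_def ar_comp comp_assoc typing)
  finally show ?thesis .
qed

text \<open>A pure map on the left commutes with any effect on the right. This is naturality of the
  strength in its first argument, and the source of all centrality below.\<close>

lemma lact_natural:
  assumes [simp]: "X \<in> Obj C" "X' \<in> Obj C" "Y \<in> Obj C" "Z \<in> Obj C"
    "h \<in> Hom C X X'" "f \<in> Hom C Y (ob T Z)"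
  shows "kcomp (X \<otimes> Y) (X \<otimes> Z) (X' \<otimes> Z)
      (pure (X \<otimes> Z) (X' \<otimes> Z) (tensA C X X' Z Z h (Ident C Z))) (lact X Y Z f)
    = kcomp (X \<otimes> Y) (X' \<otimes> Y) (X' \<otimes> Z) (lact X' Y Z f)
      (pure (X \<otimes> Y) (X' \<otimes> Y) (tensA C X X' Y Y h (Ident C Y)))"
proof -
  have "kcomp (X \<otimes> Y) (X \<otimes> Z) (X' \<otimes> Z)
      (pure (X \<otimes> Z) (X' \<otimes> Z) (tensA C X X' Z Z h (Ident C Z))) (lact X Y Z f)
    = Comp C (X \<otimes> Y) (X \<otimes> ob T Z) (ob T (X' \<otimes> Z))
       (Comp C (X \<otimes> ob T Z) (ob T (X \<otimes> Z)) (ob T (X' \<otimes> Z))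
         (ar T (X \<otimes> Z) (X' \<otimes> Z) (tensA C X X' Z Z h (Ident C Z))) (st X Z))
       (tensA C X X Y (ob T Z) (Ident C X) f)"
    by (simp add: pure_kcomp lact_Hom typing) (simp add: lact_def comp_assoc typing)
  also have "\<dots> = Comp C (X \<otimes> Y) (X' \<otimes> ob T Z) (ob T (X' \<otimes> Z)) (st X' Z)
       (tensA C X X' Y (ob T Z) h f)"
    by (simp add: st_nat[symmetric] comp_assoc tensA_comp[symmetric] ar_ident
        comp_ident_left comp_ident_right typing)
  also have "\<dots> = kcomp (X \<otimes> Y) (X' \<otimes> Y) (X' \<otimes> Z) (lact X' Y Z f)
      (pure (X \<otimes> Y) (X' \<otimes> Y) (tensA C X X' Y Y h (Ident C Y)))"
    by (simp add: kcomp_pure lact_Hom typing)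
      (simp add: lact_def comp_assoc tensA_comp[symmetric] comp_ident_left comp_ident_right typing)
  finally show ?thesis .
qed

text \<open>Naturality of the associator in its last argument, the one instance that
  \<open>st_assoc\<close> supplies directly.\<close>

lemma lact_assoc:
  assumes [simp]: "X \<in> Obj C" "Y \<in> Obj C" "Z \<in> Obj C" "W \<in> Obj C" "f \<in> Hom C Z (ob T W)"
  shows "kcomp ((X \<otimes> Y) \<otimes> Z) ((X \<otimes> Y) \<otimes> W) (X \<otimes> (Y \<otimes> W))
      (pure ((X \<otimes> Y) \<otimes> W) (X \<otimes> (Y \<otimes> W)) (assoc C X Y W)) (lact (X \<otimes> Y) Z W f)
    = kcomp ((X \<otimes> Y) \<otimes> Z) (X \<otimes> (Y \<otimes> Z)) (X \<otimes> (Y \<otimes> W)) (lact X (Y \<otimes> Z) (Y \<otimes> W) (lact Y Z W f))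
        (pure ((X \<otimes> Y) \<otimes> Z) (X \<otimes> (Y \<otimes> Z)) (assoc C X Y Z))"
proof -
  let ?T = "ob T"
  let ?f = "tensA C (X \<otimes> Y) (X \<otimes> Y) Z (?T W) (tensA C X X Y Y (Ident C X) (Ident C Y)) f"
  have "kcomp ((X \<otimes> Y) \<otimes> Z) ((X \<otimes> Y) \<otimes> W) (X \<otimes> (Y \<otimes> W))
      (pure ((X \<otimes> Y) \<otimes> W) (X \<otimes> (Y \<otimes> W)) (assoc C X Y W)) (lact (X \<otimes> Y) Z W f)
    = Comp C ((X \<otimes> Y) \<otimes> Z) ((X \<otimes> Y) \<otimes> ?T W) (?T (X \<otimes> (Y \<otimes> W)))
        (Comp C ((X \<otimes> Y) \<otimes> ?T W) (?T ((X \<otimes> Y) \<otimes> W)) (?T (X \<otimes> (Y \<otimes> W)))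
          (ar T ((X \<otimes> Y) \<otimes> W) (X \<otimes> (Y \<otimes> W)) (assoc C X Y W)) (st (X \<otimes> Y) W)) ?f"
    by (simp add: pure_kcomp lact_Hom typing) (simp add: lact_def comp_assoc tensA_ident typing)
  also have "\<dots> = Comp C ((X \<otimes> Y) \<otimes> Z) (X \<otimes> ?T (Y \<otimes> W)) (?T (X \<otimes> (Y \<otimes> W))) (st X (Y \<otimes> W))
      (Comp C ((X \<otimes> Y) \<otimes> Z) (X \<otimes> (Y \<otimes> ?T W)) (X \<otimes> ?T (Y \<otimes> W))
        (tensA C X X (Y \<otimes> ?T W) (?T (Y \<otimes> W)) (Ident C X) (st Y W))
        (Comp C ((X \<otimes> Y) \<otimes> Z) ((X \<otimes> Y) \<otimes> ?T W) (X \<otimes> (Y \<otimes> ?T W)) (assoc C X Y (?T W)) ?f))"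
    by (simp add: st_assoc comp_assoc typing)
  also have "\<dots> = kcomp ((X \<otimes> Y) \<otimes> Z) (X \<otimes> (Y \<otimes> Z)) (X \<otimes> (Y \<otimes> W))
        (lact X (Y \<otimes> Z) (Y \<otimes> W) (lact Y Z W f))
        (pure ((X \<otimes> Y) \<otimes> Z) (X \<otimes> (Y \<otimes> Z)) (assoc C X Y Z))"
    by (simp add: kcomp_pure lact_Hom typing)
      (simp add: assoc_nat lact_def comp_assoc tensA_ident_comp[symmetric] typing)
  finally show ?thesis .
qed

lemma lact_lunit:
  assumes [simp]: "X \<in> Obj C" "Y \<in> Obj C" "f \<in> Hom C X (ob T Y)"
  shows "kcomp (\<one> \<otimes> X) (\<one> \<otimes> Y) Y (pure (\<one> \<otimes> Y) Y (lunit C Y)) (lact \<one> X Y f)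
    = kcomp (\<one> \<otimes> X) X Y f (pure (\<one> \<otimes> X) X (lunit C X))"
proof -
  have "kcomp (\<one> \<otimes> X) (\<one> \<otimes> Y) Y (pure (\<one> \<otimes> Y) Y (lunit C Y)) (lact \<one> X Y f)
    = Comp C (\<one> \<otimes> X) (\<one> \<otimes> ob T Y) (ob T Y) (Comp C (\<one> \<otimes> ob T Y) (ob T (\<one> \<otimes> Y)) (ob T Y)
        (ar T (\<one> \<otimes> Y) Y (lunit C Y)) (st \<one> Y)) (tensA C \<one> \<one> X (ob T Y) (Ident C \<one>) f)"
    by (simp add: pure_kcomp lact_Hom typing) (simp add: lact_def comp_assoc typing)
  then show ?thesis
    by (simp add: st_lunit lunit_nat kcomp_pure typing)
qed

section \<open>Right action, obtained by conjugating the left action with the symmetry\<close>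

definition ract :: "'o \<Rightarrow> 'o \<Rightarrow> 'o \<Rightarrow> 'm \<Rightarrow> 'm" where
  "ract X Y Z f = kcomp (X \<otimes> Z) (Z \<otimes> Y) (Y \<otimes> Z) (pure (Z \<otimes> Y) (Y \<otimes> Z) (swap C Z Y))
     (kcomp (X \<otimes> Z) (Z \<otimes> X) (Z \<otimes> Y) (lact Z X Y f) (pure (X \<otimes> Z) (Z \<otimes> X) (swap C X Z)))"

lemma ract_Hom:
  "\<lbrakk>X \<in> Obj C; Y \<in> Obj C; Z \<in> Obj C; f \<in> Hom C X (ob T Y)\<rbrakk>
    \<Longrightarrow> ract X Y Z f \<in> Hom C (X \<otimes> Z) (ob T (Y \<otimes> Z))"
  by (simp add: ract_def kcomp_Hom pure_Hom lact_Hom typing)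

lemmas ktyping = kcomp_Hom pure_Hom lact_Hom ract_Hom

lemma ract_swap:
  assumes [simp]: "X \<in> Obj C" "Y \<in> Obj C" "Z \<in> Obj C" "f \<in> Hom C X (ob T Y)"
  shows "kcomp (Z \<otimes> X) (X \<otimes> Z) (Y \<otimes> Z) (ract X Y Z f) (pure (Z \<otimes> X) (X \<otimes> Z) (swap C Z X))
    = kcomp (Z \<otimes> X) (Z \<otimes> Y) (Y \<otimes> Z) (pure (Z \<otimes> Y) (Y \<otimes> Z) (swap C Z Y)) (lact Z X Y f)"
  by (simp add: ract_def kcomp_assoc kcomp_pure_pure swap_swap pure_ident kcomp_ident_right
      ktyping typing)

lemma lact_swap:
  assumes [simp]: "X \<in> Obj C" "Y \<in> Obj C" "Z \<in> Obj C" "f \<in> Hom C X (ob T Y)"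
  shows "kcomp (X \<otimes> Z) (Z \<otimes> X) (Z \<otimes> Y) (lact Z X Y f) (pure (X \<otimes> Z) (Z \<otimes> X) (swap C X Z))
    = kcomp (X \<otimes> Z) (Y \<otimes> Z) (Z \<otimes> Y) (pure (Y \<otimes> Z) (Z \<otimes> Y) (swap C Y Z)) (ract X Y Z f)"
proof -
  let ?g = "kcomp (X \<otimes> Z) (Z \<otimes> X) (Z \<otimes> Y) (lact Z X Y f) (pure (X \<otimes> Z) (Z \<otimes> X) (swap C X Z))"
  have "kcomp (X \<otimes> Z) (Y \<otimes> Z) (Z \<otimes> Y) (pure (Y \<otimes> Z) (Z \<otimes> Y) (swap C Y Z)) (ract X Y Z f)
    = kcomp (X \<otimes> Z) (Z \<otimes> Y) (Z \<otimes> Y) (kcomp (Z \<otimes> Y) (Y \<otimes> Z) (Z \<otimes> Y)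
        (pure (Y \<otimes> Z) (Z \<otimes> Y) (swap C Y Z)) (pure (Z \<otimes> Y) (Y \<otimes> Z) (swap C Z Y))) ?g"
    by (simp add: ract_def kcomp_assoc ktyping typing)
  then show ?thesis
    by (simp add: kcomp_pure_pure swap_swap pure_ident kcomp_ident_left ktyping typing)
qed

text \<open>Between the two conjugated factors the inner symmetries cancel; \<open>lact_swap\<close>
  performs this cancellation.\<close>

lemma ract_kcomp:
  assumes [simp]: "X \<in> Obj C" "Y \<in> Obj C" "Z \<in> Obj C" "W \<in> Obj C"
    "f \<in> Hom C X (ob T Y)" "g \<in> Hom C Y (ob T Z)"
  shows "ract X Z W (kcomp X Y Z g f) = kcomp (X \<otimes> W) (Y \<otimes> W) (Z \<otimes> W) (ract Y Z W g) (ract X Y W f)"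
proof -
  have "ract X Z W (kcomp X Y Z g f) = kcomp (X \<otimes> W) (W \<otimes> Z) (Z \<otimes> W)
      (pure (W \<otimes> Z) (Z \<otimes> W) (swap C W Z)) (kcomp (X \<otimes> W) (W \<otimes> Y) (W \<otimes> Z) (lact W Y Z g)
        (kcomp (X \<otimes> W) (Y \<otimes> W) (W \<otimes> Y) (pure (Y \<otimes> W) (W \<otimes> Y) (swap C Y W)) (ract X Y W f)))"
    by (simp add: ract_def[of X Z] lact_kcomp kcomp_assoc lact_swap ktyping typing)
  then show ?thesis
    by (simp add: ract_def[of Y Z] kcomp_assoc ktyping typing)
qed

lemma ract_pure:
  assumes [simp]: "X \<in> Obj C" "Y \<in> Obj C" "Z \<in> Obj C" "h \<in> Hom C X Y"
  shows "ract X Y Z (pure X Y h) = pure (X \<otimes> Z) (Y \<otimes> Z) (tensA C X Y Z Z h (Ident C Z))"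
proof -
  have "ract X Y Z (pure X Y h) = pure (X \<otimes> Z) (Y \<otimes> Z) (Comp C (X \<otimes> Z) (Y \<otimes> Z) (Y \<otimes> Z)
      (Comp C (Y \<otimes> Z) (Z \<otimes> Y) (Y \<otimes> Z) (swap C Z Y) (swap C Y Z)) (tensA C X Y Z Z h (Ident C Z)))"
    by (simp add: ract_def lact_pure kcomp_pure_pure swap_nat[symmetric] comp_assoc typing)
  then show ?thesis
    by (simp add: swap_swap comp_ident_left typing)
qed

text \<open>The mirror image of \<open>lact_natural\<close>, with \<open>swap_nat\<close> carrying
  \<open>h\<close> across the two symmetries.\<close>

lemma ract_natural:
  assumes [simp]: "X \<in> Obj C" "Y \<in> Obj C" "Z \<in> Obj C" "Z' \<in> Obj C"
    "f \<in> Hom C X (ob T Y)" "h \<in> Hom C Z Z'"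
  shows "kcomp (X \<otimes> Z) (Y \<otimes> Z) (Y \<otimes> Z')
      (pure (Y \<otimes> Z) (Y \<otimes> Z') (tensA C Y Y Z Z' (Ident C Y) h)) (ract X Y Z f)
    = kcomp (X \<otimes> Z) (X \<otimes> Z') (Y \<otimes> Z') (ract X Y Z' f)
      (pure (X \<otimes> Z) (X \<otimes> Z') (tensA C X X Z Z' (Ident C X) h))"
proof -
  have "kcomp (X \<otimes> Z) (Y \<otimes> Z) (Y \<otimes> Z')
      (pure (Y \<otimes> Z) (Y \<otimes> Z') (tensA C Y Y Z Z' (Ident C Y) h)) (ract X Y Z f)
    = kcomp (X \<otimes> Z) (Z \<otimes> Y) (Y \<otimes> Z')
        (pure (Z \<otimes> Y) (Y \<otimes> Z') (Comp C (Z \<otimes> Y) (Y \<otimes> Z) (Y \<otimes> Z')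
          (tensA C Y Y Z Z' (Ident C Y) h) (swap C Z Y)))
        (kcomp (X \<otimes> Z) (Z \<otimes> X) (Z \<otimes> Y) (lact Z X Y f) (pure (X \<otimes> Z) (Z \<otimes> X) (swap C X Z)))"
    by (simp add: ract_def kcomp_assoc[symmetric] kcomp_pure_pure ktyping typing)
  also have "\<dots> = kcomp (X \<otimes> Z) (Z' \<otimes> Y) (Y \<otimes> Z') (pure (Z' \<otimes> Y) (Y \<otimes> Z') (swap C Z' Y))
        (kcomp (X \<otimes> Z) (Z \<otimes> X) (Z' \<otimes> Y)
          (kcomp (Z \<otimes> X) (Z \<otimes> Y) (Z' \<otimes> Y)
            (pure (Z \<otimes> Y) (Z' \<otimes> Y) (tensA C Z Z' Y Y h (Ident C Y))) (lact Z X Y f))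
          (pure (X \<otimes> Z) (Z \<otimes> X) (swap C X Z)))"
    by (simp add: swap_nat[symmetric] kcomp_pure_pure[symmetric] kcomp_assoc ktyping typing)
  also have "\<dots> = kcomp (X \<otimes> Z) (X \<otimes> Z') (Y \<otimes> Z') (ract X Y Z' f)
      (pure (X \<otimes> Z) (X \<otimes> Z') (tensA C X X Z Z' (Ident C X) h))"
    by (simp add: lact_natural ract_def kcomp_assoc kcomp_pure_pure swap_nat ktyping typing)
  finally show ?thesis .
qed

section \<open>Thunks, which return a computation unevaluated, and thunkable Kleisli maps\<close>

definition thunk :: "'o \<Rightarrow> 'm" where
  "thunk X = pure X (ob T X) (\<eta> X)"

lemma thunk_Hom: "X \<in> Obj C \<Longrightarrow> thunk X \<in> Hom C X (ob T (ob T X))"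
  by (simp add: thunk_def pure_Hom typing)

text \<open>
  The identity on \<open>T X\<close> is a Kleisli map \<open>T X \<rightarrow> X\<close>, a retraction of \<open>thunk X\<close>. Every Kleisli map
  \<open>f\<close> factors as this map after the pure map \<open>f : X \<rightarrow> T Y\<close>, and \<open>f\<close> is thunkable when
  that pure map is \<open>f\<close> followed by \<open>thunk Y\<close>.
\<close>

definition kthunkable :: "'o \<Rightarrow> 'o \<Rightarrow> 'm \<Rightarrow> bool" where
  "kthunkable X Y f \<longleftrightarrow> kcomp X Y (ob T Y) (thunk Y) f = pure X (ob T Y) f"

lemma kthunkable_iff:
  "\<lbrakk>X \<in> Obj C; Y \<in> Obj C; f \<in> Hom C X (ob T Y)\<rbrakk> \<Longrightarrow> kthunkable X Y f \<longleftrightarrow>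
     Comp C X (ob T Y) (ob T (ob T Y)) (ar T Y (ob T Y) (\<eta> Y)) f
       = Comp C X (ob T Y) (ob T (ob T Y)) (\<eta> (ob T Y)) f"
  by (simp add: kthunkable_def thunk_def pure_kcomp typing) (simp add: pure_def)

lemma kthunkable_pure:
  assumes [simp]: "X \<in> Obj C" "Y \<in> Obj C" "h \<in> Hom C X Y"
  shows "kthunkable X Y (pure X Y h)"
  by (simp add: kthunkable_def thunk_def kcomp_pure_pure typing) (simp add: pure_def)

lemma kthunkable_ident: "X \<in> Obj C \<Longrightarrow> kthunkable X X (\<eta> X)"
  using kthunkable_pure[of X X "Ident C X"] by (simp add: pure_ident typing)

text \<open>Thunkability of \<open>g\<close> amounts to naturality of \<open>thunk\<close> with
  respect to \<open>g\<close> and its Kleisli extension. Applied to the thunk of \<open>f\<close>,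
  it moves \<open>thunk\<close> through both maps in turn.\<close>

lemma kthunkable_kcomp:
  assumes [simp]: "X \<in> Obj C" "Y \<in> Obj C" "Z \<in> Obj C" "f \<in> Hom C X (ob T Y)" "g \<in> Hom C Y (ob T Z)"
    and f: "kthunkable X Y f" and g: "kthunkable Y Z g"
  shows "kthunkable X Z (kcomp X Y Z g f)"
proof -
  \<comment> \<open>The Kleisli extension of \<open>g\<close>, a map \<open>T Y\<close> ->
    \<open>T Z\<close> of \<open>C\<close>; its pure image acts on unevaluated computations.\<close>
  let ?g = "Comp C (ob T Y) (ob T (ob T Z)) (ob T Z) (\<mu> Z) (ar T Y (ob T Z) g)"
  have "kcomp Y (ob T Y) (ob T Z) (pure (ob T Y) (ob T Z) ?g) (thunk Y)
    = pure Y (ob T Z) (kcomp Y Y Z g (\<eta> Y))"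
    by (simp add: thunk_def kcomp_pure_pure typing) (simp add: kcomp_def)
  then have *: "kcomp Y Z (ob T Z) (thunk Z) g
    = kcomp Y (ob T Y) (ob T Z) (pure (ob T Y) (ob T Z) ?g) (thunk Y)"
    using g by (simp add: kthunkable_def kcomp_ident_right)
  have "kcomp X Z (ob T Z) (thunk Z) (kcomp X Y Z g f)
    = kcomp X Y (ob T Z) (kcomp Y Z (ob T Z) (thunk Z) g) f"
    by (simp add: kcomp_assoc thunk_Hom typing)
  also have "\<dots> = kcomp X (ob T Y) (ob T Z) (pure (ob T Y) (ob T Z) ?g) (pure X (ob T Y) f)"
    unfolding * using f by (simp add: kcomp_assoc kthunkable_def thunk_Hom ktyping typing)
  also have "\<dots> = pure X (ob T Z) (kcomp X Y Z g f)"
    by (simp add: kcomp_pure_pure typing) (simp add: kcomp_def)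
  finally show ?thesis
    by (simp add: kthunkable_def)
qed

text \<open>By \<open>st_unit\<close>, the strength turns the action of \<open>X\<close> on
  \<open>thunk Z\<close> into \<open>thunk (X \<otimes> Z)\<close>; functoriality of the action does
  the rest.\<close>

lemma kthunkable_lact:
  assumes [simp]: "X \<in> Obj C" "Y \<in> Obj C" "Z \<in> Obj C" "f \<in> Hom C Y (ob T Z)"
    and f: "kthunkable Y Z f"
  shows "kthunkable (X \<otimes> Y) (X \<otimes> Z) (lact X Y Z f)"
proof -
  let ?XY = "X \<otimes> Y" and ?XZ = "X \<otimes> Z" and ?XTZ = "X \<otimes> ob T Z"
  have "pure ?XY (ob T ?XZ) (lact X Y Z f)
    = kcomp ?XY ?XTZ (ob T ?XZ) (pure ?XTZ (ob T ?XZ) (st X Z)) (lact X Y (ob T Z) (pure Y (ob T Z) f))"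
    by (simp add: lact_pure kcomp_pure_pure typing) (simp add: lact_def)
  also have "\<dots> = kcomp ?XY ?XTZ (ob T ?XZ) (pure ?XTZ (ob T ?XZ) (st X Z))
      (kcomp ?XY ?XZ ?XTZ (lact X Z (ob T Z) (thunk Z)) (lact X Y Z f))"
    using f by (simp add: kthunkable_def[symmetric] lact_kcomp[symmetric] thunk_Hom typing)
      (simp add: kthunkable_def)
  also have "\<dots> = kcomp ?XY ?XZ (ob T ?XZ) (kcomp ?XZ ?XTZ (ob T ?XZ) (pure ?XTZ (ob T ?XZ) (st X Z))
      (lact X Z (ob T Z) (thunk Z))) (lact X Y Z f)"
    by (simp add: kcomp_assoc ktyping thunk_Hom typing)
  also have "kcomp ?XZ ?XTZ (ob T ?XZ) (pure ?XTZ (ob T ?XZ) (st X Z)) (lact X Z (ob T Z) (thunk Z))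
      = thunk ?XZ"
    by (simp add: thunk_def lact_pure kcomp_pure_pure st_unit typing)
  finally show ?thesis
    by (simp add: kthunkable_def)
qed

lemma kthunkable_ract:
  assumes [simp]: "X \<in> Obj C" "Y \<in> Obj C" "Z \<in> Obj C" "f \<in> Hom C X (ob T Y)"
    and f: "kthunkable X Y f"
  shows "kthunkable (X \<otimes> Z) (Y \<otimes> Z) (ract X Y Z f)"
  using f by (simp add: ract_def kthunkable_kcomp kthunkable_pure kthunkable_lact ktyping typing)

text \<open>
  A thunkable map \<open>f\<close> can be evaluated in either order: thunk it, commute the resulting pure
  map past \<open>g\<close>, and force it afterwards.
\<close>

lemma kthunkable_central:
  assumes [simp]: "X \<in> Obj C" "Y \<in> Obj C" "Z \<in> Obj C" "W \<in> Obj C"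
    "f \<in> Hom C X (ob T Y)" "g \<in> Hom C Z (ob T W)"
    and f: "kthunkable X Y f"
  shows "kcomp (X \<otimes> Z) (X \<otimes> W) (Y \<otimes> W) (ract X Y W f) (lact X Z W g)
    = kcomp (X \<otimes> Z) (Y \<otimes> Z) (Y \<otimes> W) (lact Y Z W g) (ract X Y Z f)"
proof -
  let ?TY = "ob T Y"
  let ?r = "Ident C (ob T Y)"
  have r: "?r \<in> Hom C ?TY (ob T Y)"
    by (simp add: typing)
  have fr: "f = kcomp X ?TY Y ?r (pure X ?TY f)"
    by (simp add: kcomp_pure comp_ident_left typing)
  have rt: "kcomp Y ?TY Y ?r (thunk Y) = \<eta> Y"
    by (simp add: thunk_def kcomp_pure comp_ident_left typing)
  have "kcomp (X \<otimes> Z) (X \<otimes> W) (Y \<otimes> W) (ract X Y W f) (lact X Z W g)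
    = kcomp (X \<otimes> Z) (?TY \<otimes> W) (Y \<otimes> W) (ract ?TY Y W ?r)
       (kcomp (X \<otimes> Z) (X \<otimes> W) (?TY \<otimes> W) (ract X ?TY W (pure X ?TY f)) (lact X Z W g))"
    by (subst fr) (simp add: ract_kcomp r kcomp_assoc ktyping typing)
  also have "kcomp (X \<otimes> Z) (X \<otimes> W) (?TY \<otimes> W) (ract X ?TY W (pure X ?TY f)) (lact X Z W g)
    = kcomp (X \<otimes> Z) (?TY \<otimes> Z) (?TY \<otimes> W) (lact ?TY Z W g) (ract X ?TY Z (pure X ?TY f))"
    by (simp add: ract_pure lact_natural typing)
  also have "ract X ?TY Z (pure X ?TY f)
    = kcomp (X \<otimes> Z) (Y \<otimes> Z) (?TY \<otimes> Z) (ract Y ?TY Z (thunk Y)) (ract X Y Z f)"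
    using f by (simp add: kthunkable_def ract_kcomp[symmetric] thunk_Hom typing)
  also have "kcomp (X \<otimes> Z) (?TY \<otimes> Z) (?TY \<otimes> W) (lact ?TY Z W g) \<dots>
    = kcomp (X \<otimes> Z) (Y \<otimes> Z) (?TY \<otimes> W)
       (kcomp (Y \<otimes> Z) (?TY \<otimes> Z) (?TY \<otimes> W) (lact ?TY Z W g) (ract Y ?TY Z (thunk Y))) (ract X Y Z f)"
    by (simp add: kcomp_assoc ktyping thunk_Hom typing)
  \<comment> \<open>A second commutation: \<open>thunk Y\<close> is itself pure, so it passes back
    over \<open>g\<close> and meets the forcing map \<open>?r\<close>, which cancels it.\<close>
  also have "kcomp (Y \<otimes> Z) (?TY \<otimes> Z) (?TY \<otimes> W) (lact ?TY Z W g) (ract Y ?TY Z (thunk Y))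
    = kcomp (Y \<otimes> Z) (Y \<otimes> W) (?TY \<otimes> W) (ract Y ?TY W (thunk Y)) (lact Y Z W g)"
    by (simp add: thunk_def ract_pure lact_natural typing)
  also have "kcomp (X \<otimes> Z) (?TY \<otimes> W) (Y \<otimes> W) (ract ?TY Y W ?r)
      (kcomp (X \<otimes> Z) (Y \<otimes> Z) (?TY \<otimes> W) \<dots> (ract X Y Z f))
    = kcomp (X \<otimes> Z) (Y \<otimes> W) (Y \<otimes> W)
       (kcomp (Y \<otimes> W) (?TY \<otimes> W) (Y \<otimes> W) (ract ?TY Y W ?r) (ract Y ?TY W (thunk Y)))
       (kcomp (X \<otimes> Z) (Y \<otimes> Z) (Y \<otimes> W) (lact Y Z W g) (ract X Y Z f))"
    by (simp add: kcomp_assoc ktyping thunk_Hom typing)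
  also have "kcomp (Y \<otimes> W) (?TY \<otimes> W) (Y \<otimes> W) (ract ?TY Y W ?r) (ract Y ?TY W (thunk Y))
    = ract Y Y W (\<eta> Y)"
    by (simp add: ract_kcomp[symmetric] r thunk_Hom rt typing)
  also have "ract Y Y W (\<eta> Y) = \<eta> (Y \<otimes> W)"
    by (simp add: pure_ident[symmetric] ract_pure tensA_ident typing)
  finally show ?thesis
    by (simp add: kcomp_ident_left ktyping typing)
qed

section \<open>Tensor product of Kleisli maps, evaluating the left argument first\<close>

definition ktens :: "'o \<Rightarrow> 'o \<Rightarrow> 'o \<Rightarrow> 'o \<Rightarrow> 'm \<Rightarrow> 'm \<Rightarrow> 'm" where
  "ktens X X' Y Y' f g =
     kcomp (X \<otimes> Y) (X' \<otimes> Y) (X' \<otimes> Y') (lact X' Y Y' g) (ract X X' Y f)"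

lemma ktens_Hom:
  "\<lbrakk>X \<in> Obj C; X' \<in> Obj C; Y \<in> Obj C; Y' \<in> Obj C; f \<in> Hom C X (ob T X'); g \<in> Hom C Y (ob T Y')\<rbrakk>
    \<Longrightarrow> ktens X X' Y Y' f g \<in> Hom C (X \<otimes> Y) (ob T (X' \<otimes> Y'))"
  by (simp add: ktens_def ktyping typing)

lemma kthunkable_ktens:
  assumes "X \<in> Obj C" "X' \<in> Obj C" "Y \<in> Obj C" "Y' \<in> Obj C" "f \<in> Hom C X (ob T X')"
    "g \<in> Hom C Y (ob T Y')" "kthunkable X X' f" "kthunkable Y Y' g"
  shows "kthunkable (X \<otimes> Y) (X' \<otimes> Y') (ktens X X' Y Y' f g)"
  using assms by (simp add: ktens_def kthunkable_kcomp kthunkable_lact kthunkable_ract ktyping typing)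

lemma ktens_pure:
  assumes [simp]: "X \<in> Obj C" "X' \<in> Obj C" "Y \<in> Obj C" "Y' \<in> Obj C" "f \<in> Hom C X X'" "g \<in> Hom C Y Y'"
  shows "ktens X X' Y Y' (pure X X' f) (pure Y Y' g)
    = pure (X \<otimes> Y) (X' \<otimes> Y') (tensA C X X' Y Y' f g)"
  by (simp add: ktens_def lact_pure ract_pure kcomp_pure_pure tensA_comp[symmetric]
      comp_ident_left comp_ident_right typing)

lemma ktens_ident:
  assumes [simp]: "X \<in> Obj C" "Y \<in> Obj C"
  shows "ktens X X Y Y (\<eta> X) (\<eta> Y) = \<eta> (X \<otimes> Y)"
  using ktens_pure[of X X Y Y "Ident C X" "Ident C Y"] by (simp add: pure_ident tensA_ident typing)

lemma ktens_ident_left: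
  assumes [simp]: "X \<in> Obj C" "Y \<in> Obj C" "Y' \<in> Obj C" "g \<in> Hom C Y (ob T Y')"
  shows "ktens X X Y Y' (\<eta> X) g = lact X Y Y' g"
proof -
  have "ract X X Y (\<eta> X) = \<eta> (X \<otimes> Y)"
    by (simp add: pure_ident[symmetric] ract_pure tensA_ident typing)
  then show ?thesis
    by (simp add: ktens_def kcomp_ident_right ktyping typing)
qed

lemma ktens_pure_left:
  assumes [simp]: "X \<in> Obj C" "Y \<in> Obj C" "Y' \<in> Obj C" "g \<in> Hom C Y Y'"
  shows "ktens X X Y Y' (\<eta> X) (pure Y Y' g) = pure (X \<otimes> Y) (X \<otimes> Y') (tensA C X X Y Y' (Ident C X) g)"
  by (simp add: pure_ident[symmetric] ktens_pure typing)

lemma ktens_pure_right: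
  assumes [simp]: "X \<in> Obj C" "X' \<in> Obj C" "Y \<in> Obj C" "f \<in> Hom C X X'"
  shows "ktens X X' Y Y (pure X X' f) (\<eta> Y) = pure (X \<otimes> Y) (X' \<otimes> Y) (tensA C X X' Y Y f (Ident C Y))"
  by (simp add: pure_ident[symmetric] ktens_pure typing)

text \<open>On the left the effects occur in the order \<open>f\<close>, \<open>f'\<close>,
  \<open>g\<close>, \<open>g'\<close>, on the right in the order \<open>f\<close>, \<open>g\<close>,
  \<open>f'\<close>, \<open>g'\<close>. Only \<open>g\<close> and \<open>f'\<close> change places,
  and \<open>f'\<close> is central.\<close>

lemma ktens_kcomp:
  assumes [simp]: "X \<in> Obj C" "X' \<in> Obj C" "X'' \<in> Obj C" "Y \<in> Obj C" "Y' \<in> Obj C" "Y'' \<in> Obj C"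
    "f \<in> Hom C X (ob T X')" "f' \<in> Hom C X' (ob T X'')"
    "g \<in> Hom C Y (ob T Y')" "g' \<in> Hom C Y' (ob T Y'')"
    and f': "kthunkable X' X'' f'"
  shows "ktens X X'' Y Y'' (kcomp X X' X'' f' f) (kcomp Y Y' Y'' g' g)
    = kcomp (X \<otimes> Y) (X' \<otimes> Y') (X'' \<otimes> Y'') (ktens X' X'' Y' Y'' f' g') (ktens X X' Y Y' f g)"
proof -
  have "ktens X X'' Y Y'' (kcomp X X' X'' f' f) (kcomp Y Y' Y'' g' g)
    = kcomp (X \<otimes> Y) (X'' \<otimes> Y') (X'' \<otimes> Y'') (lact X'' Y' Y'' g')
        (kcomp (X \<otimes> Y) (X' \<otimes> Y) (X'' \<otimes> Y')
          (kcomp (X' \<otimes> Y) (X'' \<otimes> Y) (X'' \<otimes> Y') (lact X'' Y Y' g) (ract X' X'' Y f')) (ract X X' Y f))"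
    by (simp add: ktens_def lact_kcomp ract_kcomp kcomp_assoc ktyping typing)
  also have "\<dots> = kcomp (X \<otimes> Y) (X'' \<otimes> Y') (X'' \<otimes> Y'') (lact X'' Y' Y'' g')
        (kcomp (X \<otimes> Y) (X' \<otimes> Y) (X'' \<otimes> Y')
          (kcomp (X' \<otimes> Y) (X' \<otimes> Y') (X'' \<otimes> Y') (ract X' X'' Y' f') (lact X' Y Y' g)) (ract X X' Y f))"
    by (simp add: kthunkable_central f')
  finally show ?thesis
    by (simp add: ktens_def kcomp_assoc ktyping typing)
qed

text \<open>The symmetry reverses the order in which \<open>f\<close> and \<open>g\<close> are
  evaluated; centrality of \<open>g\<close> restores it.\<close>

lemma ktens_swap:
  assumes [simp]: "X \<in> Obj C" "X' \<in> Obj C" "Y \<in> Obj C" "Y' \<in> Obj C"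
    "f \<in> Hom C X (ob T X')" "g \<in> Hom C Y (ob T Y')" and g: "kthunkable Y Y' g"
  shows "kcomp (X \<otimes> Y) (X' \<otimes> Y') (Y' \<otimes> X') (pure (X' \<otimes> Y') (Y' \<otimes> X') (swap C X' Y'))
      (ktens X X' Y Y' f g)
    = kcomp (X \<otimes> Y) (Y \<otimes> X) (Y' \<otimes> X') (ktens Y Y' X X' g f) (pure (X \<otimes> Y) (Y \<otimes> X) (swap C X Y))"
proof -
  have "kcomp (X \<otimes> Y) (X' \<otimes> Y') (Y' \<otimes> X') (pure (X' \<otimes> Y') (Y' \<otimes> X') (swap C X' Y'))
      (ktens X X' Y Y' f g)
    = kcomp (X \<otimes> Y) (X' \<otimes> Y) (Y' \<otimes> X')
        (kcomp (X' \<otimes> Y) (X' \<otimes> Y') (Y' \<otimes> X') (pure (X' \<otimes> Y') (Y' \<otimes> X') (swap C X' Y')) (lact X' Y Y' g))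
        (ract X X' Y f)"
    by (simp add: ktens_def kcomp_assoc ktyping typing)
  also have "\<dots> = kcomp (X \<otimes> Y) (Y \<otimes> X') (Y' \<otimes> X') (ract Y Y' X' g)
        (kcomp (X \<otimes> Y) (X' \<otimes> Y) (Y \<otimes> X') (pure (X' \<otimes> Y) (Y \<otimes> X') (swap C X' Y)) (ract X X' Y f))"
    by (simp add: ract_swap[symmetric] kcomp_assoc ktyping typing)
  also have "\<dots> = kcomp (X \<otimes> Y) (Y \<otimes> X) (Y' \<otimes> X')
        (kcomp (Y \<otimes> X) (Y \<otimes> X') (Y' \<otimes> X') (ract Y Y' X' g) (lact Y X X' f))
        (pure (X \<otimes> Y) (Y \<otimes> X) (swap C X Y))"
    by (simp add: lact_swap[symmetric] kcomp_assoc ktyping typing)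
  finally show ?thesis
    by (simp add: kthunkable_central g ktens_def)
qed

section \<open>The monoidal category of thunkable Kleisli maps\<close>

definition thunkable_kleisli :: "('o, 'm) smoncat" where
  "thunkable_kleisli = \<lparr>Obj = Obj C, Hom = \<lambda>X Y. {f \<in> Hom C X (ob T Y). kthunkable X Y f},
     Ident = \<eta>, Comp = kcomp, tens = tens C, tensA = ktens, unitO = \<one>,
     assoc = \<lambda>X Y Z. pure ((X \<otimes> Y) \<otimes> Z) (X \<otimes> (Y \<otimes> Z)) (assoc C X Y Z),
     lunit = \<lambda>X. pure (\<one> \<otimes> X) X (lunit C X), runit = \<lambda>X. pure (X \<otimes> \<one>) X (runit C X),
     swap = \<lambda>X Y. pure (X \<otimes> Y) (Y \<otimes> X) (swap C X Y)\<rparr>"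

lemma thunkable_kleisli_sel [simp]:
  "Obj thunkable_kleisli = Obj C"
  "Hom thunkable_kleisli X Y = {f \<in> Hom C X (ob T Y). kthunkable X Y f}"
  "Ident thunkable_kleisli = \<eta>"
  "Comp thunkable_kleisli = kcomp"
  "X \<otimes>\<^bsub>thunkable_kleisli\<^esub> Y = X \<otimes> Y"
  "tensA thunkable_kleisli = ktens"
  "\<one>\<^bsub>thunkable_kleisli\<^esub> = \<one>"
  "assoc thunkable_kleisli X Y Z = pure ((X \<otimes> Y) \<otimes> Z) (X \<otimes> (Y \<otimes> Z)) (assoc C X Y Z)"
  "lunit thunkable_kleisli X = pure (\<one> \<otimes> X) X (lunit C X)"
  "runit thunkable_kleisli X = pure (X \<otimes> \<one>) X (runit C X)"
  "swap thunkable_kleisli X Y = pure (X \<otimes> Y) (Y \<otimes> X) (swap C X Y)"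
  by (simp_all add: thunkable_kleisli_def)

lemma category_thunkable_kleisli: "category thunkable_kleisli"
  by unfold_locales
    (simp_all add: typing ktyping kthunkable_ident kthunkable_kcomp kcomp_ident_left
      kcomp_ident_right kcomp_assoc)

lemma pure_iso:
  assumes [simp]: "X \<in> Obj C" "Y \<in> Obj C" and h: "is_iso C X Y h"
  shows "is_iso thunkable_kleisli X Y (pure X Y h)"
proof -
  obtain k where [simp]: "h \<in> Hom C X Y" "k \<in> Hom C Y X"
    and k: "Comp C X Y X k h = Ident C X" "Comp C Y X Y h k = Ident C Y"
    using h unfolding is_iso_def by blast
  have "pure Y X k \<in> Hom thunkable_kleisli Y X"
    by (simp add: ktyping kthunkable_pure)
  moreover have "Comp thunkable_kleisli X Y X (pure Y X k) (pure X Y h) = Ident thunkable_kleisli X"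
    "Comp thunkable_kleisli Y X Y (pure X Y h) (pure Y X k) = Ident thunkable_kleisli Y"
    by (simp_all add: kcomp_pure_pure k pure_ident)
  ultimately show ?thesis
    unfolding is_iso_def by (intro conjI bexI[where x = "pure Y X k"]) (simp_all add: ktyping kthunkable_pure)
qed

text \<open>Equations between structural maps are images of those in \<open>C\<close>, because pure
  maps compose and tensor as in \<open>C\<close>. The equations with effects are covered by
  \<open>ktens_kcomp\<close>, \<open>ktens_swap\<close> and \<open>lact_assoc\<close>.\<close>

lemma symmetric_tensor_thunkable_kleisli: "symmetric_tensor_category thunkable_kleisli"
proof -
  interpret K: category thunkable_kleisli
    by (rule category_thunkable_kleisli)
  show ?thesis
  proof unfold_locales
    fix X Y Z assume "X \<in> Obj thunkable_kleisli" "Y \<in> Obj thunkable_kleisli" "Z \<in> Obj thunkable_kleisli"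
    then show "is_iso thunkable_kleisli ((X \<otimes>\<^bsub>thunkable_kleisli\<^esub> Y) \<otimes>\<^bsub>thunkable_kleisli\<^esub> Z)
        (X \<otimes>\<^bsub>thunkable_kleisli\<^esub> (Y \<otimes>\<^bsub>thunkable_kleisli\<^esub> Z)) (assoc thunkable_kleisli X Y Z)"
      by (simp add: pure_iso assoc_iso typing)
  qed (simp_all add: typing ktyping kthunkable_pure ktens_Hom kthunkable_ktens ktens_ident ktens_kcomp
      kcomp_pure_pure swap_swap pure_ident ktens_swap ktens_pure_right hexagon
      ktens_ident_left lact_ident lact_pure lact_assoc)
qed

lemma monoidal_thunkable_kleisli: "monoidal_category thunkable_kleisli"
proof -
  interpret K: symmetric_tensor_category thunkable_kleisli
    by (rule symmetric_tensor_thunkable_kleisli)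
  show ?thesis
  proof unfold_locales
    fix X X' Y Y' Z Z' f g h
    assume "X \<in> Obj thunkable_kleisli" "X' \<in> Obj thunkable_kleisli" "Y \<in> Obj thunkable_kleisli"
      "Y' \<in> Obj thunkable_kleisli" "Z \<in> Obj thunkable_kleisli" "Z' \<in> Obj thunkable_kleisli"
      "f \<in> Hom thunkable_kleisli X X'" "g \<in> Hom thunkable_kleisli Y Y'" "h \<in> Hom thunkable_kleisli Z Z'"
    from K.assoc_nat[OF this]
    show "Comp thunkable_kleisli (X \<otimes>\<^bsub>thunkable_kleisli\<^esub> Y \<otimes>\<^bsub>thunkable_kleisli\<^esub> Z)
          (X' \<otimes>\<^bsub>thunkable_kleisli\<^esub> Y' \<otimes>\<^bsub>thunkable_kleisli\<^esub> Z')
          (X' \<otimes>\<^bsub>thunkable_kleisli\<^esub> (Y' \<otimes>\<^bsub>thunkable_kleisli\<^esub> Z')) (assoc thunkable_kleisli X' Y' Z')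
          (tensA thunkable_kleisli (X \<otimes>\<^bsub>thunkable_kleisli\<^esub> Y) (X' \<otimes>\<^bsub>thunkable_kleisli\<^esub> Y') Z Z'
            (tensA thunkable_kleisli X X' Y Y' f g) h) =
        Comp thunkable_kleisli (X \<otimes>\<^bsub>thunkable_kleisli\<^esub> Y \<otimes>\<^bsub>thunkable_kleisli\<^esub> Z)
          (X \<otimes>\<^bsub>thunkable_kleisli\<^esub> (Y \<otimes>\<^bsub>thunkable_kleisli\<^esub> Z))
          (X' \<otimes>\<^bsub>thunkable_kleisli\<^esub> (Y' \<otimes>\<^bsub>thunkable_kleisli\<^esub> Z'))
          (tensA thunkable_kleisli X X' (Y \<otimes>\<^bsub>thunkable_kleisli\<^esub> Z) (Y' \<otimes>\<^bsub>thunkable_kleisli\<^esub> Z') f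
            (tensA thunkable_kleisli Y Y' Z Z' g h))
          (assoc thunkable_kleisli X Y Z)" .
  next
    fix X X' f
    assume X: "X \<in> Obj thunkable_kleisli" "X' \<in> Obj thunkable_kleisli"
      and f: "f \<in> Hom thunkable_kleisli X X'"
    note [simp] = X[simplified] f[simplified]
    show lunit: "Comp thunkable_kleisli (\<one>\<^bsub>thunkable_kleisli\<^esub> \<otimes>\<^bsub>thunkable_kleisli\<^esub> X)
          (\<one>\<^bsub>thunkable_kleisli\<^esub> \<otimes>\<^bsub>thunkable_kleisli\<^esub> X') X' (lunit thunkable_kleisli X')
          (tensA thunkable_kleisli \<one>\<^bsub>thunkable_kleisli\<^esub> \<one>\<^bsub>thunkable_kleisli\<^esub> X X'
            (Ident thunkable_kleisli \<one>\<^bsub>thunkable_kleisli\<^esub>) f) =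
        Comp thunkable_kleisli (\<one>\<^bsub>thunkable_kleisli\<^esub> \<otimes>\<^bsub>thunkable_kleisli\<^esub> X) X X' f
          (lunit thunkable_kleisli X)"
      by (simp add: ktens_ident_left lact_lunit typing)
    \<comment> \<open>The strength axioms concern the left unitor. The right one is expressed
      through it and the symmetry, and its naturality follows by \<open>ktens_swap\<close>.\<close>
    have runit: "pure (V \<otimes> \<one>) V (runit C V) = kcomp (V \<otimes> \<one>) (\<one> \<otimes> V) V
        (pure (\<one> \<otimes> V) V (lunit C V)) (pure (V \<otimes> \<one>) (\<one> \<otimes> V) (swap C V \<one>))" if "V \<in> Obj C" for V
      using that by (simp add: kcomp_pure_pure swap_unit typing)
    have "kcomp (X \<otimes> \<one>) (X' \<otimes> \<one>) X' (pure (X' \<otimes> \<one>) X' (runit C X')) (ktens X X' \<one> \<one> f (\<eta> \<one>))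
      = kcomp (X \<otimes> \<one>) (\<one> \<otimes> X') X' (pure (\<one> \<otimes> X') X' (lunit C X'))
          (kcomp (X \<otimes> \<one>) (X' \<otimes> \<one>) (\<one> \<otimes> X') (pure (X' \<otimes> \<one>) (\<one> \<otimes> X') (swap C X' \<one>))
            (ktens X X' \<one> \<one> f (\<eta> \<one>)))"
      by (simp add: runit kcomp_assoc ktyping ktens_Hom typing)
    also have "\<dots> = kcomp (X \<otimes> \<one>) (\<one> \<otimes> X) X'
        (kcomp (\<one> \<otimes> X) (\<one> \<otimes> X') X' (pure (\<one> \<otimes> X') X' (lunit C X')) (ktens \<one> \<one> X X' (\<eta> \<one>) f))
        (pure (X \<otimes> \<one>) (\<one> \<otimes> X) (swap C X \<one>))"
      by (simp add: ktens_swap kthunkable_ident kcomp_assoc ktyping ktens_Hom typing)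
    also have "\<dots> = kcomp (X \<otimes> \<one>) X X' f (pure (X \<otimes> \<one>) X (runit C X))"
      using lunit by (simp add: runit kcomp_assoc ktyping typing)
    finally show "Comp thunkable_kleisli (X \<otimes>\<^bsub>thunkable_kleisli\<^esub> \<one>\<^bsub>thunkable_kleisli\<^esub>)
          (X' \<otimes>\<^bsub>thunkable_kleisli\<^esub> \<one>\<^bsub>thunkable_kleisli\<^esub>) X' (runit thunkable_kleisli X')
          (tensA thunkable_kleisli X X' \<one>\<^bsub>thunkable_kleisli\<^esub> \<one>\<^bsub>thunkable_kleisli\<^esub> f
            (Ident thunkable_kleisli \<one>\<^bsub>thunkable_kleisli\<^esub>)) =
        Comp thunkable_kleisli (X \<otimes>\<^bsub>thunkable_kleisli\<^esub> \<one>\<^bsub>thunkable_kleisli\<^esub>) X X' f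
          (runit thunkable_kleisli X)"
      by simp
  qed (simp_all add: typing ktyping kthunkable_pure ktens_Hom kthunkable_ktens ktens_ident ktens_kcomp
      kcomp_pure_pure pure_iso assoc_iso lunit_iso runit_iso
      ktens_pure_left ktens_pure_right pentagon triangle)
qed

section \<open>Agreement with the double strength\<close>

lemma costrength_tensA:
  assumes [simp]: "X \<in> Obj C" "X' \<in> Obj C" "Y \<in> Obj C" "f \<in> Hom C X (ob T X')"
  shows "Comp C (X \<otimes> Y) (ob T X' \<otimes> Y) (ob T (X' \<otimes> Y)) (costrength C T st X' Y)
      (tensA C X (ob T X') Y Y f (Ident C Y)) = ract X X' Y f"
proof -
  have "Comp C (X \<otimes> Y) (ob T X' \<otimes> Y) (ob T (X' \<otimes> Y)) (costrength C T st X' Y)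
      (tensA C X (ob T X') Y Y f (Ident C Y))
    = Comp C (X \<otimes> Y) (ob T (Y \<otimes> X')) (ob T (X' \<otimes> Y)) (ar T (Y \<otimes> X') (X' \<otimes> Y) (swap C Y X'))
        (Comp C (X \<otimes> Y) (Y \<otimes> X) (ob T (Y \<otimes> X')) (lact Y X X' f) (swap C X Y))"
    by (simp add: costrength_def lact_def comp_assoc swap_nat typing)
  then show ?thesis
    by (simp add: ract_def kcomp_pure pure_kcomp ktyping typing)
qed

text \<open>The costrength at \<open>T Y'\<close> treats the computation \<open>g\<close> as a
  value. As a pure map it can be moved behind the effect of \<open>f\<close> by
  \<open>ract_natural\<close>; there the strength and the multiplication turn it into the left
  action.\<close>

lemma double_strength_tensA:
  assumes [simp]: "X \<in> Obj C" "X' \<in> Obj C" "Y \<in> Obj C" "Y' \<in> Obj C"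
    "f \<in> Hom C X (ob T X')" "g \<in> Hom C Y (ob T Y')"
  shows "Comp C (X \<otimes> Y) (ob T X' \<otimes> ob T Y') (ob T (X' \<otimes> Y')) (double_strength C T \<mu> st X' Y')
      (tensA C X (ob T X') Y (ob T Y') f g) = ktens X X' Y Y' f g"
proof -
  have costr [simp]: "costrength C T st X' V \<in> Hom C (ob T X' \<otimes> V) (ob T (X' \<otimes> V))" if "V \<in> Obj C" for V
    using that by (simp add: costrength_def typing)
  have "Comp C (X \<otimes> Y) (ob T X' \<otimes> ob T Y') (ob T (X' \<otimes> ob T Y')) (costrength C T st X' (ob T Y'))
        (tensA C X (ob T X') Y (ob T Y') f g)
      = Comp C (X \<otimes> Y) (X \<otimes> ob T Y') (ob T (X' \<otimes> ob T Y'))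
          (Comp C (X \<otimes> ob T Y') (ob T X' \<otimes> ob T Y') (ob T (X' \<otimes> ob T Y')) (costrength C T st X' (ob T Y'))
            (tensA C X (ob T X') (ob T Y') (ob T Y') f (Ident C (ob T Y'))))
          (tensA C X X Y (ob T Y') (Ident C X) g)"
    by (simp add: comp_assoc tensA_comp[symmetric] comp_ident_left comp_ident_right typing)
  also have "\<dots> = kcomp (X \<otimes> Y) (X \<otimes> ob T Y') (X' \<otimes> ob T Y') (ract X X' (ob T Y') f)
      (lact X Y (ob T Y') (pure Y (ob T Y') g))"
    by (simp add: costrength_tensA lact_pure kcomp_pure ktyping typing)
  also have "\<dots> = kcomp (X \<otimes> Y) (X' \<otimes> Y) (X' \<otimes> ob T Y') (lact X' Y (ob T Y') (pure Y (ob T Y') g))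
      (ract X X' Y f)"
    by (simp add: lact_pure ract_natural typing)
  finally have 1: "Comp C (X \<otimes> Y) (ob T X' \<otimes> ob T Y') (ob T (X' \<otimes> ob T Y')) (costrength C T st X' (ob T Y'))
        (tensA C X (ob T X') Y (ob T Y') f g)
    = Comp C (X \<otimes> Y) (ob T (X' \<otimes> Y)) (ob T (X' \<otimes> ob T Y'))
        (ar T (X' \<otimes> Y) (X' \<otimes> ob T Y') (tensA C X' X' Y (ob T Y') (Ident C X') g)) (ract X X' Y f)"
    by (simp add: lact_pure pure_kcomp ktyping typing)
  show ?thesis
    by (simp add: double_strength_def comp_assoc 1 typing)
      (simp add: ktens_def lact_def kcomp_def ar_comp comp_assoc typing ktyping)
qed

end


section \<open>Transport of monoidal structure\<close>

text \<open>The family \<open>J\<close> is bijective on hom-sets and preserves all structure on the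
  nose, so equations and isomorphisms are reflected from \<open>K\<close>. For \<open>P\<close> only
  typing is assumed; even associativity is deduced, which is what makes the lemma fit for data taken
  from a non-associative category.\<close>

lemma monoidal_category_pullback:
  fixes P :: "('p, 'n, 'y) moncat_scheme" and K :: "('o, 'm, 'z) moncat_scheme"
  assumes K: "monoidal_category K"
    and p_Obj: "\<And>X. X \<in> Obj P \<Longrightarrow> p X \<in> Obj K"
    and J_bij: "\<And>X Y. \<lbrakk>X \<in> Obj P; Y \<in> Obj P\<rbrakk>
      \<Longrightarrow> bij_betw (J X Y) (Hom P X Y) (Hom K (p X) (p Y))"
    and ident_Hom: "\<And>X. X \<in> Obj P \<Longrightarrow> Ident P X \<in> Hom P X X"
    and J_ident: "\<And>X. X \<in> Obj P \<Longrightarrow> J X X (Ident P X) = Ident K (p X)"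
    and comp_Hom: "\<And>X Y Z f g. \<lbrakk>X \<in> Obj P; Y \<in> Obj P; Z \<in> Obj P; f \<in> Hom P X Y; g \<in> Hom P Y Z\<rbrakk>
      \<Longrightarrow> Comp P X Y Z g f \<in> Hom P X Z"
    and J_comp: "\<And>X Y Z f g. \<lbrakk>X \<in> Obj P; Y \<in> Obj P; Z \<in> Obj P; f \<in> Hom P X Y; g \<in> Hom P Y Z\<rbrakk>
      \<Longrightarrow> J X Z (Comp P X Y Z g f) = Comp K (p X) (p Y) (p Z) (J Y Z g) (J X Y f)"
    and tens_Obj: "\<And>X Y. \<lbrakk>X \<in> Obj P; Y \<in> Obj P\<rbrakk> \<Longrightarrow> X \<otimes>\<^bsub>P\<^esub> Y \<in> Obj P"
    and p_tens: "\<And>X Y. \<lbrakk>X \<in> Obj P; Y \<in> Obj P\<rbrakk> \<Longrightarrow> p (X \<otimes>\<^bsub>P\<^esub> Y) = p X \<otimes>\<^bsub>K\<^esub> p Y"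
    and unit_Obj: "\<one>\<^bsub>P\<^esub> \<in> Obj P"
    and p_unit: "p \<one>\<^bsub>P\<^esub> = \<one>\<^bsub>K\<^esub>"
    and tensA_Hom: "\<And>X X' Y Y' f g. \<lbrakk>X \<in> Obj P; X' \<in> Obj P; Y \<in> Obj P; Y' \<in> Obj P;
        f \<in> Hom P X X'; g \<in> Hom P Y Y'\<rbrakk>
      \<Longrightarrow> tensA P X X' Y Y' f g \<in> Hom P (X \<otimes>\<^bsub>P\<^esub> Y) (X' \<otimes>\<^bsub>P\<^esub> Y')"
    and J_tensA: "\<And>X X' Y Y' f g. \<lbrakk>X \<in> Obj P; X' \<in> Obj P; Y \<in> Obj P; Y' \<in> Obj P;
        f \<in> Hom P X X'; g \<in> Hom P Y Y'\<rbrakk>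
      \<Longrightarrow> J (X \<otimes>\<^bsub>P\<^esub> Y) (X' \<otimes>\<^bsub>P\<^esub> Y') (tensA P X X' Y Y' f g)
        = tensA K (p X) (p X') (p Y) (p Y') (J X X' f) (J Y Y' g)"
    and assoc_Hom: "\<And>X Y Z. \<lbrakk>X \<in> Obj P; Y \<in> Obj P; Z \<in> Obj P\<rbrakk>
      \<Longrightarrow> assoc P X Y Z \<in> Hom P ((X \<otimes>\<^bsub>P\<^esub> Y) \<otimes>\<^bsub>P\<^esub> Z) (X \<otimes>\<^bsub>P\<^esub> (Y \<otimes>\<^bsub>P\<^esub> Z))"
    and J_assoc: "\<And>X Y Z. \<lbrakk>X \<in> Obj P; Y \<in> Obj P; Z \<in> Obj P\<rbrakk>
      \<Longrightarrow> J ((X \<otimes>\<^bsub>P\<^esub> Y) \<otimes>\<^bsub>P\<^esub> Z) (X \<otimes>\<^bsub>P\<^esub> (Y \<otimes>\<^bsub>P\<^esub> Z)) (assoc P X Y Z) = assoc K (p X) (p Y) (p Z)"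
    and lunit_Hom: "\<And>X. X \<in> Obj P \<Longrightarrow> lunit P X \<in> Hom P (\<one>\<^bsub>P\<^esub> \<otimes>\<^bsub>P\<^esub> X) X"
    and J_lunit: "\<And>X. X \<in> Obj P \<Longrightarrow> J (\<one>\<^bsub>P\<^esub> \<otimes>\<^bsub>P\<^esub> X) X (lunit P X) = lunit K (p X)"
    and runit_Hom: "\<And>X. X \<in> Obj P \<Longrightarrow> runit P X \<in> Hom P (X \<otimes>\<^bsub>P\<^esub> \<one>\<^bsub>P\<^esub>) X"
    and J_runit: "\<And>X. X \<in> Obj P \<Longrightarrow> J (X \<otimes>\<^bsub>P\<^esub> \<one>\<^bsub>P\<^esub>) X (runit P X) = runit K (p X)"
  shows "monoidal_category P"
proof -
  interpret K: monoidal_category K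
    by (rule K)
  have J_Hom: "J X Y f \<in> Hom K (p X) (p Y)" if "X \<in> Obj P" "Y \<in> Obj P" "f \<in> Hom P X Y" for X Y f
    using J_bij[OF that(1,2)] that(3) by (auto simp: bij_betw_def)
  have J_eqI: "f = g" if "J X Y f = J X Y g" "X \<in> Obj P" "Y \<in> Obj P" "f \<in> Hom P X Y" "g \<in> Hom P X Y"
    for X Y f g
    using J_bij[OF that(2,3)] that(1,4,5) by (auto simp: bij_betw_def inj_on_def)
  note typings = p_Obj ident_Hom comp_Hom tens_Obj unit_Obj tensA_Hom assoc_Hom lunit_Hom runit_Hom J_Hom
  note J = J_ident J_comp p_tens p_unit J_tensA J_assoc J_lunit J_runit
  have reflect_iso: "is_iso P X Y f"
    if iso: "is_iso K (p X) (p Y) (J X Y f)" and X: "X \<in> Obj P" "Y \<in> Obj P" and f: "f \<in> Hom P X Y" for X Y f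
  proof -
    obtain k where k: "k \<in> Hom K (p Y) (p X)"
        "Comp K (p X) (p Y) (p X) k (J X Y f) = Ident K (p X)"
        "Comp K (p Y) (p X) (p Y) (J X Y f) k = Ident K (p Y)"
      using iso unfolding is_iso_def by blast
    \<comment> \<open>Fullness lifts the inverse from \<open>K\<close>; faithfulness then gives the
      two equations in \<open>P\<close>.\<close>
    obtain g where g: "g \<in> Hom P Y X" "J Y X g = k"
      using J_bij[OF X(2,1)] k(1) by (metis bij_betw_def imageE)
    have "Comp P X Y X g f = Ident P X"
      by (rule J_eqI[of X X]) (use X f g k in \<open>simp_all add: typings J\<close>)
    moreover have "Comp P Y X Y f g = Ident P Y"
      by (rule J_eqI[of Y Y]) (use X f g k in \<open>simp_all add: typings J\<close>)
    ultimately show ?thesis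
      using f g(1) unfolding is_iso_def by blast
  qed
  show ?thesis
  proof unfold_locales
    fix X Y f assume *: "X \<in> Obj P" "Y \<in> Obj P" "f \<in> Hom P X Y"
    show "Comp P X Y Y (Ident P Y) f = f"
      by (rule J_eqI[of X Y]) (use * in \<open>simp_all add: typings J K.comp_ident_left\<close>)
    show "Comp P X X Y f (Ident P X) = f"
      by (rule J_eqI[of X Y]) (use * in \<open>simp_all add: typings J K.comp_ident_right\<close>)
    show "Comp P (\<one>\<^bsub>P\<^esub> \<otimes>\<^bsub>P\<^esub> X) (\<one>\<^bsub>P\<^esub> \<otimes>\<^bsub>P\<^esub> Y) Y (lunit P Y) (tensA P \<one>\<^bsub>P\<^esub> \<one>\<^bsub>P\<^esub> X Y (Ident P \<one>\<^bsub>P\<^esub>) f)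
        = Comp P (\<one>\<^bsub>P\<^esub> \<otimes>\<^bsub>P\<^esub> X) X Y f (lunit P X)"
      by (rule J_eqI[of "\<one>\<^bsub>P\<^esub> \<otimes>\<^bsub>P\<^esub> X" Y]) (use * in \<open>simp_all add: typings J K.lunit_nat\<close>)
    show "Comp P (X \<otimes>\<^bsub>P\<^esub> \<one>\<^bsub>P\<^esub>) (Y \<otimes>\<^bsub>P\<^esub> \<one>\<^bsub>P\<^esub>) Y (runit P Y) (tensA P X Y \<one>\<^bsub>P\<^esub> \<one>\<^bsub>P\<^esub> f (Ident P \<one>\<^bsub>P\<^esub>))
        = Comp P (X \<otimes>\<^bsub>P\<^esub> \<one>\<^bsub>P\<^esub>) X Y f (runit P X)"
      by (rule J_eqI[of "X \<otimes>\<^bsub>P\<^esub> \<one>\<^bsub>P\<^esub>" Y]) (use * in \<open>simp_all add: typings J K.runit_nat\<close>)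
  next
    fix W X Y Z f g h
    assume *: "W \<in> Obj P" "X \<in> Obj P" "Y \<in> Obj P" "Z \<in> Obj P"
      "f \<in> Hom P W X" "g \<in> Hom P X Y" "h \<in> Hom P Y Z"
    show "Comp P W X Z (Comp P X Y Z h g) f = Comp P W Y Z h (Comp P W X Y g f)"
      by (rule J_eqI[of W Z]) (use * in \<open>simp_all add: typings J K.comp_assoc\<close>)
  next
    fix X Y assume *: "X \<in> Obj P" "Y \<in> Obj P"
    show "tensA P X X Y Y (Ident P X) (Ident P Y) = Ident P (X \<otimes>\<^bsub>P\<^esub> Y)"
      by (rule J_eqI[of "X \<otimes>\<^bsub>P\<^esub> Y" "X \<otimes>\<^bsub>P\<^esub> Y"]) (use * in \<open>simp_all add: typings J K.tensA_ident\<close>)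
    show "is_iso P (\<one>\<^bsub>P\<^esub> \<otimes>\<^bsub>P\<^esub> X) X (lunit P X)"
      by (rule reflect_iso) (use * in \<open>simp_all add: typings J K.lunit_iso\<close>)
    show "is_iso P (X \<otimes>\<^bsub>P\<^esub> \<one>\<^bsub>P\<^esub>) X (runit P X)"
      by (rule reflect_iso) (use * in \<open>simp_all add: typings J K.runit_iso\<close>)
    show "Comp P ((X \<otimes>\<^bsub>P\<^esub> \<one>\<^bsub>P\<^esub>) \<otimes>\<^bsub>P\<^esub> Y) (X \<otimes>\<^bsub>P\<^esub> (\<one>\<^bsub>P\<^esub> \<otimes>\<^bsub>P\<^esub> Y)) (X \<otimes>\<^bsub>P\<^esub> Y)
          (tensA P X X (\<one>\<^bsub>P\<^esub> \<otimes>\<^bsub>P\<^esub> Y) Y (Ident P X) (lunit P Y)) (assoc P X \<one>\<^bsub>P\<^esub> Y)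
        = tensA P (X \<otimes>\<^bsub>P\<^esub> \<one>\<^bsub>P\<^esub>) X Y Y (runit P X) (Ident P Y)"
      by (rule J_eqI[of "(X \<otimes>\<^bsub>P\<^esub> \<one>\<^bsub>P\<^esub>) \<otimes>\<^bsub>P\<^esub> Y" "X \<otimes>\<^bsub>P\<^esub> Y"])
        (use * in \<open>simp_all add: typings J K.triangle\<close>)
  next
    fix X X' X'' Y Y' Y'' f f' g g'
    assume *: "X \<in> Obj P" "X' \<in> Obj P" "X'' \<in> Obj P" "Y \<in> Obj P" "Y' \<in> Obj P" "Y'' \<in> Obj P"
      "f \<in> Hom P X X'" "f' \<in> Hom P X' X''" "g \<in> Hom P Y Y'" "g' \<in> Hom P Y' Y''"
    show "tensA P X X'' Y Y'' (Comp P X X' X'' f' f) (Comp P Y Y' Y'' g' g)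
        = Comp P (X \<otimes>\<^bsub>P\<^esub> Y) (X' \<otimes>\<^bsub>P\<^esub> Y') (X'' \<otimes>\<^bsub>P\<^esub> Y'')
            (tensA P X' X'' Y' Y'' f' g') (tensA P X X' Y Y' f g)"
      by (rule J_eqI[of "X \<otimes>\<^bsub>P\<^esub> Y" "X'' \<otimes>\<^bsub>P\<^esub> Y''"]) (use * in \<open>simp_all add: typings J K.tensA_comp\<close>)
  next
    fix X Y Z assume *: "X \<in> Obj P" "Y \<in> Obj P" "Z \<in> Obj P"
    show "is_iso P ((X \<otimes>\<^bsub>P\<^esub> Y) \<otimes>\<^bsub>P\<^esub> Z) (X \<otimes>\<^bsub>P\<^esub> (Y \<otimes>\<^bsub>P\<^esub> Z)) (assoc P X Y Z)"
      by (rule reflect_iso) (use * in \<open>simp_all add: typings J K.assoc_iso\<close>)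
  next
    fix X X' Y Y' Z Z' f g h
    assume *: "X \<in> Obj P" "X' \<in> Obj P" "Y \<in> Obj P" "Y' \<in> Obj P" "Z \<in> Obj P" "Z' \<in> Obj P"
      "f \<in> Hom P X X'" "g \<in> Hom P Y Y'" "h \<in> Hom P Z Z'"
    show "Comp P ((X \<otimes>\<^bsub>P\<^esub> Y) \<otimes>\<^bsub>P\<^esub> Z) ((X' \<otimes>\<^bsub>P\<^esub> Y') \<otimes>\<^bsub>P\<^esub> Z') (X' \<otimes>\<^bsub>P\<^esub> (Y' \<otimes>\<^bsub>P\<^esub> Z'))
            (assoc P X' Y' Z') (tensA P (X \<otimes>\<^bsub>P\<^esub> Y) (X' \<otimes>\<^bsub>P\<^esub> Y') Z Z' (tensA P X X' Y Y' f g) h)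
        = Comp P ((X \<otimes>\<^bsub>P\<^esub> Y) \<otimes>\<^bsub>P\<^esub> Z) (X \<otimes>\<^bsub>P\<^esub> (Y \<otimes>\<^bsub>P\<^esub> Z)) (X' \<otimes>\<^bsub>P\<^esub> (Y' \<otimes>\<^bsub>P\<^esub> Z'))
            (tensA P X X' (Y \<otimes>\<^bsub>P\<^esub> Z) (Y' \<otimes>\<^bsub>P\<^esub> Z') f (tensA P Y Y' Z Z' g h)) (assoc P X Y Z)"
      by (rule J_eqI[of "(X \<otimes>\<^bsub>P\<^esub> Y) \<otimes>\<^bsub>P\<^esub> Z" "X' \<otimes>\<^bsub>P\<^esub> (Y' \<otimes>\<^bsub>P\<^esub> Z')"])
        (use * in \<open>simp_all add: typings J K.assoc_nat\<close>)
  next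
    fix W X Y Z assume *: "W \<in> Obj P" "X \<in> Obj P" "Y \<in> Obj P" "Z \<in> Obj P"
    show "Comp P (((W \<otimes>\<^bsub>P\<^esub> X) \<otimes>\<^bsub>P\<^esub> Y) \<otimes>\<^bsub>P\<^esub> Z) ((W \<otimes>\<^bsub>P\<^esub> X) \<otimes>\<^bsub>P\<^esub> (Y \<otimes>\<^bsub>P\<^esub> Z))
            (W \<otimes>\<^bsub>P\<^esub> (X \<otimes>\<^bsub>P\<^esub> (Y \<otimes>\<^bsub>P\<^esub> Z)))
            (assoc P W X (Y \<otimes>\<^bsub>P\<^esub> Z)) (assoc P (W \<otimes>\<^bsub>P\<^esub> X) Y Z)
        = Comp P (((W \<otimes>\<^bsub>P\<^esub> X) \<otimes>\<^bsub>P\<^esub> Y) \<otimes>\<^bsub>P\<^esub> Z) (W \<otimes>\<^bsub>P\<^esub> ((X \<otimes>\<^bsub>P\<^esub> Y) \<otimes>\<^bsub>P\<^esub> Z))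
            (W \<otimes>\<^bsub>P\<^esub> (X \<otimes>\<^bsub>P\<^esub> (Y \<otimes>\<^bsub>P\<^esub> Z)))
            (tensA P W W ((X \<otimes>\<^bsub>P\<^esub> Y) \<otimes>\<^bsub>P\<^esub> Z) (X \<otimes>\<^bsub>P\<^esub> (Y \<otimes>\<^bsub>P\<^esub> Z)) (Ident P W) (assoc P X Y Z))
            (Comp P (((W \<otimes>\<^bsub>P\<^esub> X) \<otimes>\<^bsub>P\<^esub> Y) \<otimes>\<^bsub>P\<^esub> Z) ((W \<otimes>\<^bsub>P\<^esub> (X \<otimes>\<^bsub>P\<^esub> Y)) \<otimes>\<^bsub>P\<^esub> Z)
              (W \<otimes>\<^bsub>P\<^esub> ((X \<otimes>\<^bsub>P\<^esub> Y) \<otimes>\<^bsub>P\<^esub> Z)) (assoc P W (X \<otimes>\<^bsub>P\<^esub> Y) Z)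
              (tensA P ((W \<otimes>\<^bsub>P\<^esub> X) \<otimes>\<^bsub>P\<^esub> Y) (W \<otimes>\<^bsub>P\<^esub> (X \<otimes>\<^bsub>P\<^esub> Y)) Z Z (assoc P W X Y) (Ident P Z)))"
      by (rule J_eqI[of "((W \<otimes>\<^bsub>P\<^esub> X) \<otimes>\<^bsub>P\<^esub> Y) \<otimes>\<^bsub>P\<^esub> Z" "W \<otimes>\<^bsub>P\<^esub> (X \<otimes>\<^bsub>P\<^esub> (Y \<otimes>\<^bsub>P\<^esub> Z))"])
        (use * in \<open>simp_all add: typings J K.pentagon\<close>)
  qed (simp_all add: typings)
qed

lemma (in cat_functor) preserves_iso:
  assumes "X \<in> Obj C" "Y \<in> Obj C" "is_iso C X Y f"
  shows "is_iso D (ob F X) (ob F Y) (ar F X Y f)"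
proof -
  obtain g where "f \<in> Hom C X Y" "g \<in> Hom C Y X" "Comp C X Y X g f = Ident C X"
      "Comp C Y X Y f g = Ident C Y"
    using assms(3) unfolding is_iso_def by blast
  then have "ar F Y X g \<in> Hom D (ob F Y) (ob F X)" "ar F X Y f \<in> Hom D (ob F X) (ob F Y)"
    "Comp D (ob F X) (ob F Y) (ob F X) (ar F Y X g) (ar F X Y f) = Ident D (ob F X)"
    "Comp D (ob F Y) (ob F X) (ob F Y) (ar F X Y f) (ar F Y X g) = Ident D (ob F Y)"
    using assms(1,2) by (simp_all add: ar_Hom ar_comp[symmetric] ar_ident)
  then show ?thesis
    unfolding is_iso_def by blast
qed

text \<open>Here \<open>G\<close> is a strict monoidal functor, so the structure maps of the
  composite are the images under \<open>G\<close> of those of \<open>F\<close>.\<close>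

lemma strong_monoidal_functor_strict:
  fixes C :: "('o, 'm, 'x) moncat_scheme" and D :: "('p, 'n, 'y) moncat_scheme"
    and E :: "('q, 'k, 'z) moncat_scheme"
  assumes F: "strong_monoidal_functor C D F m2 m0"
    and E: "monoidal_category E"
    and G: "cat_functor D E G"
    and G_tens: "\<And>X Y. \<lbrakk>X \<in> Obj D; Y \<in> Obj D\<rbrakk> \<Longrightarrow> ob G (X \<otimes>\<^bsub>D\<^esub> Y) = ob G X \<otimes>\<^bsub>E\<^esub> ob G Y"
    and G_unit: "ob G \<one>\<^bsub>D\<^esub> = \<one>\<^bsub>E\<^esub>"
    and G_tensA: "\<And>X X' Y Y' f g. \<lbrakk>X \<in> Obj D; X' \<in> Obj D; Y \<in> Obj D; Y' \<in> Obj D;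
        f \<in> Hom D X X'; g \<in> Hom D Y Y'\<rbrakk>
      \<Longrightarrow> ar G (X \<otimes>\<^bsub>D\<^esub> Y) (X' \<otimes>\<^bsub>D\<^esub> Y') (tensA D X X' Y Y' f g)
        = tensA E (ob G X) (ob G X') (ob G Y) (ob G Y') (ar G X X' f) (ar G Y Y' g)"
    and G_assoc: "\<And>X Y Z. \<lbrakk>X \<in> Obj D; Y \<in> Obj D; Z \<in> Obj D\<rbrakk>
      \<Longrightarrow> ar G ((X \<otimes>\<^bsub>D\<^esub> Y) \<otimes>\<^bsub>D\<^esub> Z) (X \<otimes>\<^bsub>D\<^esub> (Y \<otimes>\<^bsub>D\<^esub> Z)) (assoc D X Y Z) = assoc E (ob G X) (ob G Y) (ob G Z)"
    and G_lunit: "\<And>X. X \<in> Obj D \<Longrightarrow> ar G (\<one>\<^bsub>D\<^esub> \<otimes>\<^bsub>D\<^esub> X) X (lunit D X) = lunit E (ob G X)"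
    and G_runit: "\<And>X. X \<in> Obj D \<Longrightarrow> ar G (X \<otimes>\<^bsub>D\<^esub> \<one>\<^bsub>D\<^esub>) X (runit D X) = runit E (ob G X)"
  shows "strong_monoidal_functor C E (func_comp G F)
    (\<lambda>X Y. ar G (ob F X \<otimes>\<^bsub>D\<^esub> ob F Y) (ob F (X \<otimes>\<^bsub>C\<^esub> Y)) (m2 X Y)) (ar G \<one>\<^bsub>D\<^esub> (ob F \<one>\<^bsub>C\<^esub>) m0)"
proof -
  interpret F: strong_monoidal_functor C D F m2 m0 by (rule F)
  interpret E: monoidal_category E by (rule E)
  interpret G: cat_functor D E G by (rule G)
  have m2_Hom: "m2 X Y \<in> Hom D (ob F X \<otimes>\<^bsub>D\<^esub> ob F Y) (ob F (X \<otimes>\<^bsub>C\<^esub> Y))"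
    if "X \<in> Obj C" "Y \<in> Obj C" for X Y
    using F.m2_iso[OF that] by (simp add: is_iso_def)
  have m0_Hom: "m0 \<in> Hom D \<one>\<^bsub>D\<^esub> (ob F \<one>\<^bsub>C\<^esub>)"
    using F.m0_iso by (simp add: is_iso_def)
  have C_Hom: "assoc C X Y Z \<in> Hom C ((X \<otimes>\<^bsub>C\<^esub> Y) \<otimes>\<^bsub>C\<^esub> Z) (X \<otimes>\<^bsub>C\<^esub> (Y \<otimes>\<^bsub>C\<^esub> Z))"
      "lunit C X \<in> Hom C (\<one>\<^bsub>C\<^esub> \<otimes>\<^bsub>C\<^esub> X) X" "runit C X \<in> Hom C (X \<otimes>\<^bsub>C\<^esub> \<one>\<^bsub>C\<^esub>) X"
    if "X \<in> Obj C" "Y \<in> Obj C" "Z \<in> Obj C" for X Y Z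
    using F.dom.assoc_iso[OF that] F.dom.lunit_iso[OF that(1)] F.dom.runit_iso[OF that(1)]
    by (simp_all add: is_iso_def)
  have D_Hom: "assoc D X Y Z \<in> Hom D ((X \<otimes>\<^bsub>D\<^esub> Y) \<otimes>\<^bsub>D\<^esub> Z) (X \<otimes>\<^bsub>D\<^esub> (Y \<otimes>\<^bsub>D\<^esub> Z))"
    if "X \<in> Obj D" "Y \<in> Obj D" "Z \<in> Obj D" for X Y Z
    using F.cod.assoc_iso[OF that] by (simp add: is_iso_def)
  note typings = F.dom.ident_hom F.dom.comp_hom F.dom.tens_Obj F.dom.unit_Obj F.dom.tensA_Hom C_Hom
    F.cod.ident_hom F.cod.comp_hom F.cod.tens_Obj F.cod.unit_Obj F.cod.tensA_Hom D_Hom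
    F.ob_Obj F.ar_Hom G.ob_Obj G.ar_Hom m2_Hom m0_Hom
  \<comment> \<open>Read from right to left, these rules collect each side of a law in
    \<open>E\<close> into a single application of \<open>G\<close>, whose argument is the
    corresponding side of the law for \<open>F\<close> in \<open>D\<close>.\<close>
  note strict = G_tens[symmetric] G_unit[symmetric] G_tensA[symmetric] G_assoc[symmetric]
    G_lunit[symmetric] G_runit[symmetric] G.ar_ident[symmetric] G.ar_comp[symmetric]
  show ?thesis
    by unfold_locales
      (simp_all add: func_comp_def typings strict F.ar_ident F.ar_comp G.preserves_iso F.m2_iso F.m0_iso
        F.m2_nat F.m2_assoc F.m2_lunit F.m2_runit)
qed


section \<open>The duploid of an adjunction\<close>

locale duploid_of_adjunction = category A + B: category B
    + L: cat_functor A B L + R: cat_functor B A R + adjunction A B L R \<phi>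
  for A :: "('oa, 'a, 'x) cat_scheme" and B :: "('ob, 'b, 'y) cat_scheme"
    and L :: "('oa, 'a, 'ob, 'b) func" and R :: "('ob, 'b, 'oa, 'a) func"
    and \<phi> :: "'oa \<Rightarrow> 'ob \<Rightarrow> 'b \<Rightarrow> 'a"
begin

section \<open>Calculus of transposes\<close>

abbreviation unit :: "'oa \<Rightarrow> 'a" where "unit \<equiv> adj_unit B L \<phi>"

abbreviation hat :: "'oa \<Rightarrow> 'ob \<Rightarrow> 'a \<Rightarrow> 'b" where "hat \<equiv> adj_transpose B L \<phi>"

abbreviation D :: "('oa + 'ob, 'a) cat" where "D \<equiv> dupl A B L R \<phi>"

lemma hat_Hom: "\<lbrakk>X \<in> Obj A; Y \<in> Obj B; g \<in> Hom A X (ob R Y)\<rbrakk> \<Longrightarrow> hat X Y g \<in> Hom B (ob L X) Y"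
  unfolding adj_transpose_def using bij[of X Y]
  by (metis bij_betw_def subset_refl the_inv_into_into)

lemma \<phi>_hat: "\<lbrakk>X \<in> Obj A; Y \<in> Obj B; g \<in> Hom A X (ob R Y)\<rbrakk> \<Longrightarrow> \<phi> X Y (hat X Y g) = g"
  unfolding adj_transpose_def using bij[of X Y] by (metis bij_betw_def f_the_inv_into_f)

lemma hat_\<phi>: "\<lbrakk>X \<in> Obj A; Y \<in> Obj B; k \<in> Hom B (ob L X) Y\<rbrakk> \<Longrightarrow> hat X Y (\<phi> X Y k) = k"
  unfolding adj_transpose_def using bij[of X Y] by (metis bij_betw_def the_inv_into_f_f)

lemma adj_unit_Hom: "X \<in> Obj A \<Longrightarrow> unit X \<in> Hom A X (ob R (ob L X))"
  unfolding adj_unit_def using bij[of X "ob L X"]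
  by (simp add: bij_betw_apply L.ob_Obj B.ident_hom)

lemmas adj_typing = ident_hom comp_hom B.ident_hom B.comp_hom L.ob_Obj R.ob_Obj L.ar_Hom R.ar_Hom
  hat_Hom adj_unit_Hom

lemma \<phi>_eq:
  "\<lbrakk>X \<in> Obj A; Y \<in> Obj B; k \<in> Hom B (ob L X) Y\<rbrakk>
    \<Longrightarrow> \<phi> X Y k = Comp A X (ob R (ob L X)) (ob R Y) (ar R (ob L X) Y k) (unit X)"
  using nat_right[of X "ob L X" Y "Ident B (ob L X)" k]
  by (simp add: adj_typing B.comp_ident_right adj_unit_def)

lemma hat_unit:
  "\<lbrakk>X \<in> Obj A; Y \<in> Obj B; g \<in> Hom A X (ob R Y)\<rbrakk>
    \<Longrightarrow> Comp A X (ob R (ob L X)) (ob R Y) (ar R (ob L X) Y (hat X Y g)) (unit X) = g"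
  using \<phi>_eq[of X Y "hat X Y g"] by (simp add: hat_Hom \<phi>_hat)

lemma hat_unique:
  "\<lbrakk>X \<in> Obj A; Y \<in> Obj B; k \<in> Hom B (ob L X) Y;
    Comp A X (ob R (ob L X)) (ob R Y) (ar R (ob L X) Y k) (unit X) = g\<rbrakk> \<Longrightarrow> hat X Y g = k"
  using \<phi>_eq[of X Y k] hat_\<phi>[of X Y k] by simp

lemma adj_unit_nat:
  "\<lbrakk>X \<in> Obj A; Y \<in> Obj A; f \<in> Hom A X Y\<rbrakk>
    \<Longrightarrow> Comp A X (ob R (ob L X)) (ob R (ob L Y)) (ar R (ob L X) (ob L Y) (ar L X Y f)) (unit X)
      = Comp A X Y (ob R (ob L Y)) (unit Y) f"
  using nat_left[of X Y "ob L Y" f "Ident B (ob L Y)"] \<phi>_eq[of X "ob L Y" "ar L X Y f"]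
  by (simp add: adj_typing B.comp_ident_left adj_unit_def)

lemma hat_adj_unit: "X \<in> Obj A \<Longrightarrow> hat X (ob L X) (unit X) = Ident B (ob L X)"
  by (rule hat_unique) (simp_all add: adj_typing R.ar_ident comp_ident_left)

lemma hat_comp_R:
  "\<lbrakk>X \<in> Obj A; Y \<in> Obj B; Z \<in> Obj B; g \<in> Hom A X (ob R Y); k \<in> Hom B Y Z\<rbrakk>
    \<Longrightarrow> hat X Z (Comp A X (ob R Y) (ob R Z) (ar R Y Z k) g) = Comp B (ob L X) Y Z k (hat X Y g)"
  by (rule hat_unique) (simp_all add: adj_typing R.ar_comp comp_assoc hat_unit)

lemma hat_comp:
  assumes [simp]: "X \<in> Obj A" "Y \<in> Obj A" "Z \<in> Obj B" "f \<in> Hom A X Y" "g \<in> Hom A Y (ob R Z)"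
  shows "hat X Z (Comp A X Y (ob R Z) g f) = Comp B (ob L X) (ob L Y) Z (hat Y Z g) (ar L X Y f)"
proof (rule hat_unique)
  have "Comp A X (ob R (ob L X)) (ob R Z)
      (ar R (ob L X) Z (Comp B (ob L X) (ob L Y) Z (hat Y Z g) (ar L X Y f))) (unit X)
    = Comp A X Y (ob R Z) (Comp A Y (ob R (ob L Y)) (ob R Z) (ar R (ob L Y) Z (hat Y Z g)) (unit Y)) f"
    by (simp add: adj_typing R.ar_comp comp_assoc adj_unit_nat)
  then show "Comp A X (ob R (ob L X)) (ob R Z)
      (ar R (ob L X) Z (Comp B (ob L X) (ob L Y) Z (hat Y Z g) (ar L X Y f))) (unit X)
    = Comp A X Y (ob R Z) g f"
    by (simp add: hat_unit)
qed (simp_all add: adj_typing)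

lemma hat_unit_comp:
  "\<lbrakk>X \<in> Obj A; Y \<in> Obj A; f \<in> Hom A X Y\<rbrakk>
    \<Longrightarrow> hat X (ob L Y) (Comp A X Y (ob R (ob L Y)) (unit Y) f) = ar L X Y f"
  by (simp add: hat_comp hat_adj_unit adj_typing B.comp_ident_left)

text \<open>By naturality of the transpose, the multiplication, which is \<open>R\<close> of a
  counit, absorbs \<open>L g\<close>. This identifies Kleisli extension with \<open>R\<close> of the
  transpose.\<close>

lemma adj_mult_comp:
  assumes "X \<in> Obj A" "Y \<in> Obj A" "g \<in> Hom A X (ob R (ob L Y))"
  shows "Comp A (ob R (ob L X)) (ob R (ob L (ob R (ob L Y)))) (ob R (ob L Y)) (adj_mult A B L R \<phi> Y)
      (ar R (ob L X) (ob L (ob R (ob L Y))) (ar L X (ob R (ob L Y)) g))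
    = ar R (ob L X) (ob L Y) (hat X (ob L Y) g)"
  using assms hat_comp[of X "ob R (ob L Y)" "ob L Y" g "Ident A (ob R (ob L Y))"]
  by (simp add: adj_mult_def Let_def R.ar_comp[symmetric] adj_typing comp_ident_left)

section \<open>Composition, positivity and thunkability in the duploid\<close>

lemma dupl_sel [simp]:
  "Inl a \<in> Obj D \<longleftrightarrow> a \<in> Obj A"
  "Inr b \<in> Obj D \<longleftrightarrow> b \<in> Obj B"
  "Hom D X Y = Hom A (pos R X) (ob R (neg L Y))"
  "Ident D (Inl a) = unit a"
  "Ident D (Inr b) = Ident A (ob R b)"
  "Comp D X (Inl a) Y g f = Comp A (pos R X) (ob R (ob L a)) (ob R (neg L Y))
     (ar R (ob L a) (neg L Y) (hat a (neg L Y) g)) f"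
  "Comp D X (Inr b) Y g f = Comp A (pos R X) (ob R b) (ob R (neg L Y)) g f"
  by (auto simp: dupl_def)

lemma dupl_cases [consumes 1, case_names Inl Inr]:
  assumes "X \<in> Obj D"
  obtains a where "X = Inl a" "a \<in> Obj A" | b where "X = Inr b" "b \<in> Obj B"
  using assms by (auto simp: dupl_def)

lemma pos_Obj: "X \<in> Obj D \<Longrightarrow> pos R X \<in> Obj A"
  by (auto simp: dupl_def R.ob_Obj)

lemma neg_Obj: "X \<in> Obj D \<Longrightarrow> neg L X \<in> Obj B"
  by (auto simp: dupl_def L.ob_Obj)

lemmas dupl_typing = adj_typing pos_Obj neg_Obj

lemma dupl_comp_Hom:
  "\<lbrakk>X \<in> Obj D; Y \<in> Obj D; Z \<in> Obj D; f \<in> Hom D X Y; g \<in> Hom D Y Z\<rbrakk> \<Longrightarrow> Comp D X Y Z g f \<in> Hom D X Z"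
  by (cases Y rule: dupl_cases) (simp_all add: dupl_typing)

lemma nonassoc_category_dupl: "nonassoc_category D"
proof
  show "Ident D X \<in> Hom D X X" if "X \<in> Obj D" for X
    using that by (cases X rule: dupl_cases) (simp_all add: dupl_typing)
  fix X Y f assume *: "X \<in> Obj D" "Y \<in> Obj D" "f \<in> Hom D X Y"
  show "Comp D X Y Y (Ident D Y) f = f"
    using *(2)
    by (cases Y rule: dupl_cases)
      (use * in \<open>simp_all add: dupl_typing hat_adj_unit R.ar_ident comp_ident_left\<close>)
  show "Comp D X X Y f (Ident D X) = f"
    using *(1)
    by (cases X rule: dupl_cases)
      (use * in \<open>simp_all add: dupl_typing hat_unit comp_ident_right\<close>)
qed (rule dupl_comp_Hom)

text \<open>Composing with \<open>h\<close> at an object of A is postcomposition with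
  \<open>R\<close> of its transpose. This respects transposition of \<open>g\<close>, by
  \<open>hat_comp_R\<close>, as well as plain composition in A, so it commutes with both kinds of
  composite.\<close>

lemma positive_Inl:
  assumes [simp]: "a \<in> Obj A"
  shows "positive D (Inl a)"
  unfolding positive_def linear_def
proof (intro ballI)
  fix Y h V U f g
  assume [simp]: "Y \<in> Obj D" and h: "h \<in> Hom D (Inl a) Y" and [simp]: "V \<in> Obj D" and U: "U \<in> Obj D"
    and f: "f \<in> Hom D V U" and g: "g \<in> Hom D U (Inl a)"
  show "Comp D V U Y (Comp D U (Inl a) Y h g) f = Comp D V (Inl a) Y h (Comp D V U (Inl a) g f)"
    using U
    by (cases U rule: dupl_cases)
      (use f g h in \<open>simp_all add: dupl_typing hat_comp_R R.ar_comp comp_assoc\<close>)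
qed

lemma positive_Inr_unit:
  assumes b [simp]: "b \<in> Obj B" and "positive D (Inr b)"
  shows "Comp A (ob R (ob L (ob R b))) (ob R b) (ob R (ob L (ob R b))) (unit (ob R b))
      (ar R (ob L (ob R b)) b (hat (ob R b) b (Ident A (ob R b))))
    = Ident A (ob R (ob L (ob R b)))"
proof -
  let ?Rb = "ob R b"
  have "linear D (Inr b) (Inl ?Rb) (unit ?Rb)"
    using assms(2) unfolding positive_def by (simp add: dupl_typing)
  \<comment> \<open>Linearity of the unit, read as a morphism from \<open>Inr b\<close> to
    \<open>Inl (R b)\<close>, is applied to two identities of A. The identity on \<open>R b\<close>
    serves as a morphism from \<open>Inl (R b)\<close> to \<open>Inr b\<close>, and the identity on
    \<open>R (L (R b))\<close> as one from \<open>Inr (L (R b))\<close> to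
    \<open>Inl (R b)\<close>.\<close>
  then have "Comp D (Inr (ob L ?Rb)) (Inl ?Rb) (Inl ?Rb)
      (Comp D (Inl ?Rb) (Inr b) (Inl ?Rb) (unit ?Rb) (Ident A ?Rb)) (Ident A (ob R (ob L ?Rb)))
    = Comp D (Inr (ob L ?Rb)) (Inr b) (Inl ?Rb) (unit ?Rb)
      (Comp D (Inr (ob L ?Rb)) (Inl ?Rb) (Inr b) (Ident A ?Rb) (Ident A (ob R (ob L ?Rb))))"
    unfolding linear_def by (simp add: dupl_typing del: dupl_sel(6,7))
  then show ?thesis
    by (simp add: dupl_typing comp_ident_right hat_adj_unit R.ar_ident)
qed

lemma unit_hat_ident:
  assumes "b \<in> Obj B"
  shows "Comp A (ob R b) (ob R (ob L (ob R b))) (ob R b)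
      (ar R (ob L (ob R b)) b (hat (ob R b) b (Ident A (ob R b)))) (unit (ob R b))
    = Ident A (ob R b)"
  using assms by (simp add: hat_unit dupl_typing)

lemma thunkable_Inr:
  assumes [simp]: "X \<in> Obj D" "b \<in> Obj B" and f: "f \<in> Hom D X (Inr b)"
  shows "thunkable D X (Inr b) f"
  unfolding thunkable_def
proof (intro ballI)
  fix Z W g h
  assume Z: "Z \<in> Obj D" and [simp]: "W \<in> Obj D" and g: "g \<in> Hom D (Inr b) Z" and h: "h \<in> Hom D Z W"
  show "Comp D X (Inr b) W (Comp D (Inr b) Z W h g) f = Comp D X Z W h (Comp D X (Inr b) Z g f)"
    using Z
    by (cases Z rule: dupl_cases) (use f g h in \<open>simp_all add: dupl_typing comp_assoc\<close>)
qed

text \<open>The condition \<open>kthunkable\<close> for the monad RL, spelled out in terms of the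
  adjunction so that it is available without a strength.\<close>

definition equalizes_units :: "'oa \<Rightarrow> 'oa \<Rightarrow> 'a \<Rightarrow> bool" where
  "equalizes_units X Y f \<longleftrightarrow>
     Comp A X (ob R (ob L Y)) (ob R (ob L (ob R (ob L Y))))
       (ar R (ob L Y) (ob L (ob R (ob L Y))) (ar L Y (ob R (ob L Y)) (unit Y))) f
     = Comp A X (ob R (ob L Y)) (ob R (ob L (ob R (ob L Y)))) (unit (ob R (ob L Y))) f"

text \<open>Bracketing matters only when the intermediate object \<open>Z\<close> lies in B. Among
  these tests there is a universal one, made of two units, and it states exactly that
  \<open>f\<close> equalizes them.\<close>

lemma thunkable_Inl_iff:
  assumes [simp]: "X \<in> Obj D" "a \<in> Obj A" and f: "f \<in> Hom D X (Inl a)"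
  shows "thunkable D X (Inl a) f \<longleftrightarrow> equalizes_units (pos R X) a f"
proof
  let ?T = "\<lambda>a. ob R (ob L a)"
  assume "thunkable D X (Inl a) f"
  \<comment> \<open>The universal test: the unit at \<open>a\<close> as a morphism to
    \<open>Inr (L a)\<close>, followed by the unit at \<open>R (L a)\<close> as a morphism back to
    an object of A.\<close>
  then have "Comp D X (Inl a) (Inl (?T a)) (Comp D (Inl a) (Inr (ob L a)) (Inl (?T a)) (unit (?T a)) (unit a)) f
      = Comp D X (Inr (ob L a)) (Inl (?T a)) (unit (?T a)) (Comp D X (Inl a) (Inr (ob L a)) (unit a) f)"
    unfolding thunkable_def by (simp add: dupl_typing del: dupl_sel(6,7))
  then show "equalizes_units (pos R X) a f"
    using f by (simp add: equalizes_units_def dupl_typing hat_unit_comp hat_adj_unit R.ar_ident comp_ident_left)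
next
  let ?T = "\<lambda>a. ob R (ob L a)"
  assume eq: "equalizes_units (pos R X) a f"
  show "thunkable D X (Inl a) f"
    unfolding thunkable_def
  proof (intro ballI)
    fix Z W g h
    assume Z: "Z \<in> Obj D" and W [simp]: "W \<in> Obj D" and g: "g \<in> Hom D (Inl a) Z" and h: "h \<in> Hom D Z W"
    show "Comp D X (Inl a) W (Comp D (Inl a) Z W h g) f = Comp D X Z W h (Comp D X (Inl a) Z g f)"
      using Z
    proof (cases Z rule: dupl_cases)
      case (Inl c)
      then show ?thesis
        using f g h by (simp add: dupl_typing hat_comp_R R.ar_comp comp_assoc)
    next
      case (Inr b)
      let ?P = "pos R X" and ?W = "neg L W" and ?Rb = "ob R b"
      let ?Rh = "ar R (ob L ?Rb) ?W (hat ?Rb ?W h)" and ?Rg = "ar R (ob L a) b (hat a b g)"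
      have [simp]: "b \<in> Obj B" "f \<in> Hom A ?P (?T a)" "g \<in> Hom A a ?Rb" "h \<in> Hom A ?Rb (ob R ?W)"
        "?Rg \<in> Hom A (?T a) ?Rb" "?Rh \<in> Hom A (?T ?Rb) (ob R ?W)"
        using Inr f g h by (simp_all add: dupl_typing)
      let ?TRg = "ar R (ob L (?T a)) (ob L ?Rb) (ar L (?T a) ?Rb ?Rg)"
      \<comment> \<open>Writing \<open>h\<close> as \<open>R\<close> of its transpose after a unit
        produces a unit that naturality moves next to \<open>f\<close>, where the equalizing
        condition applies.\<close>
      have "Comp A ?P ?Rb (ob R ?W) h (Comp A ?P (?T a) ?Rb ?Rg f)
        = Comp A ?P ?Rb (ob R ?W) (Comp A ?Rb (?T ?Rb) (ob R ?W) ?Rh (unit ?Rb)) (Comp A ?P (?T a) ?Rb ?Rg f)"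
        by (simp add: hat_unit dupl_typing)
      also have "\<dots> = Comp A ?P (?T ?Rb) (ob R ?W) ?Rh
          (Comp A ?P (?T a) (?T ?Rb) (Comp A (?T a) ?Rb (?T ?Rb) (unit ?Rb) ?Rg) f)"
        by (simp add: comp_assoc dupl_typing)
      also have "\<dots> = Comp A ?P (?T ?Rb) (ob R ?W) ?Rh
          (Comp A ?P (?T (?T a)) (?T ?Rb) ?TRg (Comp A ?P (?T a) (?T (?T a)) (unit (?T a)) f))"
        by (simp add: adj_unit_nat[symmetric] comp_assoc dupl_typing)
      also have "Comp A ?P (?T a) (?T (?T a)) (unit (?T a)) f = Comp A ?P (?T a) (?T (?T a))
          (ar R (ob L a) (ob L (?T a)) (ar L a (?T a) (unit a))) f"
        using eq by (simp add: equalizes_units_def)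
      also have "Comp A ?P (?T ?Rb) (ob R ?W) ?Rh (Comp A ?P (?T (?T a)) (?T ?Rb) ?TRg \<dots>)
        = Comp A ?P (?T a) (ob R ?W) (ar R (ob L a) ?W (Comp B (ob L a) (ob L ?Rb) ?W (hat ?Rb ?W h)
            (ar L a ?Rb (Comp A a (?T a) ?Rb ?Rg (unit a))))) f"
        by (simp add: comp_assoc L.ar_comp R.ar_comp dupl_typing)
      also have "\<dots> = Comp A ?P (?T a) (ob R ?W) (ar R (ob L a) ?W
          (hat a ?W (Comp A a ?Rb (ob R ?W) h g))) f"
        by (simp add: hat_unit hat_comp dupl_typing)
      finally show ?thesis
        using Inr by simp
    qed
  qed
qed

section \<open>From duploid morphisms to Kleisli maps\<close>

abbreviation circ :: "'oa + 'ob \<Rightarrow> 'oa + 'ob \<Rightarrow> 'a \<Rightarrow> 'a" where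
  "circ \<equiv> dupl_circ A B L R \<phi>"

lemma circ_Inl [simp]: "circ X (Inl a) f = f"
  by (simp add: dupl_circ_def)

lemma circ_Inr [simp]:
  "circ X (Inr b) f = Comp A (pos R X) (ob R b) (ob R (ob L (ob R b))) (unit (ob R b)) f"
  by (simp add: dupl_circ_def)

lemma circ_Hom:
  "\<lbrakk>X \<in> Obj D; Y \<in> Obj D; f \<in> Hom D X Y\<rbrakk> \<Longrightarrow> circ X Y f \<in> Hom A (pos R X) (ob R (ob L (pos R Y)))"
  by (cases Y rule: dupl_cases) (simp_all add: dupl_typing)

text \<open>For \<open>Y\<close> in B both sides are always true: the left one by
  \<open>thunkable_Inr\<close>, the right one because \<open>circ\<close> ends in a unit, which
  equalizes by naturality.\<close>

lemma thunkable_iff_circ: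
  assumes [simp]: "X \<in> Obj D" and Y: "Y \<in> Obj D" and f: "f \<in> Hom D X Y"
  shows "thunkable D X Y f \<longleftrightarrow> equalizes_units (pos R X) (pos R Y) (circ X Y f)"
  using Y
proof (cases Y rule: dupl_cases)
  case (Inl a)
  then show ?thesis
    using f thunkable_Inl_iff[of X a f] by simp
next
  case (Inr b)
  have "equalizes_units (pos R X) (ob R b)
      (Comp A (pos R X) (ob R b) (ob R (ob L (ob R b))) (unit (ob R b)) f)"
    using f Inr unfolding equalizes_units_def
    by (simp add: comp_assoc[symmetric] adj_unit_nat dupl_typing)
  then show ?thesis
    using Inr f thunkable_Inr[of X b f] by simp
qed

text \<open>The case that needs thunkability of \<open>f\<close> has \<open>Y\<close> in A and
  \<open>Z\<close> in B. There the unit appended by \<open>circ\<close> must be moved inside the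
  composite with \<open>g\<close>.\<close>

lemma circ_comp:
  assumes [simp]: "X \<in> Obj D" and Y: "Y \<in> Obj D" and Z: "Z \<in> Obj D"
    and f: "f \<in> Hom D X Y" "thunkable D X Y f" and g: "g \<in> Hom D Y Z"
  shows "circ X Z (Comp D X Y Z g f)
    = Comp A (pos R X) (ob R (ob L (pos R Y))) (ob R (ob L (pos R Z)))
        (ar R (ob L (pos R Y)) (ob L (pos R Z)) (hat (pos R Y) (ob L (pos R Z)) (circ Y Z g))) (circ X Y f)"
  using Y
proof (cases Y rule: dupl_cases)
  case (Inl a)
  note [simp] = Inl
  show ?thesis
    using Z
  proof (cases Z rule: dupl_cases)
    case (Inl c)
    then show ?thesis by simp
  next
    case (Inr b)
    let ?T = "\<lambda>a. ob R (ob L a)"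
    have [simp]: "a \<in> Obj A" "b \<in> Obj B" "f \<in> Hom A (pos R X) (?T a)" "g \<in> Hom A a (ob R b)"
      using Inl Inr f g by simp_all
    have "thunkable D X (Inl a) f"
      using f by simp
    \<comment> \<open>The appended unit is itself a duploid morphism from \<open>Inr b\<close> to
      \<open>Inl (R b)\<close>, so thunkability of \<open>f\<close> can be tested on
      \<open>g\<close> followed by it.\<close>
    then have "Comp D X (Inl a) (Inl (ob R b)) (Comp D (Inl a) (Inr b) (Inl (ob R b)) (unit (ob R b)) g) f
      = Comp D X (Inr b) (Inl (ob R b)) (unit (ob R b)) (Comp D X (Inl a) (Inr b) g f)"
      unfolding thunkable_def by (simp add: dupl_typing del: dupl_sel(6,7))
    then show ?thesis
      using Inr by simp
  qed
next
  case (Inr b)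
  show ?thesis
    using Z
    by (cases Z rule: dupl_cases)
      (use f g Inr in \<open>simp_all add: comp_assoc[symmetric] hat_unit dupl_typing\<close>)
qed

lemma thunkable_comp:
  assumes "X \<in> Obj D" "Y \<in> Obj D" "Z \<in> Obj D" "f \<in> Hom D X Y" "g \<in> Hom D Y Z"
    and f: "thunkable D X Y f" and g: "thunkable D Y Z g"
  shows "thunkable D X Z (Comp D X Y Z g f)"
  unfolding thunkable_def
proof (intro ballI)
  fix U V h k
  assume *: "U \<in> Obj D" "V \<in> Obj D" "h \<in> Hom D Z U" "k \<in> Hom D U V"
  have "Comp D X Z V (Comp D Z U V k h) (Comp D X Y Z g f) = Comp D X Y V (Comp D Y Z V (Comp D Z U V k h) g) f"
    using f assms(1-5) * dupl_comp_Hom[of Z U V h k] unfolding thunkable_def by metis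
  also have "\<dots> = Comp D X Y V (Comp D Y U V k (Comp D Y Z U h g)) f"
    using g assms(1-5) * unfolding thunkable_def by metis
  also have "\<dots> = Comp D X U V k (Comp D X Y U (Comp D Y Z U h g) f)"
    using f assms(1-5) * dupl_comp_Hom[of Y Z U g h] unfolding thunkable_def by metis
  also have "\<dots> = Comp D X U V k (Comp D X Z U h (Comp D X Y Z g f))"
    using f assms(1-5) * unfolding thunkable_def by metis
  finally show "Comp D X Z V (Comp D Z U V k h) (Comp D X Y Z g f)
    = Comp D X U V k (Comp D X Z U h (Comp D X Y Z g f))" .
qed

lemma thunkable_ident:
  assumes "X \<in> Obj D"
  shows "thunkable D X X (Ident D X)"
proof -
  interpret D: nonassoc_category D
    by (rule nonassoc_category_dupl)
  show ?thesis
    using assms unfolding thunkable_def by (simp add: D.comp_ident_right D.comp_hom del: dupl_sel)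
qed

lemma circ_bij:
  assumes X [simp]: "X \<in> Obj D" and Y: "Y \<in> Obj D" "positive D Y"
  shows "bij_betw (circ X Y) {f \<in> Hom D X Y. thunkable D X Y f}
    {k \<in> Hom A (pos R X) (ob R (ob L (pos R Y))). equalizes_units (pos R X) (pos R Y) k}"
  using Y(1)
proof (cases Y rule: dupl_cases)
  case (Inl a)
  then show ?thesis
    by (auto intro!: bij_betw_byWitness[where f' = id] simp: thunkable_Inl_iff)
next
  case (Inr b)
  \<comment> \<open>\<open>R\<close> of the counit at \<open>b\<close>. It retracts the unit by a
    triangle identity, and positivity makes it a two-sided inverse; postcomposition with it inverts
    \<open>circ\<close>.\<close>
  let ?r = "ar R (ob L (ob R b)) b (hat (ob R b) b (Ident A (ob R b)))"
  have [simp]: "b \<in> Obj B" "?r \<in> Hom A (ob R (ob L (ob R b))) (ob R b)"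
    using Inr by (simp_all add: dupl_typing)
  note inv = positive_Inr_unit[OF \<open>b \<in> Obj B\<close> Y(2)[unfolded Inr(1)]] unit_hat_ident[OF \<open>b \<in> Obj B\<close>]
  show ?thesis
    by (rule bij_betw_byWitness[where f' = "\<lambda>k. Comp A (pos R X) (ob R (ob L (ob R b))) (ob R b) ?r k"])
      (use Inr thunkable_iff_circ[of X Y] thunkable_Inr[of X b] inv in
        \<open>auto simp: dupl_typing comp_assoc[symmetric] comp_ident_left\<close>)
qed

end


section \<open>Positive objects and thunkable morphisms\<close>

locale strong_duploid = duploid_of_adjunction A B L R \<phi>
    + symmetric_strong_monad A "func_comp R L" "adj_unit B L \<phi>" "adj_mult A B L R \<phi>" st
  for A :: "('oa, 'a, 'x) smoncat_scheme" and B :: "('ob, 'b, 'y) cat_scheme"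
    and L :: "('oa, 'a, 'ob, 'b) func" and R :: "('ob, 'b, 'oa, 'a) func"
    and \<phi> :: "'oa \<Rightarrow> 'ob \<Rightarrow> 'b \<Rightarrow> 'a" and st :: "'oa \<Rightarrow> 'oa \<Rightarrow> 'a"
begin

section \<open>The monoidal category P_t\<close>

abbreviation Pt :: "('oa + 'ob, 'a) moncat" where "Pt \<equiv> dupl_Pt A B L R \<phi> st"

abbreviation T :: "('oa, 'a, 'oa, 'a) func" where "T \<equiv> func_comp R L"

lemma T_sel [simp]:
  "ob T X = ob R (ob L X)"
  "ar T X Y f = ar R (ob L X) (ob L Y) (ar L X Y f)"
  by (simp_all add: func_comp_def)

lemma kcomp_eq:
  assumes "X \<in> Obj A" "Y \<in> Obj A" "Z \<in> Obj A" "f \<in> Hom A X (ob T Y)" "g \<in> Hom A Y (ob T Z)"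
  shows "kcomp X Y Z g f
    = Comp A X (ob R (ob L Y)) (ob R (ob L Z)) (ar R (ob L Y) (ob L Z) (hat Y (ob L Z) g)) f"
  using assms by (simp add: kcomp_def adj_mult_comp)

lemma kthunkable_eq:
  "\<lbrakk>X \<in> Obj A; Y \<in> Obj A; f \<in> Hom A X (ob T Y)\<rbrakk> \<Longrightarrow> kthunkable X Y f \<longleftrightarrow> equalizes_units X Y f"
  by (simp add: kthunkable_iff equalizes_units_def)

text \<open>The associator ends in an object of A, where lifting is \<open>pure\<close>. The unitors
  end in \<open>X\<close>, which may lie in B, and keep the general form of the lift.\<close>

lemma Pt_sel [simp]:
  "X \<in> Obj Pt \<longleftrightarrow> X \<in> Obj D \<and> positive D X"
  "Hom Pt X Y = {f \<in> Hom D X Y. thunkable D X Y f}"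
  "Ident Pt X = Ident D X"
  "Comp Pt = Comp D"
  "X \<otimes>\<^bsub>Pt\<^esub> Y = Inl (pos R X \<otimes>\<^bsub>A\<^esub> pos R Y)"
  "\<one>\<^bsub>Pt\<^esub> = Inl \<one>\<^bsub>A\<^esub>"
  "assoc Pt X Y Z = pure ((pos R X \<otimes>\<^bsub>A\<^esub> pos R Y) \<otimes>\<^bsub>A\<^esub> pos R Z)
     (pos R X \<otimes>\<^bsub>A\<^esub> (pos R Y \<otimes>\<^bsub>A\<^esub> pos R Z)) (assoc A (pos R X) (pos R Y) (pos R Z))"
  "lunit Pt X = Comp A (\<one>\<^bsub>A\<^esub> \<otimes>\<^bsub>A\<^esub> pos R X) (pos R X) (ob R (neg L X)) (Ident D X) (lunit A (pos R X))"
  "runit Pt X = Comp A (pos R X \<otimes>\<^bsub>A\<^esub> \<one>\<^bsub>A\<^esub>) (pos R X) (ob R (neg L X)) (Ident D X) (runit A (pos R X))"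
  by (simp_all add: dupl_Pt_def Let_def dupl_lift_def pure_def)

lemma Pt_tensA:
  assumes "X \<in> Obj D" "X' \<in> Obj D" "Y \<in> Obj D" "Y' \<in> Obj D" "f \<in> Hom D X X'" "g \<in> Hom D Y Y'"
  shows "tensA Pt X X' Y Y' f g
    = ktens (pos R X) (pos R X') (pos R Y) (pos R Y') (circ X X' f) (circ Y Y' g)"
  using assms double_strength_tensA[of "pos R X" "pos R X'" "pos R Y" "pos R Y'" "circ X X' f" "circ Y Y' g"]
  by (simp add: dupl_Pt_def Let_def pos_Obj circ_Hom)

text \<open>Lifting to an object of A composes with the unit at once; for an object of B it is
  \<open>circ\<close> that adds it. The Kleisli map is the same, so the unitors of P_t correspond to
  those of the Kleisli category.\<close>

lemma circ_lift:
  assumes "P \<in> Obj A" "X \<in> Obj D" "h \<in> Hom A P (pos R X)"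
  shows "circ (Inl P) X (Comp A P (pos R X) (ob R (neg L X)) (Ident D X) h) = pure P (pos R X) h"
  using assms(2)
  by (cases X rule: dupl_cases) (use assms in \<open>simp_all add: pure_def comp_ident_left dupl_typing\<close>)

lemma lift_Hom:
  assumes "P \<in> Obj A" "X \<in> Obj D" "h \<in> Hom A P (pos R X)"
  shows "Comp A P (pos R X) (ob R (neg L X)) (Ident D X) h \<in> Hom D (Inl P) X"
  using assms(2)
  by (cases X rule: dupl_cases) (use assms in \<open>simp_all add: dupl_typing\<close>)

lemma thunkable_lift:
  assumes "P \<in> Obj A" "X \<in> Obj D" "h \<in> Hom A P (pos R X)"
  shows "thunkable D (Inl P) X (Comp A P (pos R X) (ob R (neg L X)) (Ident D X) h)"
  using assms lift_Hom[OF assms] kthunkable_pure[of P "pos R X" h] pure_Hom[of P "pos R X" h]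
  by (simp add: thunkable_iff_circ circ_lift pos_Obj kthunkable_eq)

lemma thunkable_pure:
  assumes "P \<in> Obj A" "Q \<in> Obj A" "h \<in> Hom A P Q"
  shows "thunkable D (Inl P) (Inl Q) (pure P Q h)"
  using thunkable_lift[of P "Inl Q" h] assms by (simp add: pure_def)

lemma kthunkable_circ:
  assumes "X \<in> Obj D" "Y \<in> Obj D" "f \<in> Hom D X Y" "thunkable D X Y f"
  shows "kthunkable (pos R X) (pos R Y) (circ X Y f)"
  using assms circ_Hom[of X Y f] thunkable_iff_circ[of X Y f] by (simp add: kthunkable_eq pos_Obj)

lemma tensA_Pt_Hom:
  assumes "X \<in> Obj D" "X' \<in> Obj D" "Y \<in> Obj D" "Y' \<in> Obj D" "f \<in> Hom D X X'" "g \<in> Hom D Y Y'"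
    "thunkable D X X' f" "thunkable D Y Y' g"
  shows "tensA Pt X X' Y Y' f g \<in> Hom Pt (X \<otimes>\<^bsub>Pt\<^esub> Y) (X' \<otimes>\<^bsub>Pt\<^esub> Y')"
proof -
  let ?k = "ktens (pos R X) (pos R X') (pos R Y) (pos R Y') (circ X X' f) (circ Y Y' g)"
  have k: "?k \<in> Hom A (pos R X \<otimes>\<^bsub>A\<^esub> pos R Y) (ob T (pos R X' \<otimes>\<^bsub>A\<^esub> pos R Y'))"
    by (rule ktens_Hom) (use assms circ_Hom[of X X' f] circ_Hom[of Y Y' g] in \<open>simp_all add: pos_Obj\<close>)
  have "kthunkable (pos R X \<otimes>\<^bsub>A\<^esub> pos R Y) (pos R X' \<otimes>\<^bsub>A\<^esub> pos R Y') ?k"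
    by (rule kthunkable_ktens)
      (use assms circ_Hom[of X X' f] circ_Hom[of Y Y' g] in \<open>simp_all add: pos_Obj kthunkable_circ\<close>)
  then show ?thesis
    using assms k by (simp add: Pt_tensA thunkable_Inl_iff kthunkable_eq pos_Obj tens_Obj)
qed

lemma monoidal_category_Pt: "monoidal_category Pt"
proof (rule monoidal_category_pullback[OF monoidal_thunkable_kleisli, where p = "pos R" and J = circ])
  fix X Y assume "X \<in> Obj Pt" "Y \<in> Obj Pt"
  then show "bij_betw (circ X Y) (Hom Pt X Y) (Hom thunkable_kleisli (pos R X) (pos R Y))"
    using circ_bij[of X Y] by (simp add: kthunkable_eq pos_Obj cong: conj_cong)
next
  fix X assume "X \<in> Obj Pt"
  then show "circ X X (Ident Pt X) = Ident thunkable_kleisli (pos R X)"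
    by (cases X rule: sum.exhaust) (simp_all add: comp_ident_right dupl_typing)
next
  fix X Y Z f g
  assume "X \<in> Obj Pt" "Y \<in> Obj Pt" "Z \<in> Obj Pt" "f \<in> Hom Pt X Y" "g \<in> Hom Pt Y Z"
  then show "circ X Z (Comp Pt X Y Z g f)
      = Comp thunkable_kleisli (pos R X) (pos R Y) (pos R Z) (circ Y Z g) (circ X Y f)"
    using circ_Hom[of X Y f] circ_Hom[of Y Z g] by (simp add: circ_comp kcomp_eq pos_Obj)
next
  fix X Y Z f g
  assume "X \<in> Obj Pt" "Y \<in> Obj Pt" "Z \<in> Obj Pt" "f \<in> Hom Pt X Y" "g \<in> Hom Pt Y Z"
  then show "Comp Pt X Y Z g f \<in> Hom Pt X Z"
    using dupl_comp_Hom[of X Y Z f g] thunkable_comp[of X Y Z f g] by simp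
next
  fix X assume "X \<in> Obj Pt"
  then show "Ident Pt X \<in> Hom Pt X X"
    using nonassoc_category.ident_hom[OF nonassoc_category_dupl, of X] thunkable_ident[of X] by simp
next
  fix X X' Y Y' f g
  assume "X \<in> Obj Pt" "X' \<in> Obj Pt" "Y \<in> Obj Pt" "Y' \<in> Obj Pt" "f \<in> Hom Pt X X'" "g \<in> Hom Pt Y Y'"
  then show "tensA Pt X X' Y Y' f g \<in> Hom Pt (X \<otimes>\<^bsub>Pt\<^esub> Y) (X' \<otimes>\<^bsub>Pt\<^esub> Y')"
    using tensA_Pt_Hom[of X X' Y Y' f g] by simp
next
  fix X assume "X \<in> Obj Pt"
  then show "lunit Pt X \<in> Hom Pt (\<one>\<^bsub>Pt\<^esub> \<otimes>\<^bsub>Pt\<^esub> X) X" "runit Pt X \<in> Hom Pt (X \<otimes>\<^bsub>Pt\<^esub> \<one>\<^bsub>Pt\<^esub>) X"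
    using lift_Hom[of "\<one>\<^bsub>A\<^esub> \<otimes>\<^bsub>A\<^esub> pos R X" X] lift_Hom[of "pos R X \<otimes>\<^bsub>A\<^esub> \<one>\<^bsub>A\<^esub>" X]
    by (simp_all add: thunkable_lift pos_Obj typing)
next
  fix X assume "X \<in> Obj Pt"
  then show "circ (\<one>\<^bsub>Pt\<^esub> \<otimes>\<^bsub>Pt\<^esub> X) X (lunit Pt X) = lunit thunkable_kleisli (pos R X)"
    "circ (X \<otimes>\<^bsub>Pt\<^esub> \<one>\<^bsub>Pt\<^esub>) X (runit Pt X) = runit thunkable_kleisli (pos R X)"
    by (simp_all add: circ_lift pos_Obj typing)
next
  fix X Y Z assume "X \<in> Obj Pt" "Y \<in> Obj Pt" "Z \<in> Obj Pt"
  then show "assoc Pt X Y Z \<in> Hom Pt (X \<otimes>\<^bsub>Pt\<^esub> Y \<otimes>\<^bsub>Pt\<^esub> Z) (X \<otimes>\<^bsub>Pt\<^esub> (Y \<otimes>\<^bsub>Pt\<^esub> Z))"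
    using pure_Hom[of "pos R X \<otimes>\<^bsub>A\<^esub> pos R Y \<otimes>\<^bsub>A\<^esub> pos R Z" "pos R X \<otimes>\<^bsub>A\<^esub> (pos R Y \<otimes>\<^bsub>A\<^esub> pos R Z)"]
    by (simp add: thunkable_pure pos_Obj typing)
qed (simp_all add: positive_Inl pos_Obj typing Pt_tensA)

section \<open>The strict monoidal functor from A to P_t\<close>

definition pure_functor :: "('oa, 'a, 'oa + 'ob, 'a) func" where
  "pure_functor = \<lparr>ob = Inl, ar = pure\<rparr>"

lemma pure_functor_sel [simp]: "ob pure_functor X = Inl X" "ar pure_functor X Y f = pure X Y f"
  by (simp_all add: pure_functor_def)

lemma cat_functor_pure: "cat_functor A Pt pure_functor"
proof -
  interpret Pt: monoidal_category Pt
    by (rule monoidal_category_Pt)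
  show ?thesis
  proof unfold_locales
    fix X Y Z f g
    assume "X \<in> Obj A" "Y \<in> Obj A" "Z \<in> Obj A" "f \<in> Hom A X Y" "g \<in> Hom A Y Z"
    then show "ar pure_functor X Z (Comp A X Y Z g f)
      = Comp Pt (ob pure_functor X) (ob pure_functor Y) (ob pure_functor Z)
          (ar pure_functor Y Z g) (ar pure_functor X Y f)"
      using pure_Hom[of X Y f] pure_Hom[of Y Z g]
      by (simp add: kcomp_pure_pure[symmetric] kcomp_eq)
  next
    fix X Y f assume "X \<in> Obj A" "Y \<in> Obj A" "f \<in> Hom A X Y"
    then show "ar pure_functor X Y f \<in> Hom Pt (ob pure_functor X) (ob pure_functor Y)"
      using pure_Hom[of X Y f] by (simp add: thunkable_pure)
  qed (simp_all add: positive_Inl pure_ident)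
qed

lemma strong_monoidal_pure_comp:
  assumes "strong_monoidal_functor C A F m2 m0"
  shows "strong_monoidal_functor C Pt (func_comp pure_functor F)
    (\<lambda>X Y. pure (ob F X \<otimes>\<^bsub>A\<^esub> ob F Y) (ob F (X \<otimes>\<^bsub>C\<^esub> Y)) (m2 X Y)) (pure \<one>\<^bsub>A\<^esub> (ob F \<one>\<^bsub>C\<^esub>) m0)"
proof -
  have "tensA Pt (Inl X) (Inl X') (Inl Y) (Inl Y') (pure X X' f) (pure Y Y' g)
      = pure (X \<otimes>\<^bsub>A\<^esub> Y) (X' \<otimes>\<^bsub>A\<^esub> Y') (tensA A X X' Y Y' f g)"
    if "X \<in> Obj A" "X' \<in> Obj A" "Y \<in> Obj A" "Y' \<in> Obj A" "f \<in> Hom A X X'" "g \<in> Hom A Y Y'"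
    for X X' Y Y' f g
    using that pure_Hom[of X X' f] pure_Hom[of Y Y' g] by (simp add: Pt_tensA ktens_pure)
  then show ?thesis
    using strong_monoidal_functor_strict[OF assms monoidal_category_Pt cat_functor_pure]
    by (simp add: pure_def)
qed

end


section \<open>The direct linear-non-linear adjunction\<close>

locale lnl_duploid = strong_duploid A B L R \<phi> st
  + M: category_with_finite_products M + LNL: relative_lnl_coadjunction A B R M Lin m2 m0 Mult \<Psi>
  for A :: "('oa, 'a, 'x) smoncat_scheme" and B :: "('ob, 'b, 'y) cat_scheme"
    and M :: "('om, 'm, 'z) prodcat_scheme"
    and L :: "('oa, 'a, 'ob, 'b) func" and R :: "('ob, 'b, 'oa, 'a) func"
    and \<phi> :: "'oa \<Rightarrow> 'ob \<Rightarrow> 'b \<Rightarrow> 'a" and st :: "'oa \<Rightarrow> 'oa \<Rightarrow> 'a"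
    and Lin :: "('om, 'm, 'oa, 'a) func" and m2 :: "'om \<Rightarrow> 'om \<Rightarrow> 'a" and m0 :: 'a
    and Mult :: "('ob, 'b, 'om, 'm) func" and \<Psi> :: "'om \<Rightarrow> 'ob \<Rightarrow> 'a \<Rightarrow> 'm"
begin

section \<open>The counit of the coadjunction\<close>

lemma cartesian_sel [simp]:
  "Obj (cartesian M) = Obj M" "Hom (cartesian M) = Hom M" "Ident (cartesian M) = Ident M"
  "Comp (cartesian M) = Comp M" "X \<otimes>\<^bsub>cartesian M\<^esub> Y = prodO M X Y" "\<one>\<^bsub>cartesian M\<^esub> = terminal M"
  by (simp_all add: cartesian_def)

abbreviation counit :: "'ob \<Rightarrow> 'a" where "counit \<equiv> lnl_counit A R M Lin Mult \<Psi>"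

lemmas Lin_ob = LNL.Lin.ob_Obj[simplified]
lemmas Lin_ar = LNL.Lin.ar_Hom[simplified]

lemma counit_Hom: "b \<in> Obj B \<Longrightarrow> counit b \<in> Hom A (ob Lin (ob Mult b)) (ob R b)"
  unfolding lnl_counit_def using LNL.\<Psi>_bij[of "ob Mult b" b]
  by (metis LNL.Mult.ob_Obj M.ident_hom bij_betw_def subset_refl the_inv_into_into)

lemma \<Psi>_counit: "b \<in> Obj B \<Longrightarrow> \<Psi> (ob Mult b) b (counit b) = Ident M (ob Mult b)"
  unfolding lnl_counit_def using LNL.\<Psi>_bij[of "ob Mult b" b]
  by (metis LNL.Mult.ob_Obj M.ident_hom bij_betw_def f_the_inv_into_f)

lemma \<Psi>_Hom: "\<lbrakk>X \<in> Obj M; Y \<in> Obj B; h \<in> Hom A (ob Lin X) (ob R Y)\<rbrakk> \<Longrightarrow> \<Psi> X Y h \<in> Hom M X (ob Mult Y)"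
  using LNL.\<Psi>_bij[of X Y] by (auto simp: bij_betw_def)

text \<open>The counit is universal: by naturality in M, \<open>\<Psi>\<close> sends the composite
  to an identity followed by \<open>\<Psi> X Y h\<close>, and \<open>\<Psi>\<close> is
  injective.\<close>

lemma counit_Lin_\<Psi>:
  assumes [simp]: "X \<in> Obj M" "Y \<in> Obj B" "h \<in> Hom A (ob Lin X) (ob R Y)"
  shows "Comp A (ob Lin X) (ob Lin (ob Mult Y)) (ob R Y) (counit Y) (ar Lin X (ob Mult Y) (\<Psi> X Y h)) = h"
proof -
  have "\<Psi> X Y (Comp A (ob Lin X) (ob Lin (ob Mult Y)) (ob R Y) (counit Y) (ar Lin X (ob Mult Y) (\<Psi> X Y h)))
      = \<Psi> X Y h"
    by (simp add: LNL.\<Psi>_nat_left counit_Hom \<Psi>_Hom LNL.Mult.ob_Obj \<Psi>_counit M.comp_ident_left)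
  then show ?thesis
    using LNL.\<Psi>_bij[of X Y]
    by (auto simp: bij_betw_def counit_Hom \<Psi>_Hom Lin_ar Lin_ob LNL.Mult.ob_Obj dupl_typing
        elim!: inj_onD)
qed

section \<open>The positive adjunction and the monoidal structure of its left adjoint\<close>

abbreviation LinD :: "('om, 'm, 'oa + 'ob, 'a) func" where "LinD \<equiv> dupl_Lin A B L R \<phi> Lin"

abbreviation MultD :: "('oa + 'ob, 'a, 'om, 'm) func" where
  "MultD \<equiv> dupl_Mult A B L R \<phi> M Lin Mult \<Psi>"

lemma LinD_sel [simp]:
  "ob LinD X = Inl (ob Lin X)"
  "ar LinD X X' f = Comp A (ob Lin X) (ob Lin X') (ob R (ob L (ob Lin X'))) (unit (ob Lin X')) (ar Lin X X' f)"
  by (simp_all add: dupl_Lin_def)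

lemma MultD_sel [simp]:
  "ob MultD X = ob Mult (neg L X)"
  "ar MultD (Inl a) Y f = ar Mult (ob L a) (neg L Y) (hat a (neg L Y) f)"
  "ar MultD (Inr b) Y f = \<Psi> (ob Mult b) (neg L Y)
     (Comp A (ob Lin (ob Mult b)) (ob R b) (ob R (neg L Y)) f (counit b))"
  by (simp_all add: dupl_Mult_def)

lemmas lnl_typing = dupl_typing Lin_ob Lin_ar LNL.Mult.ob_Obj LNL.Mult.ar_Hom
  M.ident_hom M.comp_hom counit_Hom \<Psi>_Hom

lemma positive_adjunction_LinD: "positive_adjunction M D LinD MultD (\<lambda>X Y. \<Psi> X (neg L Y))"
proof -
  interpret D: nonassoc_category D
    by (rule nonassoc_category_dupl)
  show ?thesis
  proof unfold_locales
    fix X Y f assume "X \<in> Obj M" "Y \<in> Obj M" "f \<in> Hom M X Y"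
    then show "ar LinD X Y f \<in> Hom D (ob LinD X) (ob LinD Y)"
      by (simp add: lnl_typing)
  next
    fix X Y f assume X: "X \<in> Obj D" and *: "Y \<in> Obj D" "f \<in> Hom D X Y"
    show "ar MultD X Y f \<in> Hom M (ob MultD X) (ob MultD Y)"
      using X by (cases X rule: dupl_cases) (use * in \<open>simp_all add: lnl_typing\<close>)
  next
    fix X assume X: "X \<in> Obj D"
    then show "ar MultD X X (Ident D X) = Ident M (ob MultD X)"
      by (cases X rule: dupl_cases)
        (simp_all add: hat_adj_unit LNL.Mult.ar_ident comp_ident_left \<Psi>_counit lnl_typing)
  next
    fix X Y Z h g
    assume X: "X \<in> Obj M" and Y: "Y \<in> Obj D" and Z: "Z \<in> Obj D"
      and h: "h \<in> Hom D (ob LinD X) Y" and g: "g \<in> Hom D Y Z"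
    show "\<Psi> X (neg L Z) (Comp D (ob LinD X) Y Z g h)
      = Comp M X (ob MultD Y) (ob MultD Z) (ar MultD Y Z g) (\<Psi> X (neg L Y) h)"
      using Y
    proof (cases Y rule: dupl_cases)
      case (Inl a)
      then show ?thesis
        using X Z h g by (simp add: LNL.\<Psi>_nat_right lnl_typing)
    next
      case (Inr b)
      let ?LX = "ob Lin X" and ?LMb = "ob Lin (ob Mult b)" and ?Z = "neg L Z"
      \<comment> \<open>Here \<open>g\<close> need not be \<open>R\<close> of a morphism of B, so
        \<open>h\<close> is factored through the counit instead. What remains is precomposition with
        the image of \<open>\<Psi> X b h\<close> under \<open>Lin\<close>, and naturality in M
        applies.\<close>
      have "Comp A ?LX (ob R b) (ob R ?Z) g h = Comp A ?LX (ob R b) (ob R ?Z) g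
          (Comp A ?LX ?LMb (ob R b) (counit b) (ar Lin X (ob Mult b) (\<Psi> X b h)))"
        using X h Inr by (simp add: counit_Lin_\<Psi>)
      also have "\<dots> = Comp A ?LX ?LMb (ob R ?Z) (Comp A ?LMb (ob R b) (ob R ?Z) g (counit b))
          (ar Lin X (ob Mult b) (\<Psi> X b h))"
        using X Z h g Inr by (simp add: comp_assoc lnl_typing)
      finally show ?thesis
        using X Z h g Inr by (simp add: LNL.\<Psi>_nat_left lnl_typing)
    qed
  next
    fix W X Y f h
    assume *: "W \<in> Obj M" "X \<in> Obj M" "Y \<in> Obj D" "f \<in> Hom M W X" "h \<in> Hom D (ob LinD X) Y"
    let ?LW = "ob Lin W" and ?LX = "ob Lin X" and ?Y = "neg L Y"
    \<comment> \<open>The unit in \<open>LinD\<close> is absorbed by the transpose of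
      \<open>h\<close>, so this composite is plain precomposition with \<open>Lin f\<close>.\<close>
    have "Comp D (ob LinD W) (ob LinD X) Y h (ar LinD W X f) = Comp A ?LW ?LX (ob R ?Y)
        (Comp A ?LX (ob R (ob L ?LX)) (ob R ?Y) (ar R (ob L ?LX) ?Y (hat ?LX ?Y h)) (unit ?LX)) (ar Lin W X f)"
      using * by (simp add: comp_assoc lnl_typing)
    also have "\<dots> = Comp A ?LW ?LX (ob R ?Y) h (ar Lin W X f)"
      using * by (simp add: hat_unit lnl_typing)
    finally show "\<Psi> W (neg L Y) (Comp D (ob LinD W) (ob LinD X) Y h (ar LinD W X f))
      = Comp M W X (ob MultD Y) (\<Psi> X (neg L Y) h) f"
      using * by (simp add: LNL.\<Psi>_nat_left lnl_typing)
  next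
    fix X Y assume "X \<in> Obj M" "Y \<in> Obj D"
    then show "bij_betw (\<Psi> X (neg L Y)) (Hom D (ob LinD X) Y) (Hom M X (ob MultD Y))"
      using LNL.\<Psi>_bij[of X "neg L Y"] by (simp add: lnl_typing)
  qed (simp_all add: lnl_typing positive_Inl LNL.Lin.ar_ident[simplified] comp_ident_right)
qed

lemma strong_monoidal_LinD:
  "strong_monoidal_functor (cartesian M) Pt LinD
    (\<lambda>X Y. dupl_lift A B L R \<phi> (ob Lin X \<otimes>\<^bsub>A\<^esub> ob Lin Y) (Inl (ob Lin (prodO M X Y))) (m2 X Y))
    (dupl_lift A B L R \<phi> \<one>\<^bsub>A\<^esub> (Inl (ob Lin (terminal M))) m0)"
proof -
  have "func_comp pure_functor Lin = LinD"
    by (simp add: func_comp_def[of pure_functor] dupl_Lin_def pure_def fun_eq_iff)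
  then show ?thesis
    using strong_monoidal_pure_comp[OF LNL.Lin.strong_monoidal_functor_axioms]
    by (simp add: dupl_lift_def pure_def)
qed

end

theorem proposition37:
  fixes A :: "('oa, 'a) smoncat" and B :: "('ob, 'b) cat" and M :: "('om, 'm) prodcat"
    and L :: "('oa, 'a, 'ob, 'b) func" and R :: "('ob, 'b, 'oa, 'a) func"
    and \<phi> :: "'oa \<Rightarrow> 'ob \<Rightarrow> 'b \<Rightarrow> 'a" and st :: "'oa \<Rightarrow> 'oa \<Rightarrow> 'a"
    and Lin :: "('om, 'm, 'oa, 'a) func" and m2 :: "'om \<Rightarrow> 'om \<Rightarrow> 'a" and m0 :: 'a
    and Mult :: "('ob, 'b, 'om, 'm) func" and \<Psi> :: "'om \<Rightarrow> 'ob \<Rightarrow> 'a \<Rightarrow> 'm"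
  assumes "symmetric_monoidal_category A" and "category B"
    and "cat_functor A B L" and "cat_functor B A R" and "adjunction A B L R \<phi>"
    and "strong_monad A (func_comp R L) (adj_unit B L \<phi>) (adj_mult A B L R \<phi>) st"
    and "relative_lnl_coadjunction A B R M Lin m2 m0 Mult \<Psi>"
  shows "positive_adjunction M (dupl A B L R \<phi>)
           (dupl_Lin A B L R \<phi> Lin) (dupl_Mult A B L R \<phi> M Lin Mult \<Psi>)
           (\<lambda>X Y. \<Psi> X (neg L Y))
       \<and> strong_monoidal_functor (cartesian M) (dupl_Pt A B L R \<phi> st)
           (dupl_Lin A B L R \<phi> Lin)
           (\<lambda>X Y. dupl_lift A B L R \<phi> (ob Lin X \<otimes>\<^bsub>A\<^esub> ob Lin Y)
                    (Inl (ob Lin (prodO M X Y))) (m2 X Y))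
           (dupl_lift A B L R \<phi> \<one>\<^bsub>A\<^esub> (Inl (ob Lin (terminal M))) m0)"
proof -
  interpret symmetric_monoidal_category A by fact
  interpret B: category B by fact
  interpret adjunction A B L R \<phi> by fact
  interpret strong_monad A "func_comp R L" "adj_unit B L \<phi>" "adj_mult A B L R \<phi>" st by fact
  interpret LNL: relative_lnl_coadjunction A B R M Lin m2 m0 Mult \<Psi> by fact
  interpret L: cat_functor A B L by fact
  interpret lnl_duploid A B M L R \<phi> st Lin m2 m0 Mult \<Psi> ..
  show ?thesis
    using positive_adjunction_LinD strong_monoidal_LinD by blast
qed

end
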